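(* Let $G$ be a nonsingular even integral symmetric $n\times n$ matrix ($n\ge1$), $D=\det G$, $N$ its level, $\mathbf{v}\in\mathbb{Z}^n$, $m\in\mathbb{Z}$ and $c$ a positive integer with $\gcd(D,c)=1$. Then the number $r_{G,\mathbf{v}}(m)$ of $\mathbf{x}\in\mathbb{Z}^n/c\mathbb{Z}^n$ with $\frac12\mathbf{x}^TG\mathbf{x}+\mathbf{v}^T\mathbf{x}\equiv m\pmod c$ equals $$c^{\frac n2-1}\left(\frac Dc\right)_K\sum_{a=0}^{c-1}e\!\left(\frac{n(1-\tilde c_0)}{8}\right)\gcd(a,c)^{\frac n2}\left(\frac{\tilde a}{\tilde c}\right)_K^n\left(\frac{D}{\gcd(a,c)}\right)_K e\!\left(\frac ac\Big(\frac{\tilde c\tilde c'-1}{2}\mathbf{v}^TG^{-1}\mathbf{v}-m\Big)\right),$$ where, for each $a$, $\tilde a=a/\gcd(a,c)$, $\tilde c=c/\gcd(a,c)$, $\tilde c_0$ is the odd part of $\tilde c$, and $\tilde c'$ is an integer with $\tilde c\tilde c'\equiv1\pmod{\tilde aN}$.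
   Context: $e(z)=\exp(2\pi i z)$. Even integral: integer entries, even diagonal. Level: least positive $N$ with $NG^{-1}$ even integral. $(\frac{\cdot}{\cdot})_K$ is the Kronecker–Jacobi symbol (in particular $(\frac{m}{1})_K=1$); $\gcd(0,c)=c$; a congruence modulo $0$ means equality. *)

theory Defs
  imports Complex_Main "HOL-Number_Theory.Number_Theory"
    "Jordan_Normal_Form.Determinant" "Jordan_Normal_Form.Gauss_Jordan_Elimination"
begin

definition e :: "complex \<Rightarrow> complex" where
  "e z = exp (2 * of_real pi * \<i> * z)"

(* Stated for real matrices, so that it also applies to multiples of inverse matrices. *)
definition even_integral :: "real mat \<Rightarrow> bool" where
  "even_integral A \<longleftrightarrow>
     (\<forall>i<dim_row A. \<forall>j<dim_col A. A $$ (i, j) \<in> \<int>) \<and>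
     (\<forall>i<dim_row A. \<exists>k::int. A $$ (i, i) = 2 * of_int k)"

(* Only meaningful for nonsingular square matrices; otherwise mat_inverse returns None. *)
definition inv_mat :: "int mat \<Rightarrow> real mat" where
  "inv_mat G = the (mat_inverse (map_mat real_of_int G))"

definition level :: "int mat \<Rightarrow> nat" where
  "level G = (LEAST N. 0 < N \<and> even_integral (of_nat N \<cdot>\<^sub>m inv_mat G))"

(* The local factor at a prime p: the Legendre symbol for odd p, and the Kronecker
   convention for p = 2. *)
definition kronecker_prime :: "int \<Rightarrow> int \<Rightarrow> int" where
  "kronecker_prime a p =
     (if p = 2 then (if even a then 0 else if a mod 8 = 1 \<or> a mod 8 = 7 then 1 else -1)
      else Legendre a p)"

(* The factor in front of the product is the symbol at the unit sgn b. *)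
definition kronecker :: "int \<Rightarrow> int \<Rightarrow> int" where
  "kronecker a b =
     (if b = 0 then (if \<bar>a\<bar> = 1 then 1 else 0)
      else (if b < 0 \<and> a < 0 then -1 else 1) *
           (\<Prod>p\<in>prime_factors b. kronecker_prime a p ^ multiplicity p b))"

definition odd_part :: "int \<Rightarrow> int" where
  "odd_part b = b div 2 ^ multiplicity 2 b"

definition vec_cong :: "nat \<Rightarrow> int \<Rightarrow> (int vec \<times> int vec) set" where
  "vec_cong n c = {(x, y). x \<in> carrier_vec n \<and> y \<in> carrier_vec n \<and>
     (\<forall>i<n. [x $ i = y $ i] (mod c))}"

lemma equiv_vec_cong: "equiv (carrier_vec n) (vec_cong n c)"
  by (rule equivI)
    (auto simp: vec_cong_def refl_on_def sym_def trans_def cong_sym intro: cong_trans)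

(* For even integral symmetric G the value of the form is even, so div 2 is exact, and
   the congruence depends only on the class of x modulo c. *)
definition rep_count :: "int mat \<Rightarrow> int vec \<Rightarrow> int \<Rightarrow> int \<Rightarrow> nat" where
  "rep_count G v m c =
     card ({x \<in> carrier_vec (dim_row G).
              [(x \<bullet> (G *\<^sub>v x)) div 2 + v \<bullet> x = m] (mod c)} // vec_cong (dim_row G) c)"

end

theory Submission
  imports Defs
begin

text \<open>
  Detecting the congruence by additive characters turns the count into a sum over \<open>a\<close> of
  exponential sums. For fixed \<open>a\<close>, reduce the fraction \<open>a/c\<close> and complete the square,
  which is possible because the reduced denominator is prime to the level. What remains is the pure
  Gauss sum of the quadratic form \<open>x \<mapsto> x\<^sup>T G x / 2\<close> to a modulus prime to \<open>det G\<close>. By the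
  Chinese remainder theorem and the recursion \<open>p\<^sup>k\<^sup>+\<^sup>2 \<rightarrow> p\<^sup>k\<close> it reduces to prime moduli, where
  the form is diagonalised (for \<open>p = 2\<close>, split into binary blocks modulo \<open>8\<close>). At odd moduli
  this leaves powers of the one-dimensional sum \<open>\<Sum>x. e(h x\<^sup>2 / c)\<close> with \<open>2 h \<equiv> 1\<close>, which equals
  \<open>e((1 - c)/8) sqrt c\<close>: its square is elementary, and its sign follows from an estimate by partial
  summation in the manner of Estermann.
\<close>

section \<open>Additive characters and sums over residue vectors\<close>

text \<open>Two normalisations of the exponential sum are needed. The theorem concerns
  \<open>gsum\<close>, built on half the form. Diagonalising modulo an odd number, however, replaces
  matrices by congruent ones, which destroys the even diagonal; so odd moduli are treated through
  \<open>qsum\<close>, built on the full form, with the half moved into the multiplier as an inverse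
  of 2. At the prime 2 no such inverse exists. There evenness of the form forces even rank, and this
  explains the shape of the result: powers of 2 contribute neither an eighth root of unity nor a
  dependence on \<open>a\<close>, so only the odd part of the denominator enters the phase.

  Integrality of \<open>N G^{-1}\<close> makes the shift that completes the square integral, and its
  even diagonal absorbs the factor 1/2 of the remaining phase; that is how the level enters.\<close>

definition ec :: "real \<Rightarrow> complex" where
  "ec t = cis (2 * pi * t)"

lemma e_of_real: "e (of_real t) = ec t"
  by (simp add: e_def ec_def cis_conv_exp mult_ac)

lemma ec_0 [simp]: "ec 0 = 1"
  by (simp add: ec_def)

lemma ec_add: "ec (s + t) = ec s * ec t"
  by (simp add: ec_def cis_mult distrib_left)

lemma ec_of_int [simp]: "ec (of_int k) = 1"
  by (simp add: ec_def cis_multiple_2pi)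

lemma ec_eq_1_iff: "ec t = 1 \<longleftrightarrow> t \<in> \<int>"
proof
  assume "ec t = 1"
  then have "cos (2 * pi * t) = 1"
    by (simp add: ec_def complex_eq_iff)
  then obtain k :: int where "2 * pi * t = of_int k * 2 * pi"
    using cos_one_2pi_int by auto
  then show "t \<in> \<int>" by simp
qed (auto elim: Ints_cases)

lemma ec_add_Ints: "k \<in> \<int> \<Longrightarrow> ec (t + k) = ec t"
  by (simp add: ec_add ec_eq_1_iff)

lemma ec_cong: "s - t \<in> \<int> \<Longrightarrow> ec s = ec t"
  using ec_add_Ints[of "s - t" t] by simp

lemma ec_minus: "ec (- t) = cnj (ec t)"
  by (simp add: ec_def cis_cnj)

lemma norm_ec [simp]: "norm (ec t) = 1"
  by (simp add: ec_def)

lemma ec_power: "ec t ^ n = ec (of_nat n * t)"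
  by (simp add: ec_def DeMoivre mult_ac)

lemma ec_nonzero [simp]: "ec t \<noteq> 0"
  by (metis norm_ec norm_zero zero_neq_one)

lemma ec_half: "ec (1 / 2) = - 1"
  by (simp add: ec_def)

lemma ec_quot_cong:
  fixes a b c :: int
  assumes "[a = b] (mod c)"
  shows "ec (of_int a / of_int c) = ec (of_int b / of_int c)"
proof (cases "c = 0")
  case False
  obtain k where "a = b + c * k"
    using assms by (metis cong_iff_lin cong_sym)
  then show ?thesis
    using False by (intro ec_cong) (simp add: field_simps)
qed (use assms in simp)

section \<open>Residue vectors and changes of variable in sums over them\<close>

definition vcong :: "nat \<Rightarrow> int \<Rightarrow> int vec \<Rightarrow> int vec \<Rightarrow> bool" where
  "vcong n c x y \<longleftrightarrow> (\<forall>i<n. [x $ i = y $ i] (mod c))"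

definition periodic :: "nat \<Rightarrow> int \<Rightarrow> (int vec \<Rightarrow> 'a) \<Rightarrow> bool" where
  "periodic n c f \<longleftrightarrow>
     (\<forall>x\<in>carrier_vec n. \<forall>y\<in>carrier_vec n. vcong n c x y \<longrightarrow> f x = f y)"

text \<open>Least nonnegative representatives of the classes modulo \<open>c\<close>: a finite index
  set, so that sums over classes become sums over concrete vectors.\<close>

definition box :: "nat \<Rightarrow> int \<Rightarrow> int vec set" where
  "box n c = {x \<in> carrier_vec n. \<forall>i<n. x $ i \<in> {0..<c}}"

definition vmod :: "int \<Rightarrow> int vec \<Rightarrow> int vec" where
  "vmod c x = map_vec (\<lambda>a. a mod c) x"

lemma box_carrier: "x \<in> box n c \<Longrightarrow> x \<in> carrier_vec n"
  by (simp add: box_def)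

lemma vmod_in_box: "c > 0 \<Longrightarrow> x \<in> carrier_vec n \<Longrightarrow> vmod c x \<in> box n c"
  by (auto simp: vmod_def box_def)

lemma vcong_vmod: "x \<in> carrier_vec n \<Longrightarrow> vcong n c (vmod c x) x"
  by (auto simp: vmod_def vcong_def cong_def)

lemma vcong_sym: "vcong n c x y \<Longrightarrow> vcong n c y x"
  by (auto simp: vcong_def cong_sym)

lemma vcong_trans: "vcong n c x y \<Longrightarrow> vcong n c y z \<Longrightarrow> vcong n c x z"
  by (auto simp: vcong_def intro: cong_trans)

lemma vcong_box_eq:
  assumes "x \<in> box n c" "y \<in> box n c" "vcong n c x y"
  shows "x = y"
proof (rule eq_vecI)
  fix i assume "i < dim_vec y"
  then show "x $ i = y $ i"
    using assms cong_less_imp_eq_int[of "x $ i" c "y $ i"]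
    by (auto simp: box_def vcong_def)
qed (use assms in \<open>auto simp: box_def\<close>)

lemma box_bij: "bij_betw (\<lambda>f. vec n f) (PiE {..<n} (\<lambda>_. {0..<c})) (box n c)"
proof (rule bij_betwI[where g = "\<lambda>x. \<lambda>i\<in>{..<n}. x $ i"])
  show "(\<lambda>f. vec n f) \<in> (PiE {..<n} (\<lambda>_. {0..<c})) \<rightarrow> box n c"
    by (auto simp: box_def PiE_iff)
  show "(\<lambda>x. \<lambda>i\<in>{..<n}. x $ i) \<in> box n c \<rightarrow> (PiE {..<n} (\<lambda>_. {0..<c}))"
    by (auto simp: box_def)
  show "(\<lambda>i\<in>{..<n}. vec n f $ i) = f" if "f \<in> PiE {..<n} (\<lambda>_. {0..<c})" for f
    using that by (auto simp: fun_eq_iff PiE_iff extensional_def restrict_def)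
  show "vec n (\<lambda>i\<in>{..<n}. x $ i) = x" if "x \<in> box n c" for x
    using that by (intro eq_vecI) (auto simp: box_def)
qed

lemma finite_box [simp]: "finite (box n c)"
  using bij_betw_finite[OF box_bij] by (auto intro: finite_PiE)

lemma card_box: "card (box n c) = nat c ^ n"
  using bij_betw_same_card[OF box_bij, of n c] by (simp add: card_PiE)

lemma periodic_vmod: "periodic n c f \<Longrightarrow> c > 0 \<Longrightarrow> x \<in> carrier_vec n \<Longrightarrow> f (vmod c x) = f x"
  using vcong_vmod[of x n c] vmod_in_box[of c x n] box_carrier
  by (auto simp: periodic_def)

lemma periodic_mult: "periodic n c f \<Longrightarrow> periodic n (c * d) f"
  unfolding periodic_def vcong_def by (metis (full_types) cong_modulus_mult)

text \<open>Injectivity modulo \<open>c\<close> and the count \<open>c^n\<close> already make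
  \<open>h\<close> a complete system of residues, so no inverse substitution has to be written down.
  Translations, linear maps and the two splittings into a double sum over \<open>y\<close> and
  \<open>z\<close> are instances.\<close>

lemma sum_box_reparam:
  fixes f :: "int vec \<Rightarrow> 'a :: comm_monoid_add"
  assumes c: "c > 0" and f: "periodic n c f"
    and h: "\<And>s. s \<in> S \<Longrightarrow> h s \<in> carrier_vec n"
    and inj: "\<And>s t. s \<in> S \<Longrightarrow> t \<in> S \<Longrightarrow> vcong n c (h s) (h t) \<Longrightarrow> s = t"
    and S: "finite S" "card S = nat c ^ n"
  shows "(\<Sum>s\<in>S. f (h s)) = (\<Sum>x\<in>box n c. f x)"
proof -
  have inj': "inj_on (\<lambda>s. vmod c (h s)) S"
  proof (rule inj_onI)
    fix s t assume st: "s \<in> S" "t \<in> S" "vmod c (h s) = vmod c (h t)"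
    have "vcong n c (h s) (h t)"
      using vcong_vmod[OF h[OF st(1)], of c] vcong_vmod[OF h[OF st(2)], of c] st(3)
      by (metis vcong_sym vcong_trans)
    then show "s = t" using inj st by blast
  qed
  have "(\<lambda>s. vmod c (h s)) ` S = box n c"
    by (rule card_subset_eq) (use h c S inj' in \<open>auto simp: card_box card_image intro: vmod_in_box\<close>)
  then have "bij_betw (\<lambda>s. vmod c (h s)) S (box n c)"
    using inj' by (simp add: bij_betw_def)
  then have "(\<Sum>x\<in>box n c. f x) = (\<Sum>s\<in>S. f (vmod c (h s)))"
    by (rule sum.reindex_bij_betw[symmetric])
  also have "\<dots> = (\<Sum>s\<in>S. f (h s))"
    by (intro sum.cong refl periodic_vmod[OF f c] h)
  finally show ?thesis by simp
qed

lemma sum_box_shift: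
  fixes f :: "int vec \<Rightarrow> 'a :: comm_monoid_add"
  assumes "c > 0" "periodic n c f" "u \<in> carrier_vec n"
  shows "(\<Sum>x\<in>box n c. f (x + u)) = (\<Sum>x\<in>box n c. f x)"
proof (rule sum_box_reparam[OF assms(1,2)])
  fix s t assume st: "s \<in> box n c" "t \<in> box n c" and *: "vcong n c (s + u) (t + u)"
  have "vcong n c s t"
    unfolding vcong_def
  proof (intro allI impI)
    fix i assume "i < n"
    then have "[s $ i + u $ i = t $ i + u $ i] (mod c)"
      using * st assms(3) by (auto simp: vcong_def box_def)
    then show "[s $ i = t $ i] (mod c)" using cong_add_rcancel by blast
  qed
  then show "s = t" using vcong_box_eq st by blast
qed (use assms in \<open>auto simp: card_box dest: box_carrier\<close>)

lemma vcong_mult_mat_vec: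
  assumes "A \<in> carrier_mat r n" "x \<in> carrier_vec n" "y \<in> carrier_vec n" "vcong n c x y"
  shows "vcong r c (A *\<^sub>v x) (A *\<^sub>v y)"
  using assms by (auto simp: vcong_def scalar_prod_def intro!: cong_sum cong_mult)

text \<open>A left inverse with integer entries yields injectivity modulo every \<open>c\<close> at
  once.\<close>

lemma sum_box_mult_mat:
  fixes f :: "int vec \<Rightarrow> 'a :: comm_monoid_add"
  assumes "c > 0" "periodic n c f" and U: "U \<in> carrier_mat n n" and V: "V \<in> carrier_mat n n"
    and VU: "V * U = 1\<^sub>m n"
  shows "(\<Sum>x\<in>box n c. f (U *\<^sub>v x)) = (\<Sum>x\<in>box n c. f x)"
proof (rule sum_box_reparam[OF assms(1,2)])
  fix s t assume st: "s \<in> box n c" "t \<in> box n c" and *: "vcong n c (U *\<^sub>v s) (U *\<^sub>v t)"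
  have inv: "V *\<^sub>v (U *\<^sub>v x) = x" if "x \<in> box n c" for x
    using box_carrier[OF that] U V VU by (metis assoc_mult_mat_vec one_mult_mat_vec)
  have "vcong n c (V *\<^sub>v (U *\<^sub>v s)) (V *\<^sub>v (U *\<^sub>v t))"
    using vcong_mult_mat_vec[OF V _ _ *] U st box_carrier by (meson mult_mat_vec_carrier)
  then show "s = t" using vcong_box_eq st inv by simp
qed (use U in \<open>auto simp: card_box dest: box_carrier\<close>)

text \<open>Two-digit expansion: \<open>y\<close> is the residue modulo \<open>c\<close> and
  \<open>z\<close> the next digit. It serves both to fold periodic summands and to descend from
  \<open>p^(k+2)\<close> to \<open>p^k\<close>.\<close>

lemma sum_box_mult:
  fixes f :: "int vec \<Rightarrow> 'a :: comm_monoid_add"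
  assumes cd: "c > 0" "d > 0" and f: "periodic n (c * d) f"
  shows "(\<Sum>y\<in>box n c. \<Sum>z\<in>box n d. f (y + c \<cdot>\<^sub>v z)) = (\<Sum>x\<in>box n (c * d). f x)"
proof -
  have "(\<Sum>y\<in>box n c. \<Sum>z\<in>box n d. f (y + c \<cdot>\<^sub>v z)) =
        (\<Sum>s\<in>box n c \<times> box n d. f (fst s + c \<cdot>\<^sub>v snd s))"
    by (simp add: sum.cartesian_product split_def)
  also have "\<dots> = (\<Sum>x\<in>box n (c * d). f x)"
  proof (rule sum_box_reparam)
    fix s t assume st: "s \<in> box n c \<times> box n d" "t \<in> box n c \<times> box n d"
      and *: "vcong n (c * d) (fst s + c \<cdot>\<^sub>v snd s) (fst t + c \<cdot>\<^sub>v snd t)"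
    have eq: "fst s $ i = fst t $ i \<and> snd s $ i = snd t $ i" if i: "i < n" for i
    proof -
      have 1: "[fst s $ i + c * snd s $ i = fst t $ i + c * snd t $ i] (mod c * d)"
        using * i st by (auto simp: vcong_def box_def mem_Times_iff)
      then have "[fst s $ i + c * snd s $ i = fst t $ i + c * snd t $ i] (mod c)"
        by (rule cong_modulus_mult)
      then have "[fst s $ i = fst t $ i] (mod c)"
        by (simp add: cong_def)
      moreover have b: "fst s $ i \<in> {0..<c}" "fst t $ i \<in> {0..<c}"
        "snd s $ i \<in> {0..<d}" "snd t $ i \<in> {0..<d}"
        using i st by (auto simp: box_def mem_Times_iff)
      ultimately have 2: "fst s $ i = fst t $ i"
        using cong_less_imp_eq_int by auto
      have "[c * snd s $ i = c * snd t $ i] (mod c * d)"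
        using 1 2 cong_add_lcancel by metis
      then have "[snd s $ i = snd t $ i] (mod d)"
        using cd by (simp add: cong_def)
      then have "snd s $ i = snd t $ i"
        using b cong_less_imp_eq_int by auto
      with 2 show ?thesis by simp
    qed
    have dims: "dim_vec (fst s) = n" "dim_vec (fst t) = n" "dim_vec (snd s) = n" "dim_vec (snd t) = n"
      using st by (auto simp: box_def mem_Times_iff)
    show "s = t"
      using eq dims by (intro prod_eqI eq_vecI) auto
  qed (use cd f in \<open>auto simp: card_box card_cartesian_product nat_mult_distrib power_mult_distrib
         intro!: add_carrier_vec dest!: box_carrier\<close>)
  finally show ?thesis .
qed

lemma sum_box_periodic:
  fixes f :: "int vec \<Rightarrow> complex"
  assumes cd: "c > 0" "d > 0" and per: "periodic n c f"
  shows "(\<Sum>x\<in>box n (c * d). f x) = of_int d ^ n * (\<Sum>x\<in>box n c. f x)"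
proof -
  have "(\<Sum>x\<in>box n (c * d). f x) = (\<Sum>y\<in>box n c. \<Sum>z\<in>box n d. f (y + c \<cdot>\<^sub>v z))"
    using sum_box_mult[OF cd periodic_mult[OF per]] by simp
  also have "\<dots> = (\<Sum>y\<in>box n c. \<Sum>z\<in>box n d. f y)"
  proof (intro sum.cong refl)
    fix y z assume yz: "y \<in> box n c" "z \<in> box n d"
    then have "vcong n c (y + c \<cdot>\<^sub>v z) y" by (auto simp: vcong_def box_def cong_def)
    moreover have "y \<in> carrier_vec n" "y + c \<cdot>\<^sub>v z \<in> carrier_vec n"
      using yz box_carrier by (auto intro!: add_carrier_vec)
    ultimately show "f (y + c \<cdot>\<^sub>v z) = f y" using per unfolding periodic_def by blast
  qed
  also have "\<dots> = of_int d ^ n * (\<Sum>x\<in>box n c. f x)"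
    using cd by (simp add: card_box sum_distrib_left)
  finally show ?thesis .
qed

lemma sum_box_crt:
  fixes f :: "int vec \<Rightarrow> 'a :: comm_monoid_add"
  assumes cd: "c > 0" "d > 0" and cop: "coprime c d" and f: "periodic n (c * d) f"
  shows "(\<Sum>y\<in>box n c. \<Sum>z\<in>box n d. f (d \<cdot>\<^sub>v y + c \<cdot>\<^sub>v z)) = (\<Sum>x\<in>box n (c * d). f x)"
proof -
  have "(\<Sum>y\<in>box n c. \<Sum>z\<in>box n d. f (d \<cdot>\<^sub>v y + c \<cdot>\<^sub>v z)) =
        (\<Sum>s\<in>box n c \<times> box n d. f (d \<cdot>\<^sub>v fst s + c \<cdot>\<^sub>v snd s))"
    by (simp add: sum.cartesian_product split_def)
  also have "\<dots> = (\<Sum>x\<in>box n (c * d). f x)"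
  proof (rule sum_box_reparam)
    fix s t assume st: "s \<in> box n c \<times> box n d" "t \<in> box n c \<times> box n d"
      and *: "vcong n (c * d) (d \<cdot>\<^sub>v fst s + c \<cdot>\<^sub>v snd s) (d \<cdot>\<^sub>v fst t + c \<cdot>\<^sub>v snd t)"
    have eq: "fst s $ i = fst t $ i \<and> snd s $ i = snd t $ i" if i: "i < n" for i
    proof -
      have 1: "[d * fst s $ i + c * snd s $ i = d * fst t $ i + c * snd t $ i] (mod c * d)"
        using * i st by (auto simp: vcong_def box_def mem_Times_iff)
      then have "[d * fst s $ i + c * snd s $ i = d * fst t $ i + c * snd t $ i] (mod c)"
        by (rule cong_modulus_mult)
      then have "[d * fst s $ i = d * fst t $ i] (mod c)"
        by (simp add: cong_def)
      then have "[fst s $ i = fst t $ i] (mod c)"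
        using cop by (simp add: cong_mult_lcancel coprime_commute)
      moreover have "[d * fst s $ i + c * snd s $ i = d * fst t $ i + c * snd t $ i] (mod d)"
        using 1 cong_modulus_mult[of _ _ d c] by (simp add: mult.commute)
      then have "[c * snd s $ i = c * snd t $ i] (mod d)"
        by (simp add: cong_def)
      then have "[snd s $ i = snd t $ i] (mod d)"
        using cop by (simp add: cong_mult_lcancel)
      moreover have b: "fst s $ i \<in> {0..<c}" "fst t $ i \<in> {0..<c}"
        "snd s $ i \<in> {0..<d}" "snd t $ i \<in> {0..<d}"
        using i st by (auto simp: box_def mem_Times_iff)
      ultimately show ?thesis
        using cong_less_imp_eq_int by auto
    qed
    have dims: "dim_vec (fst s) = n" "dim_vec (fst t) = n" "dim_vec (snd s) = n" "dim_vec (snd t) = n"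
      using st by (auto simp: box_def mem_Times_iff)
    show "s = t"
      using eq dims by (intro prod_eqI eq_vecI) auto
  qed (use cd f in \<open>auto simp: card_box card_cartesian_product nat_mult_distrib power_mult_distrib
         intro!: add_carrier_vec dest!: box_carrier\<close>)
  finally show ?thesis .
qed

lemma sum_box_append:
  fixes f :: "int vec \<Rightarrow> 'a :: comm_monoid_add"
  shows "(\<Sum>x\<in>box (r + s) c. f x) = (\<Sum>y\<in>box r c. \<Sum>z\<in>box s c. f (y @\<^sub>v z))"
proof -
  have "bij_betw (\<lambda>(y, z). y @\<^sub>v z) (box r c \<times> box s c) (box (r + s) c)"
  proof (rule bij_betwI[where g = "\<lambda>x. (vec_first x r, vec_last x s)"])
    show "(\<lambda>(y, z). y @\<^sub>v z) \<in> box r c \<times> box s c \<rightarrow> box (r + s) c"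
      by (auto simp: box_def)
    show "(\<lambda>x. (vec_first x r, vec_last x s)) \<in> box (r + s) c \<rightarrow> box r c \<times> box s c"
      by (auto simp: box_def vec_first_def vec_last_def)
    show "(\<lambda>x. (vec_first x r, vec_last x s)) ((\<lambda>(y, z). y @\<^sub>v z) w) = w"
      if "w \<in> box r c \<times> box s c" for w
      using that by (auto simp: box_def vec_first_def vec_last_def intro!: eq_vecI)
    show "(\<lambda>(y, z). y @\<^sub>v z) (vec_first x r, vec_last x s) = x"
      if "x \<in> box (r + s) c" for x
      using box_carrier[OF that] by simp
  qed
  from sum.reindex_bij_betw[OF this, of f] show ?thesis
    by (simp add: sum.cartesian_product split_def)
qed

section \<open>Quadratic forms and their exponential sums\<close>

definition symm :: "nat \<Rightarrow> 'a mat \<Rightarrow> bool" where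
  "symm n A \<longleftrightarrow> A \<in> carrier_mat n n \<and> transpose_mat A = A"

definition qf :: "'a :: comm_ring_1 mat \<Rightarrow> 'a vec \<Rightarrow> 'a" where
  "qf A x = x \<bullet> (A *\<^sub>v x)"

lemma symm_index: "symm n A \<Longrightarrow> i < n \<Longrightarrow> j < n \<Longrightarrow> A $$ (i, j) = A $$ (j, i)"
  unfolding symm_def by (metis carrier_matD index_transpose_mat(1))

lemma symm_carrier: "symm n A \<Longrightarrow> A \<in> carrier_mat n n"
  by (simp add: symm_def)

lemma symm_scalar_prod_commute:
  fixes A :: "'a :: comm_ring_1 mat"
  assumes "symm n A" "x \<in> carrier_vec n" "y \<in> carrier_vec n"
  shows "x \<bullet> (A *\<^sub>v y) = y \<bullet> (A *\<^sub>v x)"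
  using assms transpose_vec_mult_scalar[of A n n y x] comm_scalar_prod[of y n "A *\<^sub>v x"]
  by (auto simp: symm_def)

lemma qf_add:
  fixes A :: "'a :: comm_ring_1 mat"
  assumes A: "symm n A" and x: "x \<in> carrier_vec n" and y: "y \<in> carrier_vec n"
  shows "qf A (x + y) = qf A x + 2 * (y \<bullet> (A *\<^sub>v x)) + qf A y"
proof -
  have Ax: "A *\<^sub>v x \<in> carrier_vec n" "A *\<^sub>v y \<in> carrier_vec n"
    using A x y by (auto simp: symm_def)
  show ?thesis
    using symm_scalar_prod_commute[OF A x y]
    unfolding qf_def mult_add_distrib_mat_vec[OF symm_carrier[OF A] x y]
    by (simp add: scalar_prod_add_distrib[of _ n] add_scalar_prod_distrib[of _ n] x y Ax)
qed

lemma mult_mat_smult_vec: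
  fixes A :: "'a :: comm_ring_1 mat"
  assumes "A \<in> carrier_mat m n" "x \<in> carrier_vec n"
  shows "A *\<^sub>v (c \<cdot>\<^sub>v x) = c \<cdot>\<^sub>v (A *\<^sub>v x)"
  using assms by (intro eq_vecI) (auto simp: scalar_prod_def sum_distrib_left mult_ac)

lemma qf_smult:
  assumes A: "A \<in> carrier_mat n n" and x: "x \<in> carrier_vec n"
  shows "qf A (c \<cdot>\<^sub>v x) = c\<^sup>2 * qf A x"
  using assms unfolding qf_def
  by (simp add: mult_mat_smult_vec[of A n n] smult_scalar_prod_distrib[of _ n]
      scalar_prod_smult_distrib[of _ n] power2_eq_square mult.assoc)

lemma uminus_zero_mat: "- 0\<^sub>m m n = (0\<^sub>m m n :: 'a :: group_add mat)"
  by (intro eq_matI) auto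

lemma symm_transform:
  fixes A :: "'a :: comm_ring_1 mat"
  assumes A: "symm n A" and U: "U \<in> carrier_mat n m"
  shows "symm m (transpose_mat U * A * U)"
proof -
  have "transpose_mat (transpose_mat U * A * U) = transpose_mat U * transpose_mat (transpose_mat U * A)"
    using A U by (intro transpose_mult[of _ m n]) (auto simp: symm_def)
  also have "transpose_mat (transpose_mat U * A) = A * U"
    using A U transpose_mult[of "transpose_mat U" m n A n] by (auto simp: symm_def)
  also have "transpose_mat U * (A * U) = transpose_mat U * A * U"
    using A U by (intro assoc_mult_mat[symmetric, of _ m n _ n _ m]) (auto simp: symm_def)
  finally show ?thesis using A U by (auto simp: symm_def)
qed

lemma qf_transform:
  fixes A :: "'a :: comm_ring_1 mat"
  assumes A: "A \<in> carrier_mat n n" and U: "U \<in> carrier_mat n m" and x: "x \<in> carrier_vec m"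
  shows "qf (transpose_mat U * A * U) x = qf A (U *\<^sub>v x)"
proof -
  have Ux: "U *\<^sub>v x \<in> carrier_vec n" and AUx: "A *\<^sub>v (U *\<^sub>v x) \<in> carrier_vec n"
    using A U x by auto
  have "(transpose_mat U * A * U) *\<^sub>v x = transpose_mat U *\<^sub>v (A *\<^sub>v (U *\<^sub>v x))"
    using A U x Ux by (simp add: assoc_mult_mat_vec[of _ m n] assoc_mult_mat_vec[of _ m n _ m])
  then have "qf (transpose_mat U * A * U) x = x \<bullet> (transpose_mat U *\<^sub>v (A *\<^sub>v (U *\<^sub>v x)))"
    by (simp add: qf_def)
  also have "\<dots> = (transpose_mat U *\<^sub>v (A *\<^sub>v (U *\<^sub>v x))) \<bullet> x"
    using U AUx x by (intro comm_scalar_prod[of _ m]) auto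
  also have "\<dots> = (A *\<^sub>v (U *\<^sub>v x)) \<bullet> (U *\<^sub>v x)"
    by (rule transpose_vec_mult_scalar[OF U x AUx])
  also have "\<dots> = qf A (U *\<^sub>v x)"
    unfolding qf_def by (rule comm_scalar_prod[OF AUx Ux])
  finally show ?thesis .
qed

lemma det_transform:
  fixes A :: "int mat"
  assumes "A \<in> carrier_mat n n" "U \<in> carrier_mat n n" "det U = 1"
  shows "det (transpose_mat U * A * U) = det A"
  using assms by (simp add: det_mult[of _ n] det_transpose[of _ n])

lemma qf_cong:
  assumes A: "A \<in> carrier_mat n n" and A': "A' \<in> carrier_mat n n" and x: "x \<in> carrier_vec n"
    and c: "\<And>i j. i < n \<Longrightarrow> j < n \<Longrightarrow> [A $$ (i, j) = A' $$ (i, j)] (mod M)"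
  shows "[qf A x = qf A' x] (mod (M :: int))"
  unfolding qf_def scalar_prod_def using A A' x c
  by (auto simp: scalar_prod_def intro!: cong_sum cong_mult)

lemma qf_vcong:
  assumes A: "A \<in> carrier_mat n n" and x: "x \<in> carrier_vec n" and y: "y \<in> carrier_vec n"
    and c: "vcong n M x y"
  shows "[qf A x = qf A y] (mod M)"
  using vcong_mult_mat_vec[OF A x y c] c A x y
  unfolding qf_def scalar_prod_def
  by (auto simp del: index_mult_mat_vec simp: vcong_def intro!: cong_sum cong_mult)

lemma det_cong:
  assumes A: "A \<in> carrier_mat n n" and A': "A' \<in> carrier_mat n n"
    and c: "\<And>i j. i < n \<Longrightarrow> j < n \<Longrightarrow> [A $$ (i, j) = A' $$ (i, j)] (mod M)"
  shows "[det A = det A'] (mod (M :: int))"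
  unfolding det_def'[OF A] det_def'[OF A']
  by (intro cong_sum cong_mult cong_refl cong_prod c) (auto simp: permutes_in_image)

lemma dvd_det_row:
  assumes A: "(A :: int mat) \<in> carrier_mat n n" and i: "i < n"
    and d: "\<And>j. j < n \<Longrightarrow> d dvd A $$ (i, j)"
  shows "d dvd det A"
  unfolding laplace_expansion_row[OF A i] by (intro dvd_sum dvd_mult2 d) auto

text \<open>By symmetry the off-diagonal terms come in equal pairs, so only the diagonal matters
  modulo 2.\<close>

lemma sum_square_even:
  fixes s :: "nat \<Rightarrow> nat \<Rightarrow> int"
  assumes "\<And>i j. i < n \<Longrightarrow> j < n \<Longrightarrow> s i j = s j i" "\<And>i. i < n \<Longrightarrow> even (s i i)"
  shows "even (\<Sum>i<n. \<Sum>j<n. s i j)"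
  using assms
proof (induction n)
  case (Suc n)
  have "(\<Sum>i<n. s i n) = (\<Sum>j<n. s n j)"
    using Suc.prems(1) by (intro sum.cong) auto
  then have "(\<Sum>i<Suc n. \<Sum>j<Suc n. s i j) = (\<Sum>i<n. \<Sum>j<n. s i j) + 2 * (\<Sum>j<n. s n j) + s n n"
    by (simp add: sum.distrib)
  moreover have "even (\<Sum>i<n. \<Sum>j<n. s i j)" using Suc by simp
  ultimately show ?case using Suc.prems(2)[of n] by simp
qed simp

lemma qf_even:
  fixes A :: "int mat"
  assumes A: "symm n A" and d: "\<And>i. i < n \<Longrightarrow> even (A $$ (i, i))" and x: "x \<in> carrier_vec n"
  shows "even (qf A x)"
proof -
  have "qf A x = (\<Sum>i<n. \<Sum>j<n. x $ i * A $$ (i, j) * x $ j)"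
    using symm_carrier[OF A] x
    by (simp add: qf_def scalar_prod_def sum_distrib_left mult_ac lessThan_atLeast0)
  also have "even \<dots>"
    using A d symm_index[OF A] by (intro sum_square_even) (auto simp: mult_ac)
  finally show ?thesis .
qed

lemma unit_vec_mult_mat:
  fixes A :: "'a :: comm_ring_1 mat"
  assumes A: "A \<in> carrier_mat n n" and i: "i < n" and j: "j < n"
  shows "unit_vec n i \<bullet> (A *\<^sub>v unit_vec n j) = A $$ (i, j)"
  using assms by (simp add: scalar_prod_left_unit[of _ n])

lemma qf_unit_vec: "A \<in> carrier_mat n n \<Longrightarrow> i < n \<Longrightarrow> qf A (unit_vec n i) = A $$ (i, i)"
  unfolding qf_def by (rule unit_vec_mult_mat)

text \<open>A diagonal entry of the transformed matrix is a value of the old form.\<close>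

lemma even_diag_transform:
  fixes A :: "int mat"
  assumes A: "symm n A" and d: "\<And>i. i < n \<Longrightarrow> even (A $$ (i, i))" and U: "U \<in> carrier_mat n m"
    and i: "i < m"
  shows "even ((transpose_mat U * A * U) $$ (i, i))"
proof -
  have "(transpose_mat U * A * U) $$ (i, i) = qf (transpose_mat U * A * U) (unit_vec m i)"
    using symm_transform[OF A U] i by (simp add: qf_unit_vec symm_def)
  also have "\<dots> = qf A (U *\<^sub>v unit_vec m i)"
    using A U by (intro qf_transform) (auto simp: symm_def)
  also have "even \<dots>"
    using U by (intro qf_even[OF A d]) auto
  finally show ?thesis .
qed

text \<open>The full form, not half of it: the summand then depends on \<open>A\<close> only modulo
  \<open>M\<close>, whatever the parity of the diagonal, so \<open>A\<close> may be replaced by a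
  congruent matrix.\<close>

definition qsum :: "int mat \<Rightarrow> int \<Rightarrow> int \<Rightarrow> complex" where
  "qsum A b M = (\<Sum>x\<in>box (dim_row A) M. ec (of_int (b * qf A x) / of_int M))"

lemma periodic_qsum:
  assumes "A \<in> carrier_mat n n"
  shows "periodic n M (\<lambda>x. ec (of_int (b * qf A x) / of_int M))"
  unfolding periodic_def using qf_vcong[OF assms]
  by (auto simp del: of_int_mult intro!: ec_quot_cong cong_mult)

lemma qsum_transform:
  assumes A: "A \<in> carrier_mat n n" and U: "U \<in> carrier_mat n n" and V: "V \<in> carrier_mat n n"
    and VU: "V * U = 1\<^sub>m n" and M: "M > 0"
  shows "qsum (transpose_mat U * A * U) b M = qsum A b M"
proof -
  have "qsum (transpose_mat U * A * U) b M =
        (\<Sum>x\<in>box n M. ec (of_int (b * qf A (U *\<^sub>v x)) / of_int M))"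
    using A U unfolding qsum_def
    by (intro sum.cong arg_cong[of _ _ ec]) (auto simp: qf_transform[OF A U] box_carrier simp del: assoc_mult_mat)
  also have "\<dots> = qsum A b M"
    using A sum_box_mult_mat[OF M periodic_qsum[OF A, of M b] U V VU] by (simp add: qsum_def)
  finally show ?thesis .
qed

lemma qsum_cong:
  assumes A: "A \<in> carrier_mat n n" and A': "A' \<in> carrier_mat n n"
    and c: "\<And>i j. i < n \<Longrightarrow> j < n \<Longrightarrow> [A $$ (i, j) = A' $$ (i, j)] (mod M)"
  shows "qsum A b M = qsum A' b M"
  using A A' unfolding qsum_def
  by (auto simp del: of_int_mult
      intro!: sum.cong ec_quot_cong cong_mult qf_cong[OF A A' _ c] dest!: box_carrier)

lemma qf_block_diag:
  fixes B :: "'a :: comm_ring_1 mat"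
  assumes B: "B \<in> carrier_mat r r" and E: "E \<in> carrier_mat s s"
    and y: "y \<in> carrier_vec r" and z: "z \<in> carrier_vec s"
  shows "qf (four_block_mat B (0\<^sub>m r s) (0\<^sub>m s r) E) (y @\<^sub>v z) = qf B y + qf E z"
proof -
  have "four_block_mat B (0\<^sub>m r s) (0\<^sub>m s r) E *\<^sub>v (y @\<^sub>v z) = (B *\<^sub>v y) @\<^sub>v (E *\<^sub>v z)"
    using mult_mat_vec_split[OF B E y z] .
  then show ?thesis
    using assms scalar_prod_append[of y r z s "B *\<^sub>v y" "E *\<^sub>v z"] by (auto simp: qf_def)
qed

lemma qsum_block_diag:
  assumes B: "B \<in> carrier_mat r r" and E: "E \<in> carrier_mat s s"
  shows "qsum (four_block_mat B (0\<^sub>m r s) (0\<^sub>m s r) E) b M = qsum B b M * qsum E b M"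
proof -
  let ?D = "four_block_mat B (0\<^sub>m r s) (0\<^sub>m s r) E"
  have "qsum ?D b M = (\<Sum>x\<in>box (r + s) M. ec (of_int (b * qf ?D x) / of_int M))"
    using B E by (simp add: qsum_def)
  also have "\<dots> = (\<Sum>y\<in>box r M. \<Sum>z\<in>box s M.
      ec (of_int (b * qf B y) / of_int M) * ec (of_int (b * qf E z) / of_int M))"
    unfolding sum_box_append
    by (intro sum.cong refl) (simp add: qf_block_diag[OF B E box_carrier box_carrier]
        ec_add[symmetric] add_divide_distrib distrib_left)
  also have "\<dots> = qsum B b M * qsum E b M"
    using B E by (simp add: qsum_def sum_product)
  finally show ?thesis .
qed

text \<open>A Schur complement taken modulo \<open>M\<close>: it is enough that \<open>det B\<close>
  is invertible there, since the adjugate stands in for the inverse of \<open>B\<close>. The base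
  change itself is unipotent over the integers, so determinant and parity of the diagonal survive it
  exactly; a congruence enters only when the off-diagonal blocks are dropped. One statement serves
  blocks of size 1 modulo odd primes and of size 2 modulo 8.\<close>

lemma block_eliminate:
  fixes A :: "int mat"
  assumes A: "symm (r + s) A" and M: "M > 0"
    and B_def: "B = mat r r (\<lambda>(i, j). A $$ (i, j))"
    and cop: "coprime (det B) M"
  obtains E where "symm s E" "[det A = det B * det E] (mod M)"
    "\<And>b. qsum A b M = qsum B b M * qsum E b M"
    "\<forall>i<r + s. even (A $$ (i, i)) \<Longrightarrow> \<forall>i<s. even (E $$ (i, i))"
proof -
  define n where "n = r + s"
  define C where "C = mat r s (\<lambda>(i, j). A $$ (i, r + j))"
  define F where "F = mat s s (\<lambda>(i, j). A $$ (r + i, r + j))"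
  have Ac: "A \<in> carrier_mat n n" using A by (simp add: symm_def n_def)
  have An: "symm n A" using A by (simp add: n_def)
  have Bc: "B \<in> carrier_mat r r" and Cc: "C \<in> carrier_mat r s" and Fc: "F \<in> carrier_mat s s"
    by (auto simp: B_def C_def F_def)
  have Ablock: "A = four_block_mat B C (transpose_mat C) F"
    using A symm_index[OF A] by (intro eq_matI) (auto simp: symm_def B_def C_def F_def)
  obtain \<delta> where \<delta>: "[det B * \<delta> = 1] (mod M)"
    using cop cong_solve_coprime_int by blast
  \<comment> \<open>Modulo \<open>M\<close> this is the inverse of \<open>B\<close> times
    \<open>C\<close>, so that \<open>B * W\<close> cancels the block \<open>C\<close>.\<close>
  define W where "W = \<delta> \<cdot>\<^sub>m (adj_mat B * C)"
  have Wc: "W \<in> carrier_mat r s" using adj_mat(1)[OF Bc] Cc by (simp add: W_def)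
  have BW: "B * W = (\<delta> * det B) \<cdot>\<^sub>m C"
  proof -
    have "B * W = \<delta> \<cdot>\<^sub>m (B * (adj_mat B * C))"
      unfolding W_def using adj_mat(1)[OF Bc] Bc Cc by (intro mult_smult_distrib[of _ r r _ s]) auto
    also have "B * (adj_mat B * C) = det B \<cdot>\<^sub>m C"
      using adj_mat[OF Bc] Bc Cc by (simp add: assoc_mult_mat[of _ r r _ r _ s, symmetric])
        (metis left_mult_one_mat mult_smult_assoc_mat one_carrier_mat)
    finally show ?thesis by (auto simp: mult_ac)
  qed
  define U where "U = four_block_mat (1\<^sub>m r) (- W) (0\<^sub>m s r) (1\<^sub>m s)"
  define V where "V = four_block_mat (1\<^sub>m r) W (0\<^sub>m s r) (1\<^sub>m s)"
  have Uc: "U \<in> carrier_mat n n" and Vc: "V \<in> carrier_mat n n"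
    using Wc by (auto simp: U_def V_def n_def)
  have VU: "V * U = 1\<^sub>m n"
  proof -
    have "1\<^sub>m r * 1\<^sub>m r + W * 0\<^sub>m s r = 1\<^sub>m r"
      "1\<^sub>m r * - W + W * 1\<^sub>m s = 0\<^sub>m r s"
      "0\<^sub>m s r * 1\<^sub>m r + 1\<^sub>m s * 0\<^sub>m s r = (0\<^sub>m s r :: int mat)"
      "0\<^sub>m s r * - W + 1\<^sub>m s * 1\<^sub>m s = 1\<^sub>m s"
      using Wc by (auto simp: uminus_zero_mat intro!: eq_matI)
    then show ?thesis
      unfolding U_def V_def n_def using Wc
      by (subst mult_four_block_mat[of _ r r _ s _ s _ _ r _ s]) auto
  qed
  have detU: "det U = 1"
    unfolding U_def using Wc by (subst det_four_block_mat_lower_left_zero[of _ r _ s]) auto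
  define A' where "A' = transpose_mat U * A * U"
  have A'symm: "symm n A'"
    unfolding A'_def by (rule symm_transform[OF An Uc])
  have A'c: "A' \<in> carrier_mat n n" using A'symm by (simp add: symm_def)
  have AU: "A * U = four_block_mat B (C - B * W) (transpose_mat C) (F - transpose_mat C * W)"
  proof -
    have "B * 1\<^sub>m r + C * 0\<^sub>m s r = B" "B * - W + C * 1\<^sub>m s = C - B * W"
      "transpose_mat C * 1\<^sub>m r + F * 0\<^sub>m s r = transpose_mat C"
      "transpose_mat C * - W + F * 1\<^sub>m s = F - transpose_mat C * W"
      using Bc Cc Fc Wc by (auto intro!: eq_matI)
    then show ?thesis
      unfolding Ablock U_def using Bc Cc Fc Wc
      by (subst mult_four_block_mat[of _ r r _ s _ s _ _ r _ s]) auto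
  qed
  have UT: "transpose_mat U = four_block_mat (1\<^sub>m r) (0\<^sub>m r s) (transpose_mat (- W)) (1\<^sub>m s)"
    unfolding U_def using Wc by (subst transpose_four_block_mat[of _ r r _ s _ s]) auto
  have "A' = transpose_mat U * (A * U)"
    unfolding A'_def using Ac Uc by (intro assoc_mult_mat) auto
  also have "\<dots> = four_block_mat B (C - B * W)
      (transpose_mat (- W) * B + transpose_mat C)
      (transpose_mat (- W) * (C - B * W) + (F - transpose_mat C * W))"
    unfolding AU UT using Bc Cc Fc Wc
    by (subst mult_four_block_mat[of _ r r _ s _ s _ _ r _ s])
      (auto intro!: cong_four_block_mat)
  finally have A'block: "A' = four_block_mat B (C - B * W)
      (transpose_mat (- W) * B + transpose_mat C)
      (transpose_mat (- W) * (C - B * W) + (F - transpose_mat C * W))" .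
  \<comment> \<open>\<open>E\<close> is read off from the exact transform rather than reduced modulo
    \<open>M\<close>; symmetry and an even diagonal are then inherited.\<close>
  define E where "E = mat s s (\<lambda>(i, j). A' $$ (r + i, r + j))"
  have Ec: "E \<in> carrier_mat s s" by (simp add: E_def)
  define A'' where "A'' = four_block_mat B (0\<^sub>m r s) (0\<^sub>m s r) E"
  have A''c: "A'' \<in> carrier_mat n n" using Bc Ec by (auto simp: A''_def n_def)
  have upper: "[A' $$ (i, j) = A'' $$ (i, j)] (mod M)" if "i < r" "j < n" for i j
  proof (cases "j < r")
    case True
    then show ?thesis using that Bc Wc Cc Fc
      by (auto simp: A'block A''_def)
  next
    case False
    then have j: "j - r < s" using that by (simp add: n_def)
    have "A' $$ (i, j) = C $$ (i, j - r) - \<delta> * det B * C $$ (i, j - r)"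
      unfolding A'block BW using False that Bc Wc Cc Fc j by auto
    also have "[\<dots> = C $$ (i, j - r) - 1 * C $$ (i, j - r)] (mod M)"
      using \<delta> by (intro cong_diff cong_mult) (auto simp: mult_ac)
    finally show ?thesis using False that Bc Ec j by (auto simp: A''_def)
  qed
  have A''symm_ij: "A'' $$ (i, j) = A'' $$ (j, i)" if "i < r" "\<not> j < r" "j < n" for i j
    using that Bc Ec by (auto simp: A''_def n_def)
  have cong: "[A' $$ (i, j) = A'' $$ (i, j)] (mod M)" if ij: "i < n" "j < n" for i j
  proof (cases "i < r")
    case True
    then show ?thesis using upper ij by blast
  next
    case False
    show ?thesis
    proof (cases "j < r")
      case True
      then show ?thesis
        using upper[of j i] ij False A''symm_ij[of j i] symm_index[OF A'symm, of i j] by simp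
    next
      case False
      then show ?thesis using \<open>\<not> i < r\<close> ij Bc Ec by (auto simp: A''_def E_def n_def)
    qed
  qed
  show thesis
  proof
    show "symm s E"
      using symm_index[OF A'symm] by (auto simp: symm_def E_def n_def intro!: eq_matI)
    have "det A = det A'"
      unfolding A'_def by (rule det_transform[OF Ac Uc detU, symmetric])
    also have "[det A' = det A''] (mod M)"
      by (rule det_cong[OF A'c A''c cong])
    also have "det A'' = det B * det E"
      unfolding A''_def using Bc Ec by (intro det_four_block_mat_lower_left_zero[of _ r _ s]) auto
    finally show "[det A = det B * det E] (mod M)" .
    show "qsum A b M = qsum B b M * qsum E b M" for b
    proof -
      have "qsum A b M = qsum A' b M"
        unfolding A'_def by (rule qsum_transform[OF Ac Uc Vc VU M, symmetric])
      also have "\<dots> = qsum A'' b M"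
        by (rule qsum_cong[OF A'c A''c cong])
      also have "\<dots> = qsum B b M * qsum E b M"
        unfolding A''_def by (rule qsum_block_diag[OF Bc Ec])
      finally show ?thesis .
    qed
    show "\<forall>i<s. even (E $$ (i, i))" if "\<forall>i<r + s. even (A $$ (i, i))"
      using even_diag_transform[OF An _ Uc, of "r + _"] that by (auto simp: E_def A'_def n_def)
  qed
qed

lemma mult_vec_unit: "U \<in> carrier_mat m n \<Longrightarrow> j < n \<Longrightarrow> U *\<^sub>v unit_vec n j = col U (j :: nat)"
  for U :: "int mat"
  by (auto intro!: eq_vecI)

text \<open>The base change that adds \<open>t\<close> times basis vector \<open>j\<close> to basis
  vector \<open>k\<close>. With \<open>k = 0\<close> it produces a unit pivot modulo an odd prime,
  with \<open>k = 1\<close> an odd entry at \<open>(0, 1)\<close>.\<close>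

lemma transform_addrow:
  fixes A :: "int mat"
  assumes A: "symm n A" and jk: "j < n" "k < n" "j \<noteq> k" and M: "M > 0"
  obtains A' where "symm n A'" "det A' = det A" "\<And>b. qsum A' b M = qsum A b M"
    "A' $$ (k, k) = A $$ (k, k) + 2 * t * A $$ (k, j) + t\<^sup>2 * A $$ (j, j)"
    "\<And>i. i < n \<Longrightarrow> i \<noteq> k \<Longrightarrow> A' $$ (i, k) = A $$ (i, k) + t * A $$ (i, j)"
    "(\<And>i. i < n \<Longrightarrow> even (A $$ (i, i))) \<Longrightarrow> (\<And>i. i < n \<Longrightarrow> even (A' $$ (i, i)))"
proof -
  define U where "U = addrow_mat n t j k"
  define V where "V = addrow_mat n (- t) j k"
  have Ac: "A \<in> carrier_mat n n" using A by (simp add: symm_def)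
  have Uc: "U \<in> carrier_mat n n" and Vc: "V \<in> carrier_mat n n" by (auto simp: U_def V_def)
  have VU: "V * U = 1\<^sub>m n"
    using addrow_mat_inv[of j n k "- t"] jk by (simp add: U_def V_def)
  have detU: "det U = 1" using jk by (simp add: U_def det_addrow_mat)
  define A' where "A' = transpose_mat U * A * U"
  have A'symm: "symm n A'" unfolding A'_def by (rule symm_transform[OF A Uc])
  have colk: "U *\<^sub>v unit_vec n k = unit_vec n k + t \<cdot>\<^sub>v unit_vec n j"
    unfolding mult_vec_unit[OF Uc jk(2)] using jk by (auto simp: U_def intro!: eq_vecI)
  have coli: "U *\<^sub>v unit_vec n i = unit_vec n i" if "i < n" "i \<noteq> k" for i
    unfolding mult_vec_unit[OF Uc that(1)] using jk that by (auto simp: U_def intro!: eq_vecI)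
  have entry: "A' $$ (i, l) = (U *\<^sub>v unit_vec n i) \<bullet> (A *\<^sub>v (U *\<^sub>v unit_vec n l))"
    if il: "i < n" "l < n" for i l
  proof -
    have Ul: "U *\<^sub>v unit_vec n l \<in> carrier_vec n" using Uc by auto
    have "A' $$ (i, l) = unit_vec n i \<bullet> (A' *\<^sub>v unit_vec n l)"
      using A'symm il by (simp add: unit_vec_mult_mat symm_def)
    also have "A' *\<^sub>v unit_vec n l = transpose_mat U *\<^sub>v (A *\<^sub>v (U *\<^sub>v unit_vec n l))"
      unfolding A'_def using Ac Uc Ul by (simp add: assoc_mult_mat_vec[of _ n n _ n])
    also have "unit_vec n i \<bullet> \<dots> = \<dots> \<bullet> unit_vec n i"
      using Ac Uc Ul by (intro comm_scalar_prod[of _ n]) auto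
    also have "\<dots> = (A *\<^sub>v (U *\<^sub>v unit_vec n l)) \<bullet> (U *\<^sub>v unit_vec n i)"
      using Ac Uc Ul by (intro transpose_vec_mult_scalar) auto
    also have "\<dots> = (U *\<^sub>v unit_vec n i) \<bullet> (A *\<^sub>v (U *\<^sub>v unit_vec n l))"
      using Ac Uc Ul by (intro comm_scalar_prod[of _ n]) auto
    finally show ?thesis .
  qed
  have Au: "A *\<^sub>v (unit_vec n k + t \<cdot>\<^sub>v unit_vec n j) = A *\<^sub>v unit_vec n k + t \<cdot>\<^sub>v (A *\<^sub>v unit_vec n j)"
    using Ac by (simp add: mult_add_distrib_mat_vec[of _ n n] mult_mat_smult_vec[of _ n n])
  have ek: "A' $$ (i, k) = A $$ (i, k) + t * A $$ (i, j)" if "i < n" "i \<noteq> k" for i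
    unfolding entry[OF that(1) jk(2)] coli[OF that] colk Au
    using Ac jk that unit_vec_mult_mat[OF Ac that(1)]
    by (simp add: scalar_prod_add_distrib[of _ n] scalar_prod_smult_distrib[of _ n])
  show thesis
  proof
    show "symm n A'" by fact
    show "det A' = det A" unfolding A'_def by (rule det_transform[OF Ac Uc detU])
    show "qsum A' b M = qsum A b M" for b
      unfolding A'_def by (rule qsum_transform[OF Ac Uc Vc VU M])
    have "A' $$ (k, k) = qf A (unit_vec n k + t \<cdot>\<^sub>v unit_vec n j)"
      by (simp add: entry[OF jk(2) jk(2)] colk qf_def)
    also have "\<dots> = A $$ (k, k) + 2 * t * A $$ (k, j) + t\<^sup>2 * A $$ (j, j)"
      using Ac jk symm_index[OF A jk(1,2)]
      by (subst qf_add[OF A]) (auto simp: qf_smult qf_unit_vec unit_vec_mult_mat smult_scalar_prod_distrib[of _ n])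
    finally show "A' $$ (k, k) = A $$ (k, k) + 2 * t * A $$ (k, j) + t\<^sup>2 * A $$ (j, j)" .
    show "A' $$ (i, k) = A $$ (i, k) + t * A $$ (i, j)" if "i < n" "i \<noteq> k" for i
      using ek that .
    show "even (A' $$ (i, i))" if "\<And>i. i < n \<Longrightarrow> even (A $$ (i, i))" "i < n" for i
      unfolding A'_def by (rule even_diag_transform[OF A that(1) Uc that(2)])
  qed
qed

section \<open>One-dimensional Gauss sums and Legendre symbols\<close>

lemma Legendre_values: "Legendre a p \<in> {-1, 0, 1}"
  by (auto simp: Legendre_def)

lemma Legendre_cong: "[a = b] (mod p) \<Longrightarrow> Legendre a p = Legendre b p"
proof -
  assume ab: "[a = b] (mod p)"
  have "[c = a] (mod p) \<longleftrightarrow> [c = b] (mod p)" for c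
    using ab cong_trans cong_sym by blast
  moreover have "[a = 0] (mod p) \<longleftrightarrow> [b = 0] (mod p)"
    using ab cong_trans cong_sym by blast
  ultimately show ?thesis unfolding Legendre_def QuadRes_def by simp
qed

lemma Legendre_zero_iff: "Legendre a p = 0 \<longleftrightarrow> p dvd a"
  by (simp add: Legendre_def cong_0_iff)

text \<open>Euler's criterion is multiplicative modulo \<open>p\<close>, and values in {-1, 0, 1}
  that are congruent modulo \<open>p > 2\<close> here turn out equal, because their difference is at
  most 2 in absolute value.\<close>

lemma Legendre_mult:
  assumes p: "prime p" "p > 2"
  shows "Legendre (a * b) p = Legendre a p * Legendre b p"
proof -
  define q where "q = nat p"
  have pq: "p = int q" using p by (simp add: q_def)
  have q: "prime q" "2 < q" using p by (auto simp: pq)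
  have "[Legendre (a * b) p = a ^ ((q - 1) div 2) * b ^ ((q - 1) div 2)] (mod p)"
    using euler_criterion[OF q, of "a * b"] by (simp add: pq power_mult_distrib)
  moreover have "[Legendre a p * Legendre b p = a ^ ((q - 1) div 2) * b ^ ((q - 1) div 2)] (mod p)"
    using euler_criterion[OF q, of a] euler_criterion[OF q, of b] by (auto simp: pq intro: cong_mult)
  ultimately have "p dvd Legendre (a * b) p - Legendre a p * Legendre b p"
    by (meson cong_iff_dvd_diff cong_sym cong_trans)
  moreover have "\<bar>Legendre (a * b) p - Legendre a p * Legendre b p\<bar> \<le> 2"
    using Legendre_values[of "a * b" p] Legendre_values[of a p] Legendre_values[of b p] by auto
  ultimately show ?thesis
    using p zdvd_imp_le[of p "\<bar>Legendre (a * b) p - Legendre a p * Legendre b p\<bar>"] by force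
qed

lemma sum_int_atLeastLessThan: "(\<Sum>a\<in>{0..<c}. f a) = (\<Sum>k<nat c. f (int k))"
  by (rule sum.reindex_bij_witness[of _ int nat]) auto

lemma sum_ec_residues:
  assumes c: "c > 0"
  shows "(\<Sum>a\<in>{0..<c}. ec (of_int (a * t) / of_int c)) = (if c dvd t then of_int c else 0)"
proof (cases "c dvd t")
  case True
  then obtain k where "t = c * k" by blast
  then have "ec (of_int (a * t) / of_int c) = 1" for a
    using c ec_of_int[of "a * k"] by (simp add: field_simps)
  then show ?thesis using c True by simp
next
  case False
  define z where "z = ec (of_int t / of_int c)"
  have z1: "z \<noteq> 1"
  proof
    assume "z = 1"
    then obtain k :: int where "of_int t / of_int c = (of_int k :: real)"
      by (auto simp: z_def ec_eq_1_iff elim: Ints_cases)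
    then have "(of_int t :: real) = of_int (k * c)"
      using c by (simp add: field_simps)
    then have "t = k * c" by linarith
    then show False using False by simp
  qed
  have "(\<Sum>a\<in>{0..<c}. ec (of_int (a * t) / of_int c)) = (\<Sum>k<nat c. z ^ k)"
    unfolding sum_int_atLeastLessThan by (simp add: z_def ec_power)
  also have "\<dots> = (z ^ nat c - 1) / (z - 1)"
    using z1 by (simp add: geometric_sum)
  also have "z ^ nat c = 1"
    using c by (simp add: z_def ec_power)
  finally show ?thesis using False by simp
qed

lemma sum_residues_reparam:
  fixes f :: "int \<Rightarrow> 'a :: comm_monoid_add"
  assumes c: "c > 0" and f: "\<And>x y. [x = y] (mod c) \<Longrightarrow> f x = f y"
    and inj: "\<And>x y. x \<in> {0..<c} \<Longrightarrow> y \<in> {0..<c} \<Longrightarrow> [h x = h y] (mod c) \<Longrightarrow> x = y"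
  shows "(\<Sum>x\<in>{0..<c}. f (h x)) = (\<Sum>x\<in>{0..<c}. f x)"
proof -
  have inj': "inj_on (\<lambda>x. h x mod c) {0..<c}"
    by (rule inj_onI) (rule inj; simp add: cong_def)
  have "(\<lambda>x. h x mod c) ` {0..<c} = {0..<c}"
    by (rule endo_inj_surj) (use c inj' in auto)
  then have "bij_betw (\<lambda>x. h x mod c) {0..<c} {0..<c}"
    using inj' by (simp add: bij_betw_def)
  then have "(\<Sum>x\<in>{0..<c}. f x) = (\<Sum>x\<in>{0..<c}. f (h x mod c))"
    by (rule sum.reindex_bij_betw[symmetric])
  also have "\<dots> = (\<Sum>x\<in>{0..<c}. f (h x))"
    by (intro sum.cong refl f) (simp add: cong_def)
  finally show ?thesis by simp
qed

lemma sum_residues_mult: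
  fixes f :: "int \<Rightarrow> 'a :: comm_monoid_add"
  assumes c: "c > 0" and f: "\<And>x y. [x = y] (mod c) \<Longrightarrow> f x = f y" and a: "coprime a c"
  shows "(\<Sum>x\<in>{0..<c}. f (a * x)) = (\<Sum>x\<in>{0..<c}. f x)"
proof (rule sum_residues_reparam[OF c f])
  fix x y assume xy: "x \<in> {0..<c}" "y \<in> {0..<c}" "[a * x = a * y] (mod c)"
  then have "[x = y] (mod c)" using a by (simp add: cong_mult_lcancel)
  then show "x = y" using xy cong_less_imp_eq_int[of x c y] by auto
qed

definition gauss1 :: "int \<Rightarrow> int \<Rightarrow> complex" where
  "gauss1 u c = (\<Sum>x\<in>{0..<c}. ec (of_int (u * x\<^sup>2) / of_int c))"

text \<open>Modulo an odd prime a nonzero square has exactly the roots \<open>z\<close> and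
  \<open>p - z\<close>, which differ because \<open>p\<close> is odd.\<close>

lemma card_square_roots:
  assumes p: "prime p" "p > 2" and t: "t \<in> {0..<p}"
  shows "int (card {x \<in> {0..<p}. x\<^sup>2 mod p = t}) = 1 + Legendre t p"
proof -
  let ?R = "{x \<in> {0..<p}. x\<^sup>2 mod p = t}"
  have R: "?R = {x \<in> {0..<p}. [x\<^sup>2 = t] (mod p)}"
    using t by (auto simp: cong_def)
  consider "t = 0" | "t \<noteq> 0" "\<not> QuadRes p t" | "t \<noteq> 0" "QuadRes p t" by blast
  then show ?thesis
  proof cases
    case 1
    have "?R = {0}"
      using p by (auto simp: 1 mod_eq_0_iff_dvd prime_dvd_power_int_iff dest: zdvd_imp_le)
    then show ?thesis using 1 by (simp add: Legendre_def)
  next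
    case 2
    then have E: "?R = {}" unfolding R by (auto simp: QuadRes_def)
    have "\<not> [t = 0] (mod p)" using 2 t by (auto simp: cong_def)
    then show ?thesis using 2 unfolding E by (simp add: Legendre_def)
  next
    case 3
    have tp: "\<not> p dvd t" using 3 t by (auto dest: zdvd_imp_le)
    from 3 obtain y where y: "[y\<^sup>2 = t] (mod p)" by (auto simp: QuadRes_def)
    define z where "z = y mod p"
    have z: "[z\<^sup>2 = t] (mod p)" using y by (simp add: z_def cong_def power_mod)
    have z_range: "z \<in> {0..<p}" using p by (auto simp: z_def)
    have "z \<noteq> 0"
    proof
      assume "z = 0"
      then have "[t = 0] (mod p)" using z by (simp add: cong_sym_eq)
      then show False using tp by (simp add: cong_0_iff)
    qed
    have "odd p" using p prime_odd_int by simp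
    then have "z \<noteq> p - z" by presburger
    have "?R = {z, p - z}"
    proof (intro equalityI subsetI)
      fix x assume x: "x \<in> ?R"
      then have "[x\<^sup>2 = z\<^sup>2] (mod p)" using z unfolding R by (auto intro: cong_trans cong_sym)
      then have "p dvd (x - z) * (x + z)"
        by (simp add: cong_iff_dvd_diff power2_eq_square algebra_simps)
      then consider "p dvd x - z" | "p dvd x + z"
        using p by (auto simp: prime_dvd_mult_iff)
      then show "x \<in> {z, p - z}"
      proof cases
        case 1
        then have "[x = z] (mod p)" by (simp add: cong_iff_dvd_diff)
        then show ?thesis using x z_range cong_less_imp_eq_int[of x p z] by auto
      next
        case 2
        then obtain k where k: "x + z = p * k" by blast
        have "0 < x + z" "x + z < 2 * p" using x z_range \<open>z \<noteq> 0\<close> by auto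
        then have "0 < p * k" "p * k < p * 2" unfolding k by (simp_all only: mult.commute)
        have p0: "p > 0" using p by simp
        have "0 < k" using \<open>0 < p * k\<close> p0 by (simp add: zero_less_mult_iff)
        moreover have "k < 2" using \<open>p * k < p * 2\<close> by (rule iffD1[OF mult_less_cancel_left_pos[OF p0]])
        ultimately have "k = 1" by simp
        then show ?thesis using k by simp
      qed
    next
      fix x assume "x \<in> {z, p - z}"
      moreover have "[(p - z)\<^sup>2 = z\<^sup>2] (mod p)"
        by (simp add: cong_iff_dvd_diff power2_eq_square algebra_simps)
      ultimately show "x \<in> ?R"
        unfolding R using z z_range \<open>z \<noteq> 0\<close> by (auto intro: cong_trans)
    qed
    then have "card ?R = 2" using \<open>z \<noteq> p - z\<close> by simp
    then show ?thesis using 3 tp by (auto simp: Legendre_def cong_0_iff)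
  qed
qed

text \<open>Group the terms by the value of the square. The constant 1 in the count
  \<open>1 + Legendre t p\<close> contributes a complete character sum, which vanishes.\<close>

lemma gauss1_Legendre:
  assumes p: "prime p" "p > 2" and u: "\<not> p dvd u"
  shows "gauss1 u p = (\<Sum>t\<in>{0..<p}. of_int (Legendre t p) * ec (of_int (u * t) / of_int p))"
proof -
  let ?E = "\<lambda>t. ec (of_int (u * t) / of_int p)"
  have p0: "p > 0" using p by simp
  have E: "?E s = ?E t" if "[s = t] (mod p)" for s t
    using that by (intro ec_quot_cong cong_mult cong_refl)
  have "gauss1 u p = (\<Sum>x\<in>{0..<p}. ?E (x\<^sup>2 mod p))"
    unfolding gauss1_def by (intro sum.cong refl E) (simp add: cong_def)
  also have "\<dots> = (\<Sum>t\<in>{0..<p}. \<Sum>x\<in>{x \<in> {0..<p}. x\<^sup>2 mod p = t}. ?E (x\<^sup>2 mod p))"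
    by (rule sum.group[symmetric]) (use p0 in auto)
  also have "\<dots> = (\<Sum>t\<in>{0..<p}. of_nat (card {x \<in> {0..<p}. x\<^sup>2 mod p = t}) * ?E t)"
    by (intro sum.cong) auto
  also have "\<dots> = (\<Sum>t\<in>{0..<p}. of_int (1 + Legendre t p) * ?E t)"
    by (intro sum.cong refl) (simp only: card_square_roots[OF p, symmetric] of_int_of_nat_eq)
  also have "\<dots> = (\<Sum>t\<in>{0..<p}. ?E t) + (\<Sum>t\<in>{0..<p}. of_int (Legendre t p) * ?E t)"
    by (simp add: sum.distrib ring_distribs)
  also have "(\<Sum>t\<in>{0..<p}. ?E t) = 0"
    using sum_ec_residues[OF p0, of u] u by (simp add: mult.commute)
  finally show ?thesis by simp
qed

text \<open>Substitute \<open>a * t\<close> for \<open>t\<close> in the sum twisted by the Legendre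
  symbol; \<open>Legendre a p\<close> is a sign and so its own inverse.\<close>

lemma gauss1_mult_prime:
  assumes p: "prime p" "p > 2" and u: "\<not> p dvd u" and a: "\<not> p dvd a"
  shows "gauss1 (a * u) p = of_int (Legendre a p) * gauss1 u p"
proof -
  let ?F = "\<lambda>t. of_int (Legendre t p) * ec (of_int (u * t) / of_int p)"
  have p0: "p > 0" using p by simp
  have "\<not> p dvd a * u" using p u a by (simp add: prime_dvd_mult_iff)
  have La: "Legendre a p * Legendre a p = 1"
    using Legendre_values[of a p] a by (auto simp: Legendre_zero_iff[symmetric])
  have "gauss1 (a * u) p = (\<Sum>t\<in>{0..<p}. of_int (Legendre t p) * ec (of_int (a * u * t) / of_int p))"
    using gauss1_Legendre[OF p \<open>\<not> p dvd a * u\<close>] .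
  also have "\<dots> = (\<Sum>t\<in>{0..<p}. of_int (Legendre a p) * ?F (a * t))"
  proof (intro sum.cong refl)
    fix t
    have "Legendre a p * Legendre (a * t) p = Legendre t p"
      using La by (simp add: Legendre_mult[OF p] mult.assoc[symmetric])
    then have "(of_int (Legendre t p) :: complex) = of_int (Legendre a p) * of_int (Legendre (a * t) p)"
      by (metis of_int_mult)
    then show "of_int (Legendre t p) * ec (of_int (a * u * t) / of_int p) =
        of_int (Legendre a p) * ?F (a * t)"
      by (simp add: mult_ac)
  qed
  also have "\<dots> = of_int (Legendre a p) * (\<Sum>t\<in>{0..<p}. ?F (a * t))"
    by (simp add: sum_distrib_left)
  also have "(\<Sum>t\<in>{0..<p}. ?F (a * t)) = (\<Sum>t\<in>{0..<p}. ?F t)"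
  proof (rule sum_residues_mult[OF p0])
    show "coprime a p" using p a by (metis coprime_commute prime_imp_coprime_int)
    show "?F x = ?F y" if "[x = y] (mod p)" for x y
      using Legendre_cong[OF that] ec_quot_cong[of "u * x" "u * y" p] that
      by (simp add: cong_mult cong_refl)
  qed
  also have "\<dots> = gauss1 u p" by (rule gauss1_Legendre[OF p u, symmetric])
  finally show ?thesis .
qed

section \<open>Diagonalisation modulo odd primes\<close>

lemma sum_box_1: "(\<Sum>x\<in>box 1 c. f x) = (\<Sum>a\<in>{0..<c}. f (vec 1 (\<lambda>_. a)))"
  by (rule sum.reindex_bij_witness[of _ "\<lambda>a. vec 1 (\<lambda>_. a)" "\<lambda>v. v $ 0"])
    (auto simp: box_def intro!: eq_vecI arg_cong[of _ _ f])

lemma sum_box_0: "c > 0 \<Longrightarrow> (\<Sum>x\<in>box 0 c. f x) = f (0\<^sub>v 0)"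
proof -
  have "box 0 c = {0\<^sub>v 0}" by (auto simp: box_def intro!: eq_vecI)
  then show ?thesis by simp
qed

lemma qsum_0: "A \<in> carrier_mat 0 0 \<Longrightarrow> c > 0 \<Longrightarrow> qsum A b c = 1"
  by (auto simp: qsum_def sum_box_0 qf_def scalar_prod_def simp del: sum_constant)

lemma qsum_1:
  assumes "A \<in> carrier_mat 1 1"
  shows "qsum A b c = gauss1 (b * A $$ (0, 0)) c"
  using assms unfolding qsum_def gauss1_def
  by (auto simp: sum_box_1[unfolded One_nat_def] qf_def scalar_prod_def power2_eq_square mult_ac)

text \<open>Among the vectors \<open>e\<^sub>0 + t e\<^sub>j\<close> with \<open>t \<in> {0, 1, -1}\<close> one must represent a unit modulo \<open>p\<close>:
  otherwise the whole row \<open>0\<close> vanishes modulo \<open>p\<close>.\<close>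

lemma pivot_prime:
  assumes p: "prime p" "p > 2" and A: "symm (Suc n) A" and d: "\<not> p dvd det A"
  obtains A' where "symm (Suc n) A'" "det A' = det A" "\<And>b. qsum A' b p = qsum A b p"
    "\<not> p dvd A' $$ (0, 0)"
proof (cases "\<exists>j t. j < Suc n \<and> j \<noteq> 0 \<and>
    \<not> p dvd A $$ (0, 0) + 2 * t * A $$ (0, j) + t\<^sup>2 * A $$ (j, j)")
  case True
  then obtain j t where "j < Suc n" "j \<noteq> 0" and jt:
    "\<not> p dvd A $$ (0, 0) + 2 * t * A $$ (0, j) + t\<^sup>2 * A $$ (j, j)" by blast
  show ?thesis
  proof (rule transform_addrow[OF A \<open>j < Suc n\<close> _ \<open>j \<noteq> 0\<close>, of p t])
    fix A' assume "symm (Suc n) A'" "det A' = det A" "\<And>b. qsum A' b p = qsum A b p"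
      "A' $$ (0, 0) = A $$ (0, 0) + 2 * t * A $$ (0, j) + t\<^sup>2 * A $$ (j, j)"
    then show thesis using that jt by metis
  qed (use p in auto)
next
  case False
  show ?thesis
  proof (cases "p dvd A $$ (0, 0)")
    case True
    have "p dvd A $$ (0, j)" if "j < Suc n" for j
    proof (cases "j = 0")
      case j: False
      have "p dvd A $$ (0, 0) + 2 * 1 * A $$ (0, j) + 1\<^sup>2 * A $$ (j, j)"
        "p dvd A $$ (0, 0) + 2 * (-1) * A $$ (0, j) + (-1)\<^sup>2 * A $$ (j, j)"
        using False j that by blast+
      \<comment> \<open>The values at \<open>t = 1\<close> and \<open>t = -1\<close> differ by
        \<open>4 * A $$ (0, j)\<close>, and 4 is a unit modulo \<open>p\<close>.\<close>
      then have "p dvd (A $$ (0, 0) + 2 * 1 * A $$ (0, j) + 1\<^sup>2 * A $$ (j, j)) -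
          (A $$ (0, 0) + 2 * (-1) * A $$ (0, j) + (-1)\<^sup>2 * A $$ (j, j))"
        by (rule dvd_diff)
      then have "p dvd 2 * (2 * A $$ (0, j))" by simp
      moreover have "\<not> p dvd 2" using p by (auto dest: zdvd_imp_le)
      then have "\<not> p dvd 4" using p prime_dvd_mult_iff[of p 2 2] by simp
      ultimately show ?thesis using p by (simp add: prime_dvd_mult_iff)
    qed (use True in simp)
    then have "p dvd det A"
      using dvd_det_row[OF symm_carrier[OF A], of 0 p] by simp
    with d show ?thesis by simp
  next
    case False
    show ?thesis by (rule that[OF A _ _ False]) simp_all
  qed
qed

text \<open>Splits off one unit pivot at a time. Each pivot turns into its symbol times
  \<open>gauss1 b p\<close>, and the symbols multiply to that of the determinant, so no diagonal
  form has to be recorded.\<close>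

lemma qsum_prime:
  assumes p: "prime p" "p > 2" and A: "symm n A" and d: "\<not> p dvd det A" and b: "\<not> p dvd b"
  shows "qsum A b p = of_int (Legendre (det A) p) * gauss1 b p ^ n"
  using A d
proof (induction n arbitrary: A)
  case 0
  have "QuadRes p 1" unfolding QuadRes_def by (rule exI[of _ 1]) simp
  moreover have "\<not> p dvd 1" using p by (auto dest: zdvd_imp_le)
  ultimately have "Legendre 1 p = 1" by (simp add: Legendre_def cong_0_iff)
  then show ?case
    using 0 p by (simp add: symm_def qsum_0)
next
  case (Suc n)
  have p0: "p > 0" using p by simp
  obtain A' where A': "symm (Suc n) A'" "det A' = det A" "\<And>b. qsum A' b p = qsum A b p"
    "\<not> p dvd A' $$ (0, 0)"
    by (rule pivot_prime[OF p Suc.prems]) (rule that)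
  define B where "B = mat 1 1 (\<lambda>(i, j). A' $$ (i, j))"
  have Bc: "B \<in> carrier_mat 1 1" and B00: "B $$ (0, 0) = A' $$ (0, 0)"
    by (auto simp: B_def)
  have detB: "det B = A' $$ (0, 0)" using det_single[OF Bc] B00 by simp
  have cop: "coprime (det B) p"
    unfolding detB using p A'(4) by (metis coprime_commute prime_imp_coprime_int)
  have symm1: "symm (1 + n) A'" using A'(1) by simp
  obtain E where E: "symm n E" "[det A' = det B * det E] (mod p)"
    "\<And>b. qsum A' b p = qsum B b p * qsum E b p"
    by (rule block_eliminate[OF symm1 p0 B_def cop]) (rule that)
  have dE: "\<not> p dvd det E"
    using cong_dvd_iff[OF E(2)] A'(2) Suc.prems(2) by auto
  have "qsum A b p = qsum B b p * qsum E b p" using A'(3) E(3) by simp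
  also have "qsum B b p = of_int (Legendre (det B) p) * gauss1 b p"
    using gauss1_mult_prime[OF p b A'(4)] by (simp add: qsum_1[OF Bc] B00 detB mult.commute)
  also have "qsum E b p = of_int (Legendre (det E) p) * gauss1 b p ^ n"
    by (rule Suc.IH[OF E(1) dE])
  also have "Legendre (det A) p = Legendre (det B) p * Legendre (det E) p"
    using Legendre_cong[OF E(2)] A'(2) by (simp add: Legendre_mult[OF p])
  ultimately show ?case by simp
qed

section \<open>Binary blocks at the prime 2\<close>

lemma ec_half_int: "ec (of_int k / 2) = (if even k then 1 else -1)"
proof -
  obtain l where "k = 2 * l \<or> k = 2 * l + 1" by (metis oddE dvdE)
  then show ?thesis
    by (auto simp: add_divide_distrib ec_add ec_half)
qed

lemma det_2:
  fixes B :: "int mat"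
  assumes B: "B \<in> carrier_mat 2 2"
  shows "det B = B $$ (0, 0) * B $$ (1, 1) - B $$ (0, 1) * B $$ (1, 0)"
proof -
  have d: "det M = M $$ (0, 0)" if "M \<in> carrier_mat (Suc 0) (Suc 0)" for M :: "int mat"
    using that det_single[of M] by simp
  have "mat_delete B 0 j \<in> carrier_mat (Suc 0) (Suc 0)" for j
    using mat_delete_carrier[of B 2 2 0 j] B by (simp add: numeral_2_eq_2)
  then show ?thesis
    using B unfolding laplace_expansion_row[OF B, of 0, simplified] cofactor_def
    by (simp add: d numeral_2_eq_2) (simp add: mat_delete_def)
qed

lemma kronecker_prime_2_cong: "[a = b] (mod 8) \<Longrightarrow> kronecker_prime a 2 = kronecker_prime b 2"
proof -
  assume ab: "[a = b] (mod 8)"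
  then have "[a = b] (mod 2)" by (rule cong_dvd_modulus) simp
  then have "even a \<longleftrightarrow> even b" by (rule cong_dvd_iff)
  then show ?thesis using ab by (auto simp: kronecker_prime_def cong_def)
qed

lemma odd_mod_8: "odd (a :: int) \<Longrightarrow> a mod 8 \<in> {1, 3, 5, 7}"
  by (auto; presburger)

lemma kronecker_prime_2_mult: "kronecker_prime (a * b) 2 = kronecker_prime a 2 * kronecker_prime b 2"
proof (cases "odd a \<and> odd b")
  case True
  define x y where "x = a mod 8" and "y = b mod 8"
  have ax: "[a = x] (mod 8)" and bx: "[b = y] (mod 8)" by (simp_all add: x_def y_def cong_def)
  have "x \<in> {1, 3, 5, 7}" "y \<in> {1, 3, 5, 7}"
    using True odd_mod_8 unfolding x_def y_def by blast+
  then have "kronecker_prime (x * y) 2 = kronecker_prime x 2 * kronecker_prime y 2"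
    by (elim insertE emptyE) (simp_all add: kronecker_prime_def)
  then show ?thesis
    using kronecker_prime_2_cong[OF ax] kronecker_prime_2_cong[OF bx]
      kronecker_prime_2_cong[OF cong_mult[OF ax bx]] by simp
qed (auto simp: kronecker_prime_def)

text \<open>Modulo 2 half the form is \<alpha> x^2 + x y + \<gamma> y^2. If \<alpha> \<gamma> is
  even it is hyperbolic and odd at one nonzero vector; if \<alpha> \<gamma> is odd it is anisotropic
  and odd at all three. The signs add up to 2 or -2, repeated 16 times in the box modulo 8. The
  determinant \<open>4 \<alpha> \<gamma> - \<beta>^2\<close> is 7 or 3 modulo 8 accordingly, so the
  Kronecker convention at 2 records the type.\<close>

lemma qsum_block_2:
  assumes B: "symm 2 B" and d: "\<And>i. i < 2 \<Longrightarrow> even (B $$ (i, i))" and o: "odd (B $$ (0, 1))"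
  shows "qsum B 2 8 = 32 * of_int (kronecker_prime (det B) 2)"
proof -
  obtain \<alpha> where \<alpha>: "B $$ (0, 0) = 2 * \<alpha>" using d[of 0] by (auto elim: evenE)
  obtain \<gamma> where \<gamma>: "B $$ (1, 1) = 2 * \<gamma>" using d[of 1] by (auto elim: evenE)
  obtain \<beta> where \<beta>: "B $$ (0, 1) = \<beta>" by blast
  have Bc: "B \<in> carrier_mat 2 2" by (rule symm_carrier[OF B])
  have \<beta>': "B $$ (1, 0) = \<beta>" using symm_index[OF B, of 0 1] \<beta> by simp
  have q: "qf B (vec 1 (\<lambda>_. x) @\<^sub>v vec 1 (\<lambda>_. y)) = 2 * (\<alpha> * x\<^sup>2 + \<beta> * x * y + \<gamma> * y\<^sup>2)" for x y
    using Bc \<alpha> \<gamma> \<beta>' \<beta>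
    by (simp add: qf_def scalar_prod_def numeral_2_eq_2 power2_eq_square algebra_simps)
  have half: "ec (of_int (2 * (2 * k)) / of_int 8) = (if even k then 1 else -1)" for k
    using ec_half_int[of k] by simp
  have "qsum B 2 8 = (\<Sum>x\<in>{0..<8}. \<Sum>y\<in>{0..<8}.
      if even (\<alpha> * x\<^sup>2 + \<beta> * x * y + \<gamma> * y\<^sup>2) then 1 else -1)"
  proof -
    have dim: "dim_row B = 1 + 1" using Bc by simp
    show ?thesis
      unfolding qsum_def dim sum_box_append sum_box_1 q half ..
  qed
  also have "\<dots> = (if odd \<alpha> \<and> odd \<gamma> then -32 else 32)"
  proof -
    have "{0..<8 :: int} = {0, 1, 2, 3, 4, 5, 6, 7}" by auto
    moreover have "odd \<beta>" using o \<beta> by simp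
    ultimately show ?thesis by (cases "even \<alpha>"; cases "even \<gamma>") simp_all
  qed
  also have "\<dots> = 32 * of_int (kronecker_prime (det B) 2)"
  proof -
    obtain b where b: "\<beta> = 2 * b + 1" using o \<beta> by (auto elim: oddE)
    have det: "det B = 4 * (\<alpha> * \<gamma> - b * (b + 1)) - 1"
      unfolding det_2[OF Bc] \<alpha> \<gamma> \<beta>' \<beta> b by (simp add: algebra_simps)
    have ev: "even (b * (b + 1))" by simp
    show ?thesis
    proof (cases "odd \<alpha> \<and> odd \<gamma>")
      case True
      then have "odd (\<alpha> * \<gamma> - b * (b + 1))" using ev by simp
      then obtain k where "\<alpha> * \<gamma> - b * (b + 1) = 2 * k + 1" by (rule oddE)
      then have "det B = 8 * k + 3" unfolding det by simp
      then show ?thesis using True by (simp add: kronecker_prime_def)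
    next
      case False
      then have "even (\<alpha> * \<gamma> - b * (b + 1))" using ev by auto
      then obtain k where "\<alpha> * \<gamma> - b * (b + 1) = 2 * k" by (rule evenE)
      then have "det B = 8 * (k - 1) + 7" unfolding det by simp
      then have "det B mod 8 = 7" "odd (det B)" by presburger+
      then show ?thesis using False by (simp add: kronecker_prime_def)
    qed
  qed
  finally show ?thesis .
qed

text \<open>An odd determinant requires an odd entry in row 0, and it lies off the even diagonal; in
  particular rank one is impossible. If the entry \<open>(0, 1)\<close> is even, adding basis vector
  \<open>j\<close> to basis vector 1 makes it odd.\<close>

lemma pivot_two:
  assumes A: "symm (Suc n) A" and ev: "\<And>i. i < Suc n \<Longrightarrow> even (A $$ (i, i))" and d: "odd (det A)"
  obtains A' where "symm (Suc n) A'" "det A' = det A" "\<And>b. qsum A' b 8 = qsum A b 8"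
    "\<And>i. i < Suc n \<Longrightarrow> even (A' $$ (i, i))" "odd (A' $$ (0, 1))" "n > 0"
proof -
  obtain j where j: "j < Suc n" "odd (A $$ (0, j))"
    using dvd_det_row[OF symm_carrier[OF A], of 0 2] d by auto
  have j0: "j \<noteq> 0" using j ev[of 0] by (cases "j = 0") auto
  then have n: "n > 0" using j by simp
  show ?thesis
  proof (cases "odd (A $$ (0, 1))")
    case False
    then have "j \<noteq> 1" using j by metis
    have "1 < Suc n" using n by simp
    show ?thesis
    proof (rule transform_addrow[OF A \<open>j < Suc n\<close> \<open>1 < Suc n\<close> \<open>j \<noteq> 1\<close>, of 8 1])
      fix A' assume A': "symm (Suc n) A'" "det A' = det A" "\<And>b. qsum A' b 8 = qsum A b 8"
        "\<And>i. i < Suc n \<Longrightarrow> i \<noteq> 1 \<Longrightarrow> A' $$ (i, 1) = A $$ (i, 1) + 1 * A $$ (i, j)"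
        "(\<And>i. i < Suc n \<Longrightarrow> even (A $$ (i, i))) \<Longrightarrow> (\<And>i. i < Suc n \<Longrightarrow> even (A' $$ (i, i)))"
      have "odd (A' $$ (0, 1))" using A'(4)[of 0] False j(2) by simp
      then show thesis using that[OF A'(1-3) A'(5)[OF ev] _ n] by blast
    qed simp
  next
    case True
    show ?thesis by (rule that[OF A _ _ ev True n]) simp_all
  qed
qed

text \<open>The summand of \<open>qsum A 2 8\<close> is \<open>(-1) ^ (qf A x div 2)\<close>, of period \<open>2\<close>.
  The modulus is \<open>8\<close> and not \<open>2\<close>, because the symbol at
  \<open>2\<close> depends on the determinant modulo \<open>8\<close>.\<close>

lemma qsum_two:
  assumes A: "symm n A" and ev: "\<And>i. i < n \<Longrightarrow> even (A $$ (i, i))" and d: "odd (det A)"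
  shows "even n \<and> qsum A 2 8 = 32 ^ (n div 2) * of_int (kronecker_prime (det A) 2)"
  using assms
proof (induction n arbitrary: A rule: less_induct)
  case (less n)
  show ?case
  proof (cases n)
    case 0
    then show ?thesis using less.prems by (simp add: symm_def qsum_0 kronecker_prime_def)
  next
    case (Suc m)
    obtain A' where A': "symm (Suc m) A'" "det A' = det A" "\<And>b. qsum A' b 8 = qsum A b 8"
      "\<And>i. i < Suc m \<Longrightarrow> even (A' $$ (i, i))" "odd (A' $$ (0, 1))" "m > 0"
      using pivot_two[of m A] less.prems unfolding Suc by blast
    obtain s where s: "m = Suc s" using A'(6) by (cases m) auto
    define B where "B = mat 2 2 (\<lambda>(i, j). A' $$ (i, j))"
    have symm2: "symm (2 + s) A'" using A'(1) s by simp
    have Bs: "symm 2 B"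
      using symm_index[OF symm2] by (auto simp: symm_def B_def intro!: eq_matI)
    have Bev: "even (B $$ (i, i))" if "i < 2" for i
      using that A'(4) s by (auto simp: B_def)
    have B01: "odd (B $$ (0, 1))" using A'(5) by (simp add: B_def)
    have oddB: "odd (det B)"
      using det_2[OF symm_carrier[OF Bs]] Bev[of 0] B01 symm_index[OF Bs, of 0 1] by simp
    then have cop: "coprime (det B) 8"
      using coprime_power_right_iff[of "det B" 2 3] by simp
    obtain E where E: "symm s E" "[det A' = det B * det E] (mod 8)"
      "\<And>b. qsum A' b 8 = qsum B b 8 * qsum E b 8"
      "\<forall>i<2 + s. even (A' $$ (i, i)) \<Longrightarrow> \<forall>i<s. even (E $$ (i, i))"
      by (rule block_eliminate[OF symm2 _ B_def cop]) (simp, rule that)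
    have Eev: "even (E $$ (i, i))" if "i < s" for i
      using E(4) A'(4) s that by simp
    have "[det A' = det B * det E] (mod 2)"
      using E(2) by (rule cong_dvd_modulus) simp
    then have "odd (det B * det E)"
      using A'(2) less.prems(3) cong_dvd_iff by metis
    then have oddE: "odd (det E)" by simp
    have IH: "even s \<and> qsum E 2 8 = 32 ^ (s div 2) * of_int (kronecker_prime (det E) 2)"
      using less.IH[OF _ E(1) Eev oddE] Suc s by simp
    have "kronecker_prime (det A) 2 = kronecker_prime (det B) 2 * kronecker_prime (det E) 2"
      using kronecker_prime_2_cong[OF E(2)] A'(2) by (simp add: kronecker_prime_2_mult)
    moreover have "qsum A 2 8 = qsum B 2 8 * qsum E 2 8" using A'(3) E(3) by metis
    ultimately show ?thesis
      using IH qsum_block_2[OF Bs Bev B01] by (simp add: Suc s)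
  qed
qed

section \<open>Gauss sums of even forms\<close>

definition even_form :: "nat \<Rightarrow> int mat \<Rightarrow> bool" where
  "even_form n G \<longleftrightarrow> symm n G \<and> (\<forall>i<n. even (G $$ (i, i)))"

definition hq :: "int mat \<Rightarrow> int vec \<Rightarrow> int" where
  "hq G x = qf G x div 2"

definition gsum :: "int mat \<Rightarrow> int \<Rightarrow> int \<Rightarrow> complex" where
  "gsum G a c = (\<Sum>x\<in>box (dim_row G) c. ec (of_int (a * hq G x) / of_int c))"

lemma even_form_symm: "even_form n G \<Longrightarrow> symm n G"
  by (simp add: even_form_def)

lemma even_form_carrier: "even_form n G \<Longrightarrow> G \<in> carrier_mat n n"
  by (simp add: even_form_def symm_def)

lemma even_form_dim: "even_form n G \<Longrightarrow> dim_row G = n"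
  by (auto simp: even_form_def symm_def)

lemma qf_eq_hq: "even_form n G \<Longrightarrow> x \<in> carrier_vec n \<Longrightarrow> qf G x = 2 * hq G x"
  using qf_even[of n G x] by (simp add: even_form_def hq_def)

lemma hq_add:
  assumes G: "even_form n G" and x: "x \<in> carrier_vec n" and y: "y \<in> carrier_vec n"
  shows "hq G (x + y) = hq G x + y \<bullet> (G *\<^sub>v x) + hq G y"
  using qf_add[OF even_form_symm[OF G] x y] qf_eq_hq[OF G] x y by simp

lemma hq_smult:
  assumes G: "even_form n G" and x: "x \<in> carrier_vec n"
  shows "hq G (k \<cdot>\<^sub>v x) = k\<^sup>2 * hq G x"
  using qf_smult[OF even_form_carrier[OF G] x, of k] qf_eq_hq[OF G] x by simp

text \<open>Reducing the value of \<open>qf\<close> would control only twice \<open>hq\<close>,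
  which loses information when \<open>M\<close> is even. So \<open>x = y + M z\<close> is expanded
  directly; the cross term then needs no halving.\<close>

lemma hq_vcong:
  assumes G: "even_form n G" and x: "x \<in> carrier_vec n" and y: "y \<in> carrier_vec n"
    and c: "vcong n M x y"
  shows "[hq G x = hq G y] (mod M)"
proof -
  define z where "z = vec n (\<lambda>i. (x $ i - y $ i) div M)"
  have z: "z \<in> carrier_vec n" by (simp add: z_def)
  have "x = y + M \<cdot>\<^sub>v z"
    using x y c by (intro eq_vecI) (auto simp: z_def vcong_def cong_iff_dvd_diff)
  then have "hq G x - hq G y = (M \<cdot>\<^sub>v z) \<bullet> (G *\<^sub>v y) + M\<^sup>2 * hq G z"
    using G y z by (simp add: hq_add hq_smult)
  also have "\<dots> = M * (z \<bullet> (G *\<^sub>v y) + M * hq G z)"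
    using z y even_form_carrier[OF G]
    by (simp add: smult_scalar_prod_distrib[of _ n] power2_eq_square algebra_simps)
  finally show ?thesis by (simp add: cong_iff_dvd_diff)
qed

lemma periodic_gsum:
  assumes "even_form n G"
  shows "periodic n c (\<lambda>x. ec (of_int (a * hq G x) / of_int c))"
  unfolding periodic_def using hq_vcong[OF assms]
  by (auto simp del: of_int_mult intro!: ec_quot_cong cong_mult)

lemma gsum_cong: "[a = b] (mod c) \<Longrightarrow> gsum G a c = gsum G b c"
  unfolding gsum_def by (intro sum.cong refl ec_quot_cong cong_mult cong_refl)

lemma gsum_1: "even_form n G \<Longrightarrow> gsum G a 1 = 1"
proof -
  assume G: "even_form n G"
  have "box n 1 = {0\<^sub>v n}" by (auto simp: box_def intro!: eq_vecI)
  then show ?thesis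
    using ec_of_int[of "a * hq G (0\<^sub>v n)"] by (simp add: gsum_def even_form_dim[OF G])
qed

lemma gsum_eq_qsum:
  assumes G: "even_form n G" and h: "[2 * h = 1] (mod c)"
  shows "gsum G a c = qsum G (a * h) c"
  unfolding gsum_def qsum_def
proof (intro sum.cong refl ec_quot_cong)
  fix x assume "x \<in> box (dim_row G) c"
  then have "x \<in> carrier_vec n" using even_form_dim[OF G] box_carrier by blast
  then have "a * h * qf G x = a * hq G x * (2 * h)" using qf_eq_hq[OF G] by simp
  also have "[\<dots> = a * hq G x * 1] (mod c)" by (intro cong_mult cong_refl h)
  finally show "[a * hq G x = a * h * qf G x] (mod c)" by (simp add: cong_sym)
qed

text \<open>\<open>2 * qf / 8\<close> is \<open>hq / 2\<close>, whose phase has period 2 in each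
  coordinate, and the box modulo 8 covers the box modulo 2 exactly \<open>4^n\<close> times.\<close>

lemma gsum_two_qsum:
  assumes G: "even_form n G"
  shows "qsum G 2 8 = 4 ^ n * gsum G 1 2"
proof -
  let ?f = "\<lambda>x. ec (of_int (1 * hq G x) / of_int 2)"
  have "qsum G 2 8 = (\<Sum>x\<in>box n 8. ?f x)"
    unfolding qsum_def even_form_dim[OF G]
    by (intro sum.cong refl arg_cong[of _ _ ec]) (simp add: qf_eq_hq[OF G box_carrier])
  also have "\<dots> = 4 ^ n * gsum G 1 2"
    using sum_box_periodic[of 2 4 n ?f] periodic_gsum[OF G, of 2 1]
    by (simp add: gsum_def even_form_dim[OF G])
  finally show ?thesis .
qed

lemma gsum_two:
  assumes G: "even_form n G" and d: "odd (det G)" and u: "odd u"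
  shows "even n" "gsum G u 2 = 2 ^ (n div 2) * of_int (kronecker_prime (det G) 2)"
proof -
  have *: "even n \<and> qsum G 2 8 = 32 ^ (n div 2) * of_int (kronecker_prime (det G) 2)"
    using G d by (intro qsum_two) (auto simp: even_form_def)
  then show "even n" by blast
  then obtain m where m: "n = 2 * m" by blast
  have "(4::complex) ^ n * gsum G 1 2 = 4 ^ n * (2 ^ m * of_int (kronecker_prime (det G) 2))"
    using * gsum_two_qsum[OF G] by (simp add: m power_mult power_mult_distrib[symmetric])
  then have "gsum G 1 2 = 2 ^ m * of_int (kronecker_prime (det G) 2)" by simp
  moreover have "gsum G u 2 = gsum G 1 2"
    using u by (intro gsum_cong) (auto simp: cong_def odd_iff_mod_2_eq_one)
  ultimately show "gsum G u 2 = 2 ^ (n div 2) * of_int (kronecker_prime (det G) 2)"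
    by (simp add: m)
qed

text \<open>With \<open>x = d y + c z\<close> the cross term is a multiple of \<open>c d\<close> and
  drops out of the phase; the squares \<open>d^2\<close> and \<open>c^2\<close> divided by
  \<open>c d\<close> leave the twists \<open>d\<close> modulo \<open>c\<close> and \<open>c\<close>
  modulo \<open>d\<close>.\<close>

lemma gsum_crt:
  assumes G: "even_form n G" and cd: "c > 0" "d > 0" "coprime c d"
  shows "gsum G a (c * d) = gsum G (a * d) c * gsum G (a * c) d"
proof -
  let ?f = "\<lambda>x. ec (of_int (a * hq G x) / of_int (c * d))"
  have "gsum G a (c * d) = (\<Sum>y\<in>box n c. \<Sum>z\<in>box n d. ?f (d \<cdot>\<^sub>v y + c \<cdot>\<^sub>v z))"
    using sum_box_crt[OF cd periodic_gsum[OF G]] by (simp add: gsum_def even_form_dim[OF G])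
  also have "\<dots> = (\<Sum>y\<in>box n c. \<Sum>z\<in>box n d.
      ec (of_int (a * d * hq G y) / of_int c) * ec (of_int (a * c * hq G z) / of_int d))"
  proof (intro sum.cong refl)
    fix y z assume "y \<in> box n c" "z \<in> box n d"
    then have y: "y \<in> carrier_vec n" and z: "z \<in> carrier_vec n" using box_carrier by auto
    have "hq G (d \<cdot>\<^sub>v y + c \<cdot>\<^sub>v z) = d\<^sup>2 * hq G y + c * d * (z \<bullet> (G *\<^sub>v y)) + c\<^sup>2 * hq G z"
      using y z even_form_carrier[OF G]
      by (simp add: hq_add[OF G] hq_smult[OF G] mult_mat_smult_vec[of _ n n]
          smult_scalar_prod_distrib[of _ n] scalar_prod_smult_distrib[of _ n])
    then have "of_int (a * hq G (d \<cdot>\<^sub>v y + c \<cdot>\<^sub>v z)) / (of_int (c * d) :: real) =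
       of_int (a * d * hq G y) / of_int c + of_int (a * c * hq G z) / of_int d
         + of_int (a * (z \<bullet> (G *\<^sub>v y)))"
      using cd by (simp add: field_simps power2_eq_square)
    then show "?f (d \<cdot>\<^sub>v y + c \<cdot>\<^sub>v z) =
      ec (of_int (a * d * hq G y) / of_int c) * ec (of_int (a * c * hq G z) / of_int d)"
      by (simp only: ec_add ec_of_int mult_1_right)
  qed
  also have "\<dots> = gsum G (a * d) c * gsum G (a * c) d"
    by (simp add: gsum_def even_form_dim[OF G] sum_product)
  finally show ?thesis .
qed

text \<open>For a nontrivial character, translation by a suitable unit vector multiplies the sum by
  a root of unity other than 1.\<close>

lemma sum_ec_box:
  assumes p: "p > 0" and w: "w \<in> carrier_vec n"
  shows "(\<Sum>z\<in>box n p. ec (of_int (z \<bullet> w) / of_int p)) =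
    (if \<forall>i<n. p dvd w $ i then of_int p ^ n else 0)"
proof -
  let ?f = "\<lambda>z. ec (of_int (z \<bullet> w) / of_int p)"
  show ?thesis
  proof (cases "\<forall>i<n. p dvd w $ i")
    case True
    have "?f z = 1" if "z \<in> box n p" for z
    proof -
      have "p dvd z \<bullet> w"
        using True w by (auto simp: scalar_prod_def intro!: dvd_sum dvd_mult)
      then have "ec (of_int (z \<bullet> w) / of_int p) = ec (of_int 0 / of_int p)"
        by (intro ec_quot_cong) (simp add: cong_0_iff)
      then show ?thesis by simp
    qed
    then show ?thesis using True p by (simp add: card_box)
  next
    case False
    then obtain i where i: "i < n" "\<not> p dvd w $ i" by blast
    have per: "periodic n p ?f"
      unfolding periodic_def
    proof (intro ballI impI ec_quot_cong)
      fix x y assume "x \<in> carrier_vec n" "y \<in> carrier_vec n" "vcong n p x y"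
      then show "[x \<bullet> w = y \<bullet> w] (mod p)"
        using w unfolding scalar_prod_def by (auto simp: vcong_def intro!: cong_sum cong_mult)
    qed
    have "(\<Sum>z\<in>box n p. ?f z) = (\<Sum>z\<in>box n p. ?f (z + unit_vec n i))"
      by (rule sum_box_shift[OF p per, symmetric]) simp
    also have "\<dots> = (\<Sum>z\<in>box n p. ?f z * ec (of_int (w $ i) / of_int p))"
      using w i by (intro sum.cong refl)
        (simp add: add_scalar_prod_distrib[OF box_carrier _ w] ec_add[symmetric] add_divide_distrib)
    also have "\<dots> = (\<Sum>z\<in>box n p. ?f z) * ec (of_int (w $ i) / of_int p)"
      by (simp add: sum_distrib_right)
    finally have "(\<Sum>z\<in>box n p. ?f z) * (1 - ec (of_int (w $ i) / of_int p)) = 0"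
      by (simp add: algebra_simps)
    moreover have "ec (of_int (w $ i) / of_int p) \<noteq> 1"
    proof
      assume "ec (of_int (w $ i) / of_int p) = 1"
      then obtain k :: int where "of_int (w $ i) / of_int p = (of_int k :: real)"
        by (auto simp: ec_eq_1_iff elim: Ints_cases)
      then have "of_int (w $ i) = (of_int (p * k) :: real)" using p by (simp add: field_simps)
      then have "w $ i = p * k" by linarith
      then show False using i by simp
    qed
    ultimately have "(\<Sum>z\<in>box n p. ?f z) = 0" by simp
    then show ?thesis unfolding if_not_P[OF False] .
  qed
qed

text \<open>Multiplying by the adjugate turns divisibility of \<open>G y\<close> into divisibility
  of \<open>det G\<close> times \<open>y\<close>.\<close>

lemma dvd_mult_mat_vec:
  fixes G :: "int mat"
  assumes G: "G \<in> carrier_mat n n" and y: "y \<in> carrier_vec n" and d: "coprime (det G) p"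
    and dvd: "\<forall>i<n. p dvd (G *\<^sub>v y) $ i" and i: "i < n"
  shows "p dvd y $ i"
proof -
  have "adj_mat G *\<^sub>v (G *\<^sub>v y) = (adj_mat G * G) *\<^sub>v y"
    using G y adj_mat(1)[OF G] by (simp add: assoc_mult_mat_vec[of _ n n _ n])
  also have "\<dots> = det G \<cdot>\<^sub>v y"
    using y by (auto simp: adj_mat(3)[OF G] intro!: eq_vecI)
  finally have eq: "adj_mat G *\<^sub>v (G *\<^sub>v y) = det G \<cdot>\<^sub>v y" .
  have "p dvd (adj_mat G *\<^sub>v (G *\<^sub>v y)) $ i"
    using dvd adj_mat(1)[OF G] G y i
    by (auto simp: scalar_prod_def[of "row (adj_mat G) i"] intro!: dvd_sum dvd_mult)
  then have "p dvd det G * y $ i" unfolding eq using y i by simp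
  then show ?thesis using d by (simp add: coprime_dvd_mult_right_iff coprime_commute)
qed

text \<open>Expand \<open>x = y + p^(k+1) z\<close> with \<open>z\<close> modulo \<open>p\<close>.
  The term quadratic in \<open>z\<close> is divisible by \<open>p^(k+2)\<close>, because 2 (k+1)
  \<ge> k+2, so the sum over \<open>z\<close> is a sum of a linear character. It vanishes unless
  \<open>p\<close> divides \<open>G y\<close>, hence \<open>y\<close>; the survivors
  \<open>y = p w\<close> reproduce the sum to the modulus \<open>p^k\<close>, each with weight
  \<open>p^n\<close>.\<close>

lemma gsum_power:
  assumes G: "even_form n G" and p: "p > 0" and d: "coprime (det G) p" and a: "coprime a p"
  shows "gsum G a (p ^ (k + 2)) = of_int p ^ n * gsum G a (p ^ k)"
proof -
  let ?q = "p ^ (k + 1)"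
  let ?f = "\<lambda>x. ec (of_int (a * hq G x) / of_int (p ^ (k + 2)))"
  have Gc: "G \<in> carrier_mat n n" by (rule even_form_carrier[OF G])
  have qp: "?q * p = p ^ (k + 2)" by simp
  have q0: "?q > 0" using p by simp
  have "gsum G a (p ^ (k + 2)) = (\<Sum>y\<in>box n ?q. \<Sum>z\<in>box n p. ?f (y + ?q \<cdot>\<^sub>v z))"
    using sum_box_mult[OF q0 p, of n ?f] periodic_gsum[OF G, of "p ^ (k + 2)" a]
    unfolding gsum_def even_form_dim[OF G] qp by simp
  also have "\<dots> = (\<Sum>y\<in>box n ?q. \<Sum>z\<in>box n p. ?f y * ec (of_int (z \<bullet> (a \<cdot>\<^sub>v (G *\<^sub>v y))) / of_int p))"
  proof (intro sum.cong refl)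
    fix y z assume "y \<in> box n ?q" "z \<in> box n p"
    then have y: "y \<in> carrier_vec n" and z: "z \<in> carrier_vec n" using box_carrier by auto
    have "hq G (y + ?q \<cdot>\<^sub>v z) = hq G y + ?q * (z \<bullet> (G *\<^sub>v y)) + ?q\<^sup>2 * hq G z"
      using y z Gc
      by (simp add: hq_add[OF G] hq_smult[OF G] smult_scalar_prod_distrib[of _ n])
    moreover have "z \<bullet> (a \<cdot>\<^sub>v (G *\<^sub>v y)) = a * (z \<bullet> (G *\<^sub>v y))"
      using y z Gc by (simp add: scalar_prod_smult_distrib[of _ n])
    moreover have "?q\<^sup>2 = p ^ (k + 2) * p ^ k" by (simp add: power2_eq_square power_add algebra_simps)
    ultimately have "of_int (a * hq G (y + ?q \<cdot>\<^sub>v z)) / (of_int (p ^ (k + 2)) :: real) =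
        of_int (a * hq G y) / of_int (p ^ (k + 2)) + of_int (z \<bullet> (a \<cdot>\<^sub>v (G *\<^sub>v y))) / of_int p
          + of_int (a * p ^ k * hq G z)"
      using p by (simp add: field_simps)
    then show "?f (y + ?q \<cdot>\<^sub>v z) = ?f y * ec (of_int (z \<bullet> (a \<cdot>\<^sub>v (G *\<^sub>v y))) / of_int p)"
      by (simp only: ec_add ec_of_int mult_1_right)
  qed
  also have "\<dots> = (\<Sum>y\<in>box n ?q. if \<forall>i<n. p dvd y $ i then of_int p ^ n * ?f y else 0)"
  proof (intro sum.cong refl)
    fix y assume "y \<in> box n ?q"
    then have y: "y \<in> carrier_vec n" by (rule box_carrier)
    have "(\<forall>i<n. p dvd (a \<cdot>\<^sub>v (G *\<^sub>v y)) $ i) \<longleftrightarrow> (\<forall>i<n. p dvd (G *\<^sub>v y) $ i)"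
      using Gc a by (auto simp: coprime_dvd_mult_right_iff coprime_commute)
    also have "\<dots> \<longleftrightarrow> (\<forall>i<n. p dvd y $ i)"
      using dvd_mult_mat_vec[OF Gc y d] Gc y
      by (auto simp: scalar_prod_def intro!: dvd_sum dvd_mult)
    finally have iff: "(\<forall>i<n. p dvd (a \<cdot>\<^sub>v (G *\<^sub>v y)) $ i) \<longleftrightarrow> (\<forall>i<n. p dvd y $ i)" .
    have aux: "x * (if P then z else 0) = (if P then z * x else 0)" for P and x z :: complex
      by simp
    have w: "a \<cdot>\<^sub>v (G *\<^sub>v y) \<in> carrier_vec n" using Gc y by simp
    show "(\<Sum>z\<in>box n p. ?f y * ec (of_int (z \<bullet> (a \<cdot>\<^sub>v (G *\<^sub>v y))) / of_int p)) =
        (if \<forall>i<n. p dvd y $ i then of_int p ^ n * ?f y else 0)"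
      unfolding sum_distrib_left[symmetric] sum_ec_box[OF p w] iff
      by (rule aux)
  qed
  also have "\<dots> = (\<Sum>y\<in>{y \<in> box n ?q. \<forall>i<n. p dvd y $ i}. of_int p ^ n * ?f y)"
    by (rule sum.inter_filter[symmetric]) simp
  also have "\<dots> = (\<Sum>w\<in>box n (p ^ k). of_int p ^ n * ?f (p \<cdot>\<^sub>v w))"
  proof (rule sum.reindex_bij_witness[of _ "\<lambda>w. p \<cdot>\<^sub>v w" "\<lambda>y. vec n (\<lambda>i. y $ i div p)"])
    fix y assume y: "y \<in> {y \<in> box n ?q. \<forall>i<n. p dvd y $ i}"
    show eq: "p \<cdot>\<^sub>v vec n (\<lambda>i. y $ i div p) = y"
      using y by (intro eq_vecI) (auto simp: box_def)
    have "y $ i div p \<in> {0..<p ^ k}" if i: "i < n" for i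
    proof -
      obtain t where t: "y $ i = p * t" using y i by blast
      have "p * 0 \<le> p * t" "p * t < p * p ^ k"
        using y i unfolding t[symmetric] by (auto simp: box_def)
      then have "0 \<le> t" "t < p ^ k"
        using mult_le_cancel_left_pos[OF p] mult_less_cancel_left_pos[OF p] by blast+
      then show ?thesis using p by (simp add: t)
    qed
    then show "vec n (\<lambda>i. y $ i div p) \<in> box n (p ^ k)"
      by (simp add: box_def)
    show "of_int p ^ n * ?f (p \<cdot>\<^sub>v vec n (\<lambda>i. y $ i div p)) = of_int p ^ n * ?f y"
      by (simp only: eq)
  next
    fix w assume w: "w \<in> box n (p ^ k)"
    show "vec n (\<lambda>i. (p \<cdot>\<^sub>v w) $ i div p) = w"
      using w p by (intro eq_vecI) (auto simp: box_def)
    show "p \<cdot>\<^sub>v w \<in> {y \<in> box n ?q. \<forall>i<n. p dvd y $ i}"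
      using w p by (auto simp: box_def)
  qed
  also have "\<dots> = (\<Sum>w\<in>box n (p ^ k). of_int p ^ n * ec (of_int (a * hq G w) / of_int (p ^ k)))"
  proof (intro sum.cong refl)
    fix w assume "w \<in> box n (p ^ k)"
    then have w: "w \<in> carrier_vec n" by (rule box_carrier)
    have "of_int (a * hq G (p \<cdot>\<^sub>v w)) / (of_int (p ^ (k + 2)) :: real) = of_int (a * hq G w) / of_int (p ^ k)"
      using p by (simp add: hq_smult[OF G w] power2_eq_square)
    then show "of_int p ^ n * ?f (p \<cdot>\<^sub>v w) = of_int p ^ n * ec (of_int (a * hq G w) / of_int (p ^ k))"
      by (simp only:)
  qed
  also have "\<dots> = of_int p ^ n * gsum G a (p ^ k)"
    by (simp add: gsum_def even_form_dim[OF G] sum_distrib_left)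
  finally show ?thesis .
qed

section \<open>The Kronecker symbol and odd moduli\<close>

lemma kronecker_superset:
  assumes "b > 0" "finite S" "prime_factors b \<subseteq> S" "\<And>p. p \<in> S \<Longrightarrow> prime p"
  shows "kronecker a b = (\<Prod>p\<in>S. kronecker_prime a p ^ multiplicity p b)"
proof -
  have "kronecker a b = (\<Prod>p\<in>prime_factors b. kronecker_prime a p ^ multiplicity p b)"
    using assms(1) by (simp add: kronecker_def)
  also have "\<dots> = (\<Prod>p\<in>S. kronecker_prime a p ^ multiplicity p b)"
  proof (rule prod.mono_neutral_left)
    show "\<forall>p\<in>S - prime_factors b. kronecker_prime a p ^ multiplicity p b = 1"
      using assms by (auto simp: prime_factors_multiplicity)
  qed (use assms in auto)
  finally show ?thesis .
qed

lemma kronecker_1: "kronecker a 1 = 1"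
  by (simp add: kronecker_def)

lemma kronecker_mult_right:
  assumes "b > 0" "c > 0"
  shows "kronecker a (b * c) = kronecker a b * kronecker a c"
proof -
  let ?S = "prime_factors b \<union> prime_factors c"
  have bc: "b * c > 0" using assms by simp
  have S: "finite ?S" "\<And>p. p \<in> ?S \<Longrightarrow> prime p" by auto
  have "prime_factors (b * c) = ?S"
    using assms by (simp add: prime_factors_product)
  then have "kronecker a (b * c) = (\<Prod>p\<in>?S. kronecker_prime a p ^ multiplicity p (b * c))"
    using bc S by (intro kronecker_superset) auto
  also have "\<dots> = (\<Prod>p\<in>?S. kronecker_prime a p ^ multiplicity p b * kronecker_prime a p ^ multiplicity p c)"
  proof (intro prod.cong refl)
    fix p assume "p \<in> ?S"
    then have "prime_elem p" using S(2) by blast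
    then have "multiplicity p (b * c) = multiplicity p b + multiplicity p c"
      using assms by (intro prime_elem_multiplicity_mult_distrib) auto
    then show "kronecker_prime a p ^ multiplicity p (b * c) =
        kronecker_prime a p ^ multiplicity p b * kronecker_prime a p ^ multiplicity p c"
      by (simp add: power_add)
  qed
  also have "\<dots> = kronecker a b * kronecker a c"
    using kronecker_superset[OF assms(1) S(1) _ S(2), of a] kronecker_superset[OF assms(2) S(1) _ S(2), of a]
    by (simp add: prod.distrib)
  finally show ?thesis .
qed

lemma kronecker_power_right: "b > 0 \<Longrightarrow> kronecker a (b ^ k) = kronecker a b ^ k"
  by (induction k) (simp_all add: kronecker_1[unfolded One_nat_def] kronecker_mult_right)

lemma kronecker_prime_right: "prime p \<Longrightarrow> kronecker a p = kronecker_prime a p"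
  using prime_gt_0_int[of p] by (simp add: kronecker_def prime_factorization_prime)

lemma kronecker_prime_mult:
  assumes "prime p"
  shows "kronecker_prime (a * b) p = kronecker_prime a p * kronecker_prime b p"
proof (cases "p = 2")
  case False
  then have "p > 2" using prime_ge_2_int[OF assms] by simp
  then show ?thesis using Legendre_mult[OF assms] by (simp add: kronecker_prime_def)
qed (simp add: kronecker_prime_2_mult)

text \<open>\<open>c\<close> is odd because at the prime 2 the symbol depends on its upper argument
  modulo 8.\<close>

lemma kronecker_cong_left:
  assumes "c > 0" "odd c" "[a = b] (mod c)"
  shows "kronecker a c = kronecker b c"
proof -
  have "kronecker_prime a p = kronecker_prime b p" if "p \<in> prime_factors c" for p
  proof -
    have "p dvd c" using that by (simp add: in_prime_factors_iff)
    then have "[a = b] (mod p)" "p \<noteq> 2" using assms cong_dvd_modulus by auto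
    then show ?thesis by (simp add: kronecker_prime_def Legendre_cong)
  qed
  then show ?thesis using assms(1) by (simp add: kronecker_def)
qed

lemma kronecker_square:
  assumes "c > 0" "coprime a c"
  shows "kronecker a c * kronecker a c = 1"
proof -
  have "kronecker_prime a p * kronecker_prime a p = 1" if "p \<in> prime_factors c" for p
  proof -
    have p: "prime p" "p dvd c" using that by (auto simp: in_prime_factors_iff)
    then have "\<not> p dvd a" using assms(2) coprime_common_divisor not_prime_unit by blast
    then show ?thesis
      using Legendre_values[of a p] Legendre_zero_iff[of a p] by (auto simp: kronecker_prime_def)
  qed
  then show ?thesis
    using assms(1) by (simp add: kronecker_def prod.distrib[symmetric] power_mult_distrib[symmetric])
qed

text \<open>Stripping the full power of one prime leaves a smaller cofactor coprime to it. The
  product step is restricted to coprime factors, where the Chinese remainder theorem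
  applies.\<close>

lemma coprime_parts_induct [consumes 1, case_names one prime_power mult]:
  fixes c :: int
  assumes "c > 0"
    and one: "P 1"
    and pp: "\<And>p k. prime p \<Longrightarrow> P (p ^ k)"
    and mult: "\<And>a b. a > 0 \<Longrightarrow> b > 0 \<Longrightarrow> coprime a b \<Longrightarrow> P a \<Longrightarrow> P b \<Longrightarrow> P (a * b)"
  shows "P c"
  using assms(1)
proof (induction "nat c" arbitrary: c rule: less_induct)
  case (less c)
  show ?case
  proof (cases "c = 1")
    case False
    then obtain p where p: "prime p" "p dvd c"
      using less.prems prime_factor_int[of c] by auto
    define k where "k = multiplicity p c"
    obtain d where d: "c = p ^ k * d" "\<not> p dvd d"
      unfolding k_def
      by (rule multiplicity_decompose'[of c p]) (use p less.prems not_prime_unit in auto)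
    have p0: "p > 1" using p prime_gt_1_int by simp
    have k: "k > 0" using p less.prems prime_factors_multiplicity[of c] in_prime_factors_iff[of p c] by (auto simp: k_def)
    have pk: "p ^ k > 1" using one_less_power[OF p0 k] .
    have d0: "d > 0" using less.prems d(1) p0 by (simp add: zero_less_mult_iff)
    have "1 * d < p ^ k * d" using pk d0 by (intro mult_strict_right_mono)
    then have "d < c" unfolding d(1) by simp
    then have "P d" using less.hyps[of d] d0 less.prems by simp
    moreover have "coprime (p ^ k) d"
      using p d(2) by (simp add: prime_imp_coprime)
    ultimately show ?thesis
      unfolding d(1) using p0 d0 by (intro mult pp p) auto
  qed (use one in simp)
qed

section \<open>The one-dimensional sum as the Gauss sum of a form of rank one\<close>

lemma gauss1_cong: "[u = w] (mod c) \<Longrightarrow> gauss1 u c = gauss1 w c"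
  unfolding gauss1_def by (intro sum.cong refl ec_quot_cong cong_mult cong_refl)

text \<open>The matrix for which \<open>hq\<close> is \<open>u x^2\<close>: one-dimensional sums
  thereby inherit the Chinese remainder splitting, the recursion and the evaluation from
  \<open>gsum\<close>.\<close>

definition unary :: "int \<Rightarrow> int mat" where
  "unary u = mat 1 1 (\<lambda>_. 2 * u)"

lemma even_form_unary: "even_form 1 (unary u)"
  by (auto simp: even_form_def symm_def unary_def intro!: eq_matI)

lemma det_unary: "det (unary u) = 2 * u"
  using det_single[of "unary u"] by (simp add: unary_def)

lemma gsum_unary: "gsum (unary u) a c = gauss1 (a * u) c"
proof -
  have hq: "hq (unary u) (vec 1 (\<lambda>_. x)) = u * x\<^sup>2" for x
    by (simp add: hq_def qf_def unary_def scalar_prod_def power2_eq_square algebra_simps)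
  have dim: "dim_row (unary u) = 1" by (simp add: unary_def)
  show ?thesis
    unfolding gsum_def dim sum_box_1 hq gauss1_def by (simp add: mult_ac)
qed

lemma gauss1_crt:
  assumes "c > 0" "d > 0" "coprime c d"
  shows "gauss1 u (c * d) = gauss1 (u * d) c * gauss1 (u * c) d"
  using gsum_crt[OF even_form_unary[of 1] assms, of u] by (simp add: gsum_unary)

lemma gauss1_power:
  assumes "p > 0" "odd p" "coprime u p"
  shows "gauss1 u (p ^ (k + 2)) = of_int p * gauss1 u (p ^ k)"
  using gsum_power[OF even_form_unary[of 1] assms(1) _ assms(3), of k] assms
  by (simp add: gsum_unary det_unary)

lemma gauss1_1: "gauss1 u 1 = 1"
  using gsum_1[OF even_form_unary[of 1], of u] by (simp add: gsum_unary)

text \<open>Keeping the power of the one-dimensional sum unevaluated makes the statement multiplicative in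
  \<open>c\<close> without quadratic reciprocity, which is absorbed by the evaluation of \<open>gauss1 h c\<close> for
  composite \<open>c\<close>.\<close>

lemma gsum_odd_gauss1:
  assumes "c > 0" "odd c" "even_form n G" "coprime a c" "coprime (det G) c" "[2 * h = 1] (mod c)"
  shows "gsum G a c = of_int (kronecker (det G) c) * gauss1 (a * h) c ^ n"
  using assms
proof (induction c arbitrary: G a h rule: coprime_parts_induct)
  case one
  show ?case using gsum_1[OF one(2)] by (simp add: gauss1_1 kronecker_1)
next
  case (prime_power p k)
  note G = prime_power(3)
  have p0: "p > 0" using prime_power(1) prime_gt_0_int by simp
  show ?case
  proof (cases "k = 0")
    case True
    then show ?thesis using gsum_1[OF G] by (simp add: gauss1_1 kronecker_1)
  next
    case False
    then have p: "odd p" "coprime a p" "coprime (det G) p"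
      using prime_power(2,4,5) by auto
    have p2: "p > 2" using prime_power(1) p(1) prime_ge_2_int[of p] by (cases "p = 2") auto
    have "p dvd p ^ k" using False by (simp add: dvd_power)
    then have hp: "[2 * h = 1] (mod p)"
      using prime_power(6) cong_dvd_modulus by blast
    then have "coprime (2 * h) p" using cong_imp_coprime[OF cong_sym[OF hp]] by simp
    then have "coprime h p" by simp
    then have ah: "coprime (a * h) p" using p by simp
    have ndvd: "\<not> p dvd x" if "coprime x p" for x
    proof
      assume "p dvd x"
      then have "is_unit p" using coprime_common_divisor[OF that] by simp
      then show False using prime_power(1) not_prime_unit by auto
    qed
    have base: "gsum G a p = of_int (kronecker (det G) p) * gauss1 (a * h) p ^ n"
      using gsum_eq_qsum[OF G hp, of a] p2
        qsum_prime[OF prime_power(1) p2 even_form_symm[OF G] ndvd[OF p(3)] ndvd[OF ah]]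
      by (simp add: kronecker_prime_right[OF prime_power(1)] kronecker_prime_def)
    have "gsum G a (p ^ j) = of_int (kronecker (det G) (p ^ j)) * gauss1 (a * h) (p ^ j) ^ n" for j
    proof (induction j rule: less_induct)
      case (less j)
      have "j = 0 \<or> j = 1 \<or> (\<exists>i. j = i + 2)" by presburger
      then consider "j = 0" | "j = 1" | i where "j = i + 2" by blast
      then show ?case
      proof cases
        case 1
        then show ?thesis using gsum_1[OF G] by (simp add: gauss1_1 kronecker_1)
      next
        case 2
        then show ?thesis using base by simp
      next
        case (3 i)
        \<comment> \<open>Two more factors of \<open>p\<close> contribute the square of a
          sign.\<close>
        have "kronecker (det G) (p ^ j) = kronecker (det G) (p ^ i)"
          using p0 kronecker_square[OF p0 p(3)]
          by (simp add: 3 kronecker_mult_right kronecker_power_right mult.assoc[symmetric])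
        then show ?thesis
          using less.IH[of i]
          unfolding 3 gsum_power[OF G p0 p(3) p(2)] gauss1_power[OF p0 p(1) ah]
          by (simp add: power_mult_distrib)
      qed
    qed
    then show ?thesis .
  qed
next
  case (mult c d)
  have cop: "coprime a c" "coprime a d" "coprime (det G) c" "coprime (det G) d" "odd c" "odd d"
    using mult.prems(1,3,4) by auto
  have h: "[2 * h = 1] (mod c)" "[2 * h = 1] (mod d)"
    using cong_modulus_mult[of "2 * h" 1 c d] cong_modulus_mult[of "2 * h" 1 d c] mult.prems(5)
    by (simp_all only: mult.commute[of d c])
  \<comment> \<open>Only the multiplier is twisted by the cofactor, and \<open>gauss1_crt\<close>
    twists in the same way, so the two sides split alike.\<close>
  have 1: "gsum G (a * d) c = of_int (kronecker (det G) c) * gauss1 (a * d * h) c ^ n"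
    using cop h mult(3) by (intro mult.IH mult.prems(2)) (simp_all add: coprime_commute)
  have 2: "gsum G (a * c) d = of_int (kronecker (det G) d) * gauss1 (a * c * h) d ^ n"
    using cop h mult(3) by (intro mult.IH mult.prems(2)) (simp_all add: coprime_commute)
  have "gauss1 (a * h) (c * d) = gauss1 (a * d * h) c * gauss1 (a * c * h) d"
    using gauss1_crt[OF mult(1-3), of "a * h"] by (simp add: mult_ac)
  then show ?case
    using 1 2
    by (simp add: mult(1,2) gsum_crt[OF mult.prems(2) mult(1-3)] kronecker_mult_right power_mult_distrib)
qed

text \<open>\<open>gsum_odd_gauss1\<close> for the rank-one form \<open>h u x^2\<close>, where
  \<open>2 * h\<close> is 1 modulo \<open>c\<close>: its determinant is \<open>u\<close> modulo
  \<open>c\<close>, and the multiplier \<open>2 * w\<close> leaves \<open>u * w\<close> on one side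
  and \<open>w\<close> on the other. The symbol thus appears for composite \<open>c\<close> without
  a further induction.\<close>

lemma gauss1_mult:
  assumes c: "c > 0" "odd c" and u: "coprime u c" and w: "coprime w c"
  shows "gauss1 (u * w) c = of_int (kronecker u c) * gauss1 w c"
proof -
  define h where "h = (c + 1) div 2"
  have "2 * h = c + 1" using c(2) unfolding h_def by presburger
  then have h: "[2 * h = 1] (mod c)" by (simp add: cong_def)
  have coph: "coprime h c"
    using cong_imp_coprime[OF cong_sym[OF h]] by simp
  have two: "coprime 2 c" using c by simp
  have 1: "[2 * w * (h * u) = u * w] (mod c)" "[2 * (h * u) = u] (mod c)" "[2 * w * h = w] (mod c)"
    using cong_mult[OF h cong_refl[of "u * w"]] cong_mult[OF h cong_refl[of u]]
      cong_mult[OF h cong_refl[of w]] by (simp_all add: mult_ac)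
  have "gsum (unary (h * u)) (2 * w) c =
      of_int (kronecker (det (unary (h * u))) c) * gauss1 (2 * w * h) c ^ 1"
    using u w coph two by (intro gsum_odd_gauss1 c even_form_unary h) (simp_all add: det_unary)
  then show ?thesis
    using gauss1_cong[OF 1(1)] gauss1_cong[OF 1(3)] kronecker_cong_left[OF c 1(2)]
    by (simp add: gsum_unary det_unary)
qed

section \<open>The sign of the one-dimensional Gauss sum\<close>

text \<open>With \<open>x = y + d\<close> the sum over \<open>y\<close> is a complete character sum,
  which vanishes unless \<open>c\<close> divides \<open>2 b d\<close>; as \<open>c\<close> is odd
  and prime to \<open>b\<close>, only \<open>d = 0\<close> survives.\<close>

lemma gauss1_norm:
  assumes c: "c > 0" "odd c" and b: "coprime b c"
  shows "gauss1 b c * cnj (gauss1 b c) = of_int c"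
proof -
  let ?f = "\<lambda>x. ec (of_int (b * x\<^sup>2) / of_int c)"
  have "gauss1 b c * cnj (gauss1 b c) =
      (\<Sum>y\<in>{0..<c}. \<Sum>x\<in>{0..<c}. ec (of_int (b * (x\<^sup>2 - y\<^sup>2)) / of_int c))"
    unfolding gauss1_def cnj_sum sum_product
    by (subst sum.swap) (simp add: ec_minus[symmetric] ec_add[symmetric] right_diff_distrib diff_divide_distrib)
  also have "\<dots> = (\<Sum>y\<in>{0..<c}. \<Sum>d\<in>{0..<c}. ?f d * ec (of_int (y * (2 * b * d)) / of_int c))"
  proof (rule sum.cong[OF refl])
    fix y
    have "(\<Sum>x\<in>{0..<c}. ec (of_int (b * (x\<^sup>2 - y\<^sup>2)) / of_int c)) =
        (\<Sum>d\<in>{0..<c}. ec (of_int (b * ((d + y)\<^sup>2 - y\<^sup>2)) / of_int c))"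
    proof (rule sum_residues_reparam[OF c(1), symmetric])
      fix x x' :: int
      show "ec (of_int (b * (x\<^sup>2 - y\<^sup>2)) / of_int c) = ec (of_int (b * (x'\<^sup>2 - y\<^sup>2)) / of_int c)"
        if "[x = x'] (mod c)"
        by (intro ec_quot_cong cong_mult cong_refl cong_diff cong_pow that)
      show "x = x'" if "x \<in> {0..<c}" "x' \<in> {0..<c}" "[x + y = x' + y] (mod c)"
        using that cong_add_rcancel[of x y x' c] cong_less_imp_eq_int[of x c x'] by auto
    qed
    also have "\<dots> = (\<Sum>d\<in>{0..<c}. ?f d * ec (of_int (y * (2 * b * d)) / of_int c))"
      by (simp add: ec_add[symmetric] add_divide_distrib[symmetric] power2_eq_square algebra_simps)
    finally show "(\<Sum>x\<in>{0..<c}. ec (of_int (b * (x\<^sup>2 - y\<^sup>2)) / of_int c)) =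
      (\<Sum>d\<in>{0..<c}. ?f d * ec (of_int (y * (2 * b * d)) / of_int c))" .
  qed
  also have "\<dots> = (\<Sum>d\<in>{0..<c}. ?f d * (if c dvd 2 * b * d then of_int c else 0))"
    by (subst sum.swap) (simp only: sum_distrib_left[symmetric] sum_ec_residues[OF c(1)])
  also have "\<dots> = (\<Sum>d\<in>{0..<c}. if d = 0 then of_int c else 0)"
  proof (intro sum.cong refl)
    fix d assume d: "d \<in> {0..<c}"
    have "coprime c (2 * b)" using b c by (simp add: coprime_commute)
    then have "c dvd 2 * b * d \<longleftrightarrow> c dvd d" by (rule coprime_dvd_mult_right_iff)
    also have "\<dots> \<longleftrightarrow> d = 0" using d by (auto dest: zdvd_imp_le)
    finally show "?f d * (if c dvd 2 * b * d then of_int c else 0) = (if d = 0 then of_int c else 0)"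
      by simp
  qed
  also have "\<dots> = of_int c" using c(1) by (simp add: sum.delta)
  finally show ?thesis .
qed

text \<open>The nontrivial character modulo 4, meant for odd arguments; the value at even ones is a
  default.\<close>

definition chi4 :: "int \<Rightarrow> int" where
  "chi4 c = (if c mod 4 = 1 then 1 else -1)"

lemma chi4_mult:
  assumes "odd a" "odd b"
  shows "chi4 (a * b) = chi4 a * chi4 b"
proof -
  have ab: "a mod 4 = 1 \<or> a mod 4 = 3" "b mod 4 = 1 \<or> b mod 4 = 3" using assms by presburger+
  have "a * b mod 4 = (a mod 4) * (b mod 4) mod 4" by (simp add: mod_mult_eq)
  then show ?thesis using ab unfolding chi4_def by (elim disjE) simp_all
qed

lemma chi4_1: "chi4 1 = 1"
  by (simp add: chi4_def)

lemma chi4_power: "odd a \<Longrightarrow> chi4 (a ^ k) = chi4 a ^ k"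
  by (induction k) (simp_all add: chi4_mult chi4_1)

text \<open>Euler's criterion gives the congruence, and signs congruent modulo \<open>p > 2\<close>
  agree.\<close>

lemma Legendre_minus_one:
  assumes p: "prime p" "p > 2"
  shows "Legendre (-1) p = chi4 p"
proof -
  define q where "q = nat p"
  have pq: "p = int q" using p by (simp add: q_def)
  have q: "prime q" "2 < q" using p by (auto simp: pq)
  have podd: "odd p" using p prime_odd_int by simp
  have exp: "(-1) ^ ((q - 1) div 2) = chi4 p"
  proof -
    have "even ((q - 1) div 2) \<longleftrightarrow> p mod 4 = 1" using podd q unfolding pq by presburger
    then show ?thesis by (simp add: chi4_def)
  qed
  have "[Legendre (-1) p = chi4 p] (mod p)"
    using euler_criterion[OF q, of "-1"] unfolding pq[symmetric] exp .
  then have "p dvd Legendre (-1) p - chi4 p" by (simp add: cong_iff_dvd_diff)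
  moreover have "\<bar>Legendre (-1) p - chi4 p\<bar> \<le> 2"
    using Legendre_values[of "-1" p] by (auto simp: chi4_def)
  ultimately have "Legendre (-1) p - chi4 p = 0"
    using p zdvd_imp_le[of p "\<bar>Legendre (-1) p - chi4 p\<bar>"] by fastforce
  then show ?thesis by simp
qed

lemma kronecker_minus_one:
  assumes "c > 0" "odd c"
  shows "kronecker (-1) c = chi4 c"
  using assms
proof (induction c rule: coprime_parts_induct)
  case (prime_power p k)
  have p0: "p > 0" using prime_power(1) prime_gt_0_int by simp
  show ?case
  proof (cases "k = 0")
    case False
    then have "odd p" using prime_power(2) by simp
    then have "p > 2" using prime_ge_2_int[OF prime_power(1)] by (cases "p = 2") auto
    then have "kronecker (-1) p = chi4 p"
      using Legendre_minus_one[OF prime_power(1)]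
      by (simp add: kronecker_prime_right[OF prime_power(1)] kronecker_prime_def)
    then show ?thesis using \<open>odd p\<close> by (simp add: kronecker_power_right[OF p0] chi4_power)
  qed (simp add: kronecker_1 chi4_1)
next
  case (mult a b)
  then show ?case by (simp add: kronecker_mult_right chi4_mult)
qed (simp add: kronecker_1 chi4_1)

text \<open>Conjugation turns \<open>b\<close> into \<open>-b\<close>, which multiplies the sum by
  \<open>kronecker (-1) c\<close>; the known norm thereby becomes a square.\<close>

lemma gauss1_square:
  assumes c: "c > 0" "odd c" and b: "coprime b c"
  shows "gauss1 b c ^ 2 = of_int (chi4 c * c)"
proof -
  have "cnj (gauss1 b c) = gauss1 (-1 * b) c"
    by (simp add: gauss1_def ec_minus[symmetric])
  also have "\<dots> = of_int (chi4 c) * gauss1 b c"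
    using gauss1_mult[OF c _ b, of "-1"] kronecker_minus_one[OF c] by simp
  finally have "gauss1 b c * (of_int (chi4 c) * gauss1 b c) = of_int c"
    using gauss1_norm[OF c b] by simp
  then show ?thesis
    by (cases "c mod 4 = 1") (auto simp: chi4_def power2_eq_square minus_equation_iff[of _ "of_int c"])
qed

text \<open>Partial summation: the initial boundary term costs \<open>s L\<close>, the drops of the
  weights telescope to \<open>s L - s (L + m)\<close>, and the final boundary term costs
  \<open>s (L + m)\<close>.\<close>

lemma abel_norm_bound:
  fixes w :: "nat \<Rightarrow> complex" and s :: "nat \<Rightarrow> real"
  assumes w: "\<And>l. norm (w l) \<le> 1" and nonneg: "\<And>l. l \<le> L + m \<Longrightarrow> s l \<ge> 0"
    and dec: "\<And>l. L \<le> l \<Longrightarrow> l < L + m \<Longrightarrow> s (Suc l) \<le> s l"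
  shows "norm (\<Sum>l\<in>{L..L + m}. of_real (s l) * (w (Suc l) - w l)) \<le> 2 * s L"
proof -
  \<comment> \<open>The final boundary term is kept inside the norm, so that each step of the
    induction costs only the drop of \<open>s\<close>.\<close>
  have "norm ((\<Sum>l\<in>{L..L + k}. of_real (s l) * (w (Suc l) - w l)) - of_real (s (L + k)) * w (Suc (L + k)))
      \<le> 2 * s L - s (L + k)" if "k \<le> m" for k
    using that
  proof (induction k)
    case 0
    have "norm (of_real (s L) * w L) \<le> s L * 1"
      unfolding norm_mult using nonneg[of L] w[of L] by (intro mult_mono) auto
    then show ?case by (simp add: algebra_simps)
  next
    case (Suc k)
    let ?A = "\<lambda>k. (\<Sum>l\<in>{L..L + k}. of_real (s l) * (w (Suc l) - w l)) - of_real (s (L + k)) * w (Suc (L + k))"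
    have d: "s (Suc (L + k)) \<le> s (L + k)" using dec[of "L + k"] Suc.prems by simp
    have "?A (Suc k) = ?A k + of_real (s (L + k) - s (Suc (L + k))) * w (Suc (L + k))"
      by (simp add: algebra_simps)
    also have "norm \<dots> \<le> norm (?A k) + norm (of_real (s (L + k) - s (Suc (L + k))) * w (Suc (L + k)))"
      by (rule norm_triangle_ineq)
    also have "norm (of_real (s (L + k) - s (Suc (L + k))) * w (Suc (L + k)))
        \<le> (s (L + k) - s (Suc (L + k))) * 1"
      unfolding norm_mult norm_of_real using d w by (intro mult_mono) auto
    finally show ?case using Suc by simp
  qed
  from this[of m] have 1: "norm ((\<Sum>l\<in>{L..L + m}. of_real (s l) * (w (Suc l) - w l))
      - of_real (s (L + m)) * w (Suc (L + m))) \<le> 2 * s L - s (L + m)" by simp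
  have 2: "norm (of_real (s (L + m)) * w (Suc (L + m))) \<le> s (L + m) * 1"
    unfolding norm_mult using nonneg[of "L + m"] w by (intro mult_mono) auto
  show ?thesis
    using norm_triangle_ineq[of "(\<Sum>l\<in>{L..L + m}. of_real (s l) * (w (Suc l) - w l))
      - of_real (s (L + m)) * w (Suc (L + m))" "of_real (s (L + m)) * w (Suc (L + m))"] 1 2 by simp
qed

text \<open>Jordan's inequality. A point below the chord would, by the mean value theorem on either
  side, give \<open>cos u < 2 / pi < cos v\<close> with \<open>u < v\<close>.\<close>

lemma sin_ge_chord:
  assumes "0 \<le> x" "x \<le> pi / 2"
  shows "sin x \<ge> 2 * x / pi"
proof (rule ccontr)
  assume neg: "\<not> sin x \<ge> 2 * x / pi"
  define g where "g x = sin x - 2 * x / pi" for x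
  have g0: "g 0 = 0" "g (pi / 2) = 0" by (simp_all add: g_def)
  have gx: "g x < 0" using neg by (simp add: g_def)
  have der: "(g has_real_derivative cos t - 2 / pi) (at t)" for t
    unfolding g_def by (auto intro!: derivative_eq_intros)
  have "x \<noteq> 0" "x \<noteq> pi / 2" using gx g0 by (metis less_irrefl)+
  then have x: "0 < x" "x < pi / 2" using assms by linarith+
  obtain u where u: "0 < u" "u < x" "g x - g 0 = (x - 0) * (cos u - 2 / pi)"
    using MVT2[OF x(1), of g "\<lambda>t. cos t - 2 / pi"] der by auto
  obtain v where v: "x < v" "v < pi / 2" "g (pi / 2) - g x = (pi / 2 - x) * (cos v - 2 / pi)"
    using MVT2[OF x(2), of g "\<lambda>t. cos t - 2 / pi"] der by auto
  have "cos u < 2 / pi"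
    using u gx g0 x by (auto simp: mult_less_0_iff)
  moreover have "cos v > 2 / pi"
    using v gx g0 x zero_less_mult_iff[of "pi / 2 - x" "cos v - 2 / pi"] by auto
  moreover have "cos v < cos u"
    using u v pi_gt_zero by (intro cos_monotone_0_pi) auto
  ultimately show False by simp
qed

text \<open>Summation by parts: with \<open>w\<^sub>l = ec (l\<^sup>2 / (2 c))\<close>, the summand is a constant of modulus
  \<open>1/2\<close> times \<open>(w\<^sub>l\<^sub>+\<^sub>1 - w\<^sub>l) / sin (\<pi> (2 l + 1) / (2 c))\<close>, and the cosecants decrease.\<close>

lemma odd_square_tail_bound:
  fixes c L r :: nat
  assumes c: "c = 2 * r + 1" and L: "L \<le> r" and J: "(2 * L + 1)\<^sup>2 \<ge> 3 * c"
  shows "norm ((\<Sum>l\<in>{L..<r}. ec ((2 * real l + 1)\<^sup>2 / (8 * c))) + ec ((2 * real r + 1)\<^sup>2 / (8 * c)) / 2)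
    \<le> sqrt c / sqrt 3"
proof -
  let ?z = "\<lambda>l. ec ((2 * real l + 1)\<^sup>2 / (8 * c))"
  define w where "w l = ec ((real l)\<^sup>2 / (2 * c))" for l
  define \<theta> where "\<theta> l = pi * (2 * real l + 1) / (2 * c)" for l
  have c0: "c > 0" using c by simp
  have \<theta>_pos: "0 < \<theta> l" for l using c0 by (simp add: \<theta>_def)
  have \<theta>_le: "\<theta> l \<le> pi / 2" if "l \<le> r" for l
  proof -
    have "2 * real l + 1 \<le> real c" using that c by simp
    then have "pi * (2 * real l + 1) \<le> pi * real c" by (intro mult_left_mono) auto
    then have "pi * (2 * real l + 1) / (2 * c) \<le> pi * real c / (2 * c)"
      by (intro divide_right_mono) auto
    then show ?thesis using c0 by (simp add: \<theta>_def)
  qed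
  have sin_pos: "sin (\<theta> l) > 0" if "l \<le> r" for l
  proof (rule sin_gt_zero[OF \<theta>_pos])
    show "\<theta> l < pi" using \<theta>_le[OF that] pi_gt_zero by linarith
  qed
  have diff: "w (Suc l) - w l = 2 * \<i> * of_real (sin (\<theta> l)) * ec (1 / (8 * c)) * ?z l" for l
  proof -
    \<comment> \<open>Mean and half the difference of the exponents of \<open>w (Suc l)\<close> and
      \<open>w l\<close>; the difference of the two exponentials is then a sine times an exponential
      at the mean.\<close>
    define M where "M = ((2 * real l + 1)\<^sup>2 + 1) / (8 * c)"
    define D where "D = (2 * real l + 1) / (4 * c)"
    have 1: "(real (Suc l))\<^sup>2 / (2 * c) = M + D" "(real l)\<^sup>2 / (2 * c) = M - D"
      using c0 by (simp_all add: M_def D_def field_simps power2_eq_square)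
    have "w (Suc l) = ec (M + D)" "w l = ec (M + - D)"
      by (simp_all only: w_def 1 diff_conv_add_uminus)
    then have "w (Suc l) - w l = ec M * (ec D - cnj (ec D))"
      by (simp only: ec_add ec_minus right_diff_distrib)
    also have "ec D - cnj (ec D) = 2 * \<i> * of_real (sin (\<theta> l))"
    proof -
      have "2 * pi * D = \<theta> l" by (simp add: D_def \<theta>_def)
      then show ?thesis by (simp add: complex_eq_iff ec_def)
    qed
    also have "ec M = ec (1 / (8 * c)) * ?z l"
      by (simp add: M_def ec_add[symmetric] add_divide_distrib add.commute)
    finally show ?thesis by (simp add: mult_ac)
  qed
  \<comment> \<open>At \<open>r\<close> the cosecant is 1; the weight 1/2 there produces the halved
    last term and keeps the weights decreasing.\<close>
  define s where "s l = (if l < r then 1 / sin (\<theta> l) else 1 / 2)" for l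
  have sin_r: "sin (\<theta> r) = 1"
  proof -
    have "2 * real r + 1 = real c" using c by simp
    then have "\<theta> r = pi / 2" using c0 unfolding \<theta>_def by simp
    then show ?thesis by (simp only: sin_pi_half)
  qed
  define \<kappa> where "\<kappa> = 1 / (2 * \<i> * ec (1 / (8 * c)))"
  have \<kappa>: "norm \<kappa> = 1 / 2" by (simp add: \<kappa>_def norm_divide norm_mult)
  have z_eq: "?z l = \<kappa> * (of_real (1 / sin (\<theta> l)) * (w (Suc l) - w l))" if "l \<le> r" for l
    unfolding diff \<kappa>_def using sin_pos[OF that] by simp
  obtain m where m: "r = L + m" using L le_Suc_ex by blast
  have "(\<Sum>l\<in>{L..<r}. ?z l) + ?z r / 2 = \<kappa> * (\<Sum>l\<in>{L..L + m}. of_real (s l) * (w (Suc l) - w l))"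
  proof -
    have "(\<Sum>l\<in>{L..L + m}. of_real (s l) * (w (Suc l) - w l)) =
        (\<Sum>l\<in>{L..<r}. of_real (s l) * (w (Suc l) - w l)) + of_real (s r) * (w (Suc r) - w r)"
    proof -
      have "{L..L + m} = insert r {L..<r}" using m by auto
      then show ?thesis by (simp add: add.commute)
    qed
    also have "(\<Sum>l\<in>{L..<r}. of_real (s l) * (w (Suc l) - w l)) =
        (\<Sum>l\<in>{L..<r}. of_real (1 / sin (\<theta> l)) * (w (Suc l) - w l))"
      by (intro sum.cong refl) (simp add: s_def)
    moreover have "(\<Sum>l\<in>{L..<r}. ?z l) =
        \<kappa> * (\<Sum>l\<in>{L..<r}. of_real (1 / sin (\<theta> l)) * (w (Suc l) - w l))"
      unfolding sum_distrib_left by (intro sum.cong refl z_eq) simp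
    moreover have "?z r / 2 = \<kappa> * (of_real (s r) * (w (Suc r) - w r))"
      using z_eq[of r] sin_r by (simp add: s_def)
    ultimately show ?thesis by (simp only: distrib_left)
  qed
  also have "norm \<dots> \<le> 1 / 2 * (2 * (if L < r then 1 / sin (\<theta> L) else 1 / 2))"
    unfolding norm_mult \<kappa>
  proof (intro mult_left_mono)
    have "norm (\<Sum>l\<in>{L..L + m}. of_real (s l) * (w (Suc l) - w l)) \<le> 2 * s L"
    proof (rule abel_norm_bound)
      show "norm (w l) \<le> 1" for l by (simp add: w_def)
      show "s l \<ge> 0" for l
        using sin_pos[of l] by (cases "l < r") (auto simp: s_def less_imp_le)
      show "s (Suc l) \<le> s l" if "L \<le> l" "l < L + m" for l
      proof (cases "Suc l < r")
        case True
        have "\<theta> l \<le> \<theta> (Suc l)" using c0 by (simp add: \<theta>_def field_simps)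
        then have "sin (\<theta> l) \<le> sin (\<theta> (Suc l))"
          using \<theta>_pos[of l] \<theta>_le[of "Suc l"] True by (intro sin_monotone_2pi_le) auto
        then show ?thesis using True sin_pos[of l] by (simp add: s_def frac_le)
      next
        case False
        then have lr: "l < r" "Suc l = r" using that m by auto
        have "1 \<le> 1 / sin (\<theta> l)" using sin_pos[of l] lr by simp
        then show ?thesis using lr by (simp add: s_def)
      qed
    qed
    then show "norm (\<Sum>l\<in>{L..L + m}. of_real (s l) * (w (Suc l) - w l)) \<le> 2 * (if L < r then 1 / sin (\<theta> L) else 1 / 2)"
      by (simp add: s_def)
  qed simp
  \<comment> \<open>This also covers \<open>L = r\<close>, where the weight is 1/2.\<close>
  also have "\<dots> \<le> 1 / sin (\<theta> L)"
  proof -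
    have "sin (\<theta> L) \<le> 2" using sin_le_one[of "\<theta> L"] by linarith
    then show ?thesis using sin_pos[OF L] by (simp add: field_simps)
  qed
  also have "\<dots> \<le> real c / (2 * real L + 1)"
  proof -
    have "2 * \<theta> L / pi \<le> sin (\<theta> L)"
      using \<theta>_pos[of L] \<theta>_le[OF L] by (intro sin_ge_chord) auto
    moreover have "2 * \<theta> L / pi = (2 * real L + 1) / c" using c0 by (simp add: \<theta>_def)
    ultimately have "(2 * real L + 1) / c \<le> sin (\<theta> L)" by simp
    then have "1 / sin (\<theta> L) \<le> 1 / ((2 * real L + 1) / c)"
      using c0 by (intro divide_left_mono) (auto simp: sin_pos[OF L])
    then show ?thesis by simp
  qed
  also have "\<dots> \<le> sqrt c / sqrt 3"
  proof -
    have "sqrt (3 * c) \<le> 2 * real L + 1"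
    proof (rule real_le_lsqrt)
      show "real (3 * c) \<le> (2 * real L + 1)\<^sup>2"
        using of_nat_mono[OF J, where 'a = real] by (simp add: add.commute)
    qed simp_all
    then have "sqrt 3 * sqrt c \<le> 2 * real L + 1" by (simp add: real_sqrt_mult)
    then have "sqrt c * (sqrt 3 * sqrt c) \<le> sqrt c * (2 * real L + 1)"
      by (intro mult_left_mono) auto
    also have "sqrt c * (sqrt 3 * sqrt c) = (sqrt c * sqrt c) * sqrt 3" by (simp only: mult_ac)
    also have "sqrt c * sqrt c = real c" by simp
    finally show ?thesis by (simp add: field_simps)
  qed
  finally show ?thesis .
qed

text \<open>Up to \<open>L\<close> the phases lie between -pi/4 and pi/2, so no cosine is negative.
  While the odd square is at most \<open>c\<close> they have modulus at most pi/4 and cosine at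
  least \<open>sqrt 2 / 2\<close>. The number \<open>K\<close> of these terms is positive, so 3 K
  \<ge> 2 K + 1 > \<open>sqrt c\<close>.\<close>

lemma odd_square_head_bound:
  fixes c L :: nat
  assumes c: "c > 0" and head: "\<And>l. l < L \<Longrightarrow> (2 * l + 1)\<^sup>2 < 3 * c"
    and L: "(2 * L + 1)\<^sup>2 \<ge> 3 * c"
  shows "(\<Sum>l<L. Re (ec ((2 * real l + 1)\<^sup>2 / (8 * c) - 1 / 8))) \<ge> sqrt c * sqrt 2 / 6"
proof -
  define K where "K = (LEAST K. (2 * K + 1)\<^sup>2 > c)"
  have ex: "\<exists>K. (2 * K + 1)\<^sup>2 > c"
    by (rule exI[of _ c]) (simp add: power2_eq_square)
  have K: "(2 * K + 1)\<^sup>2 > c" unfolding K_def by (rule LeastI_ex[OF ex])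
  have below_K: "(2 * l + 1)\<^sup>2 \<le> c" if "l < K" for l
    using not_less_Least[of l "\<lambda>K. (2 * K + 1)\<^sup>2 > c"] that unfolding K_def by simp
  have "K \<noteq> 0"
  proof
    assume "K = 0"
    then show False using K c by simp
  qed
  have KL: "K \<le> L"
  proof (rule ccontr)
    assume "\<not> K \<le> L"
    then have "(2 * L + 1)\<^sup>2 \<le> c" by (intro below_K) simp
    then show False using L c by simp
  qed
  define \<phi> where "\<phi> l = 2 * pi * ((2 * real l + 1)\<^sup>2 / (8 * c) - 1 / 8)" for l
  have Re_eq: "Re (ec ((2 * real l + 1)\<^sup>2 / (8 * c) - 1 / 8)) = cos (\<phi> l)" for l
    by (simp add: ec_def \<phi>_def)
  have \<phi>_eq: "\<phi> l = pi / 4 * ((2 * real l + 1)\<^sup>2 / c - 1)" for l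
    by (simp add: \<phi>_def field_simps)
  have \<phi>_ge: "- (pi / 4) \<le> \<phi> l" for l
    unfolding \<phi>_eq using c by (simp add: field_simps)
  have \<phi>_le: "\<phi> l \<le> pi / 4 * (t - 1)" if "(2 * l + 1)\<^sup>2 \<le> t * c" for l t :: nat
  proof -
    have "(2 * real l + 1)\<^sup>2 \<le> t * c"
      using of_nat_mono[OF that, where 'a = real] by (simp add: add.commute)
    then have "(2 * real l + 1)\<^sup>2 / c \<le> t" using c by (simp add: field_simps)
    then show ?thesis unfolding \<phi>_eq by (intro mult_left_mono) auto
  qed
  have nonneg: "0 \<le> cos (\<phi> l)" if "l < L" for l
    using \<phi>_ge[of l] \<phi>_le[of l 3] head[OF that] pi_gt_zero by (intro cos_ge_zero) auto
  have large: "sqrt 2 / 2 \<le> cos (\<phi> l)" if "l < K" for l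
  proof -
    have "\<bar>\<phi> l\<bar> \<le> pi / 4"
      using \<phi>_ge[of l] \<phi>_le[of l 2] below_K[OF that] by auto
    then have "cos (pi / 4) \<le> cos \<bar>\<phi> l\<bar>"
      by (intro cos_monotone_0_pi_le) auto
    then show ?thesis by (simp add: cos_45)
  qed
  have "sqrt c \<le> 3 * real K"
  proof (rule real_le_lsqrt)
    have "c \<le> (3 * K)\<^sup>2"
      using K \<open>K \<noteq> 0\<close> power_mono[of "2 * K + 1" "3 * K" 2] by linarith
    then show "real c \<le> (3 * real K)\<^sup>2"
      using of_nat_mono[where 'a = real] by fastforce
  qed simp
  then have "sqrt c * (sqrt 2 / 6) \<le> 3 * real K * (sqrt 2 / 6)"
    by (intro mult_right_mono) auto
  also have "\<dots> = (\<Sum>l<K. sqrt 2 / 2)" by simp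
  also have "\<dots> \<le> (\<Sum>l<K. cos (\<phi> l))" using large by (intro sum_mono) auto
  also have "\<dots> \<le> (\<Sum>l<L. cos (\<phi> l))"
    using KL nonneg by (intro sum_mono2) auto
  finally show ?thesis unfolding Re_eq by simp
qed

text \<open>The number \<open>ec (-1/8)\<close> times this sum squares to \<open>c\<close>, so this crude bound already singles
  out the root \<open>sqrt c\<close>.\<close>

lemma odd_square_sum_bound:
  fixes c r :: nat
  assumes c: "c = 2 * r + 1"
  shows "Re (ec (- 1 / 8) * (\<Sum>l<c. ec ((2 * real l + 1)\<^sup>2 / (8 * c)))) > - sqrt c"
proof (cases "r = 0")
  case True
  then show ?thesis using c by (simp add: ec_add[symmetric])
next
  case False
  let ?z = "\<lambda>l. ec ((2 * real l + 1)\<^sup>2 / (8 * c))"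
  have c0: "c > 0" using c by simp
  \<comment> \<open>At \<open>3 c\<close> the phase, after the factor \<open>ec (- 1 / 8)\<close>,
    reaches a quarter turn: earlier terms have nonnegative real part, and from there on the
    cosecants are at most \<open>sqrt (c / 3)\<close>. As \<open>r\<close> is positive, c \<ge> 3
    and the index \<open>r\<close> is already past the threshold.\<close>
  define L where "L = (LEAST L. (2 * L + 1)\<^sup>2 \<ge> 3 * c)"
  have exr: "(2 * r + 1)\<^sup>2 \<ge> 3 * c"
    using False unfolding c power2_eq_square by (intro mult_right_mono) auto
  have L: "(2 * L + 1)\<^sup>2 \<ge> 3 * c"
    unfolding L_def by (rule LeastI[of "\<lambda>L. (2 * L + 1)\<^sup>2 \<ge> 3 * c"]) (rule exr)
  have Lr: "L \<le> r"
    unfolding L_def by (rule Least_le) (rule exr)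
  have head: "(2 * l + 1)\<^sup>2 < 3 * c" if "l < L" for l
    using not_less_Least[of l "\<lambda>L. (2 * L + 1)\<^sup>2 \<ge> 3 * c"] that unfolding L_def by simp
  define R where "R = (\<Sum>l\<in>{L..<r}. ?z l) + ?z r / 2"
  have R: "norm R \<le> sqrt c / sqrt 3"
    unfolding R_def by (rule odd_square_tail_bound[OF c Lr L])
  \<comment> \<open>The reflection sends \<open>2 l + 1\<close> to \<open>2 c - (2 l + 1)\<close>
    and fixes \<open>l = r\<close>. The whole sum is therefore twice a half sum in which the middle
    term counts half, whence the last summand of \<open>R\<close>.\<close>
  have refl_z: "?z (2 * r - l) = ?z l" if "l \<le> r" for l
  proof (rule ec_cong)
    have "2 * real (2 * r - l) + 1 = 2 * real c - (2 * real l + 1)"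
      using that c by (simp add: of_nat_diff)
    moreover have "(2 * real c - j)\<^sup>2 / (8 * c) - j\<^sup>2 / (8 * c) = (real c - j) / 2" for j :: real
      using c0 by (simp add: field_simps power2_eq_square)
    moreover have "real c - (2 * real l + 1) = 2 * real_of_int (int r - int l)"
      using c by simp
    ultimately have "(2 * real (2 * r - l) + 1)\<^sup>2 / (8 * c) - (2 * real l + 1)\<^sup>2 / (8 * c) =
        real_of_int (int r - int l)"
      by (simp only:) simp
    then show "(2 * real (2 * r - l) + 1)\<^sup>2 / (8 * c) - (2 * real l + 1)\<^sup>2 / (8 * c) \<in> \<int>"
      by (simp only: Ints_of_int)
  qed
  have "(\<Sum>l<c. ?z l) = (\<Sum>l<r. ?z l) + (\<Sum>l\<in>{r..<c}. ?z l)"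
    unfolding lessThan_atLeast0 by (rule sum.atLeastLessThan_concat[symmetric]) (use c in auto)
  also have "(\<Sum>l\<in>{r..<c}. ?z l) = ?z r + (\<Sum>l\<in>{Suc r..<c}. ?z l)"
    by (rule sum.atLeast_Suc_lessThan) (use c in simp)
  also have "(\<Sum>l\<in>{Suc r..<c}. ?z l) = (\<Sum>l<r. ?z (2 * r - l))"
    by (rule sum.reindex_bij_witness[of _ "\<lambda>l. 2 * r - l" "\<lambda>l. 2 * r - l"]) (use c in auto)
  also have "\<dots> = (\<Sum>l<r. ?z l)"
    by (intro sum.cong refl refl_z) simp
  also have "(\<Sum>l<r. ?z l) = (\<Sum>l<L. ?z l) + (\<Sum>l\<in>{L..<r}. ?z l)"
    unfolding lessThan_atLeast0 by (rule sum.atLeastLessThan_concat[symmetric]) (use Lr in auto)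
  finally have T: "(\<Sum>l<c. ?z l) = 2 * ((\<Sum>l<L. ?z l) + R)"
    by (simp add: R_def)
  have "Re (ec (- 1 / 8) * (\<Sum>l<c. ?z l)) =
      2 * ((\<Sum>l<L. Re (ec ((2 * real l + 1)\<^sup>2 / (8 * c) - 1 / 8))) + Re (ec (- 1 / 8) * R))"
  proof -
    have "ec (- 1 / 8) * (\<Sum>l<L. ?z l) = (\<Sum>l<L. ec ((2 * real l + 1)\<^sup>2 / (8 * c) - 1 / 8))"
      by (simp add: sum_distrib_left ec_add[symmetric])
    then show ?thesis unfolding T
      by (simp add: distrib_left mult.left_commute[of _ 2] Re_sum[symmetric] del: Re_sum)
  qed
  moreover have "(\<Sum>l<L. Re (ec ((2 * real l + 1)\<^sup>2 / (8 * c) - 1 / 8))) \<ge> sqrt c * sqrt 2 / 6"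
    by (rule odd_square_head_bound[OF c0 head L])
  moreover have "- (sqrt c / sqrt 3) \<le> Re (ec (- 1 / 8) * R)"
  proof -
    have "\<bar>Re (ec (- 1 / 8) * R)\<bar> \<le> norm R"
      using abs_Re_le_cmod[of "ec (- 1 / 8) * R"] by (simp add: norm_mult)
    then show ?thesis using R by linarith
  qed
  moreover have "sqrt c * sqrt 2 / 6 - sqrt c / sqrt 3 > - sqrt c / 2"
  proof -
    \<comment> \<open>These rational bounds suffice: 1/5 - 5/8 + 1/2 = 3/40 > 0.\<close>
    have "6 / 5 \<le> sqrt 2" by (rule real_le_rsqrt) (simp add: power2_eq_square)
    moreover have "8 / 5 \<le> sqrt 3" by (rule real_le_rsqrt) (simp add: power2_eq_square)
    then have "1 / sqrt 3 \<le> 1 / (8 / 5)" by (intro divide_left_mono) auto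
    ultimately have "sqrt 2 / 6 - 1 / sqrt 3 + 1 / 2 > 0" by simp
    then have "sqrt c * (sqrt 2 / 6 - 1 / sqrt 3 + 1 / 2) > 0" using c0 by (intro mult_pos_pos) auto
    moreover have "sqrt c * (sqrt 2 / 6 - 1 / sqrt 3 + 1 / 2) =
        sqrt c * sqrt 2 / 6 - sqrt c / sqrt 3 + sqrt c / 2"
      by (simp add: distrib_left right_diff_distrib)
    ultimately show ?thesis by linarith
  qed
  moreover have "- s < x" if "x = 2 * (a + b)" "u \<le> a" "- t \<le> b" "- s / 2 < u - t"
    for s t u a b x :: real
    using that by (simp add: field_simps)
  ultimately show ?thesis by blast
qed

text \<open>\<open>gauss1_square\<close> leaves only a sign open. Recentring at
  \<open>x = r - l\<close> turns the phases, up to a constant, into (2 l + 1)^2 / (8 c), which are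
  symmetric about \<open>l = r\<close> and vary slowly for small \<open>l\<close>, as the estimate
  requires.\<close>

lemma gauss1_half:
  assumes c: "c > 0" "odd c" and h: "[2 * h = 1] (mod c)"
  shows "gauss1 h c = ec ((1 - of_int c) / 8) * of_real (sqrt (of_int c))"
proof -
  obtain r' where r': "c = 2 * r' + 1" using c(2) by (rule oddE)
  define r where "r = nat r'"
  have r: "c = 2 * int r + 1" using r' c(1) by (simp add: r_def)
  define q where "q = 2 * r + 1"
  have q: "c = int q" by (simp add: q_def r)
  have q0: "q > 0" by (simp add: q_def)
  define h' where "h' = int r + 1"
  have h': "2 * h' = c + 1" by (simp add: h'_def r)
  then have h'c: "[2 * h' = 1] (mod c)" by (simp add: cong_def)
  have "[2 * h = 2 * h'] (mod c)" using h h'c by (meson cong_sym cong_trans)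
  moreover have "coprime 2 c" using c by simp
  ultimately have "[h = h'] (mod c)" by (simp add: cong_mult_lcancel)
  then have hh: "gauss1 h c = gauss1 h' c" by (rule gauss1_cong)
  define T where "T = (\<Sum>l<q. ec ((2 * real l + 1)\<^sup>2 / (8 * q)))"
  have "gauss1 h' c = (\<Sum>x\<in>{0..<c}. ec (of_int (h' * (int r - x)\<^sup>2) / of_int c))"
    unfolding gauss1_def
  proof (rule sum_residues_reparam[OF c(1), symmetric])
    show "ec (of_int (h' * x\<^sup>2) / of_int c) = ec (of_int (h' * y\<^sup>2) / of_int c)"
      if "[x = y] (mod c)" for x y
      by (intro ec_quot_cong cong_mult cong_refl cong_pow that)
    show "x = y" if "x \<in> {0..<c}" "y \<in> {0..<c}" "[int r - x = int r - y] (mod c)" for x y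
    proof -
      have "[x = y] (mod c)" using that(3) by (simp add: cong_iff_dvd_diff dvd_diff_commute)
      then show ?thesis using that cong_less_imp_eq_int[of x c y] by auto
    qed
  qed
  also have "\<dots> = (\<Sum>l<q. ec (of_int (h' * (int r - int l)\<^sup>2) / of_int c))"
    unfolding sum_int_atLeastLessThan q by simp
  also have "\<dots> = (\<Sum>l<q. ec ((3 * of_int c + 4) / 8) * ec ((2 * real l + 1)\<^sup>2 / (8 * q)))"
  proof (intro sum.cong refl)
    fix l
    define m where "m = int r - int l"
    have "even (m * (m - 1))" by simp
    then obtain k where k: "m * (m - 1) = 2 * k" by (rule evenE)
    \<comment> \<open>Here \<open>2 h' = c + 1\<close>, \<open>2 m = c - (2 l + 1)\<close> and
      \<open>m^2 = m + 2 k\<close>; the parity of \<open>m (m - 1)\<close> makes the last term a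
      multiple of \<open>8 c\<close>.\<close>
    have "8 * (h' * m\<^sup>2) = (2 * int l + 1)\<^sup>2 + c * (3 * c + 4) + 8 * c * (k - int l - 1)"
    proof -
      have l: "int l = int r - m" by (simp add: m_def)
      have "8 * c * k = 4 * c * (m * (m - 1))" using k by simp
      then show ?thesis
        unfolding l h'_def r by (simp add: power2_eq_square algebra_simps)
    qed
    then have "real_of_int (8 * (h' * m\<^sup>2)) = of_int
        ((2 * int l + 1)\<^sup>2 + c * (3 * c + 4) + 8 * c * (k - int l - 1))" by (simp only:)
    then have "8 * of_int (h' * m\<^sup>2) = (2 * real l + 1)\<^sup>2 + of_int c * (3 * of_int c + 4)
        + 8 * of_int c * of_int (k - int l - 1)"
      by simp
    then have "of_int (h' * m\<^sup>2) / of_int c =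
        (3 * of_int c + 4) / 8 + (2 * real l + 1)\<^sup>2 / (8 * q) + of_int (k - int l - 1)"
      using q0 by (simp add: q field_simps)
    then show "ec (of_int (h' * (int r - int l)\<^sup>2) / of_int c) =
        ec ((3 * of_int c + 4) / 8) * ec ((2 * real l + 1)\<^sup>2 / (8 * q))"
      unfolding m_def[symmetric] by (simp only: ec_add ec_of_int mult_1_right)
  qed
  also have "\<dots> = ec ((3 * of_int c + 4) / 8) * T" by (simp add: T_def sum_distrib_left)
  finally have gT: "gauss1 h' c = ec ((3 * of_int c + 4) / 8) * T" .
  define X where "X = ec (- 1 / 8) * T"
  have gX: "gauss1 h' c = ec ((1 - of_int c) / 8) * X"
  proof -
    have "ec ((3 * of_int c + 4) / 8) = ec ((1 - of_int c) / 8 + - 1 / 8)"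
    proof (rule ec_cong)
      have "(3 * real_of_int c + 4) / 8 - ((1 - real_of_int c) / 8 + - 1 / 8) = of_int (int r + 1)"
        by (simp add: r field_simps)
      then show "(3 * real_of_int c + 4) / 8 - ((1 - real_of_int c) / 8 + - 1 / 8) \<in> \<int>"
        by (simp only: Ints_of_int)
    qed
    then show ?thesis by (simp only: gT X_def ec_add mult.assoc)
  qed
  have "coprime h' c" using cong_imp_coprime[OF cong_sym[OF h'c]] by simp
  then have "(ec ((1 - of_int c) / 8) * X)\<^sup>2 = of_int (chi4 c * c)"
    unfolding gX[symmetric] by (rule gauss1_square[OF c])
  moreover have "ec ((1 - of_int c) / 8) ^ 2 = of_int (chi4 c)"
  proof -
    have "ec ((1 - of_int c) / 8) ^ 2 = ec (of_int (- int r) / 2)"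
      by (simp add: ec_power r)
    also have "\<dots> = of_int (chi4 c)"
      unfolding ec_half_int chi4_def r by (auto; presburger)
    finally show ?thesis .
  qed
  ultimately have "of_int (chi4 c) * X\<^sup>2 = of_int (chi4 c) * of_int c"
    by (simp add: power_mult_distrib)
  then have "X\<^sup>2 = (of_real (sqrt (of_int c)))\<^sup>2"
    using c(1) by (simp add: chi4_def of_real_power[symmetric] del: of_real_power split: if_splits)
  then have "X = of_real (sqrt (of_int c)) \<or> X = - of_real (sqrt (of_int c))"
    by (simp add: power2_eq_iff)
  moreover have "Re X > - sqrt (of_int c)"
    using odd_square_sum_bound[OF q_def] by (simp add: X_def T_def q)
  ultimately have "X = of_real (sqrt (of_int c))" by auto
  then show ?thesis using hh gX by simp
qed

section \<open>Gauss sums to an arbitrary modulus\<close>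

text \<open>Neither base case of the two-step recursion sees the odd multiplier \<open>u\<close>,
  and even rank makes the powers of the square root integral. Hence no root of unity arises at
  2.\<close>

lemma gsum_two_power:
  assumes G: "even_form n G" and d: "odd (det G)" and u: "odd u"
  shows "gsum G u (2 ^ k) = of_int (kronecker (det G) (2 ^ k)) * of_real (sqrt (2 ^ k)) ^ n"
proof (induction k rule: less_induct)
  case (less k)
  obtain m where m: "n = 2 * m" using gsum_two(1)[OF G d u] by blast
  have sq: "complex_of_real (sqrt (2 ^ j)) ^ n = (2 ^ j) ^ m" for j
  proof -
    have "sqrt (2 ^ j) ^ n = (2 ^ j) ^ m" by (simp add: m power_mult)
    then have "complex_of_real (sqrt (2 ^ j) ^ n) = of_real ((2 ^ j) ^ m)" by (simp only:)
    then show ?thesis by simp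
  qed
  have "k = 0 \<or> k = 1 \<or> (\<exists>i. k = i + 2)" by presburger
  then consider "k = 0" | "k = 1" | i where "k = i + 2" by blast
  then show ?case
  proof cases
    case 1
    then show ?thesis using gsum_1[OF G] by (simp add: kronecker_1)
  next
    case 2
    then show ?thesis
      using gsum_two(2)[OF G d u] kronecker_prime_right[of 2 "det G"] sq[of 1]
      by (simp add: m)
  next
    case (3 i)
    have cop: "coprime (det G) 2" "coprime u 2" using d u by simp_all
    have "kronecker (det G) (2 ^ k) = kronecker (det G) (2 ^ i)"
    proof -
      have "kronecker (det G) 2 * kronecker (det G) 2 = 1"
        by (rule kronecker_square[OF _ cop(1)]) simp
      moreover have pow: "kronecker (det G) (2 ^ j) = kronecker (det G) 2 ^ j" for j
        by (rule kronecker_power_right) simp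
      ultimately show ?thesis unfolding 3 pow by (simp add: mult.assoc[symmetric])
    qed
    then show ?thesis
      using less.IH[of i] gsum_power[OF G _ cop, of i]
      unfolding sq by (simp add: 3 m power_mult power_mult_distrib)
  qed
qed

lemma odd_part_odd: "odd c \<Longrightarrow> odd_part c = c"
  by (simp add: odd_part_def not_dvd_imp_multiplicity_0)

lemma odd_part_two_power: "odd d \<Longrightarrow> odd_part (2 ^ k * d) = d"
proof -
  assume d: "odd d"
  then have "d \<noteq> 0" by auto
  then have "multiplicity 2 (2 ^ k * d) = k"
    using d by (simp add: prime_elem_multiplicity_mult_distrib not_dvd_imp_multiplicity_0)
  then show ?thesis by (simp add: odd_part_def)
qed

lemma gsum_odd:
  assumes c: "c > 0" "odd c" and G: "even_form n G" and a: "coprime a c" and d: "coprime (det G) c"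
  shows "gsum G a c = of_int (kronecker (det G) c) * of_int (kronecker a c) ^ n *
    ec (of_nat n * (1 - of_int c) / 8) * of_real (sqrt (of_int c)) ^ n"
proof -
  define h where "h = (c + 1) div 2"
  have "2 * h = c + 1" using c(2) unfolding h_def by presburger
  then have h: "[2 * h = 1] (mod c)" by (simp add: cong_def)
  have "coprime (2 * h) c" using cong_imp_coprime[OF cong_sym[OF h]] by simp
  then have hc: "coprime h c" by simp
  have "gsum G a c = of_int (kronecker (det G) c) * gauss1 (a * h) c ^ n"
    by (rule gsum_odd_gauss1[OF c G a d h])
  also have "gauss1 (a * h) c = of_int (kronecker a c) * (ec ((1 - of_int c) / 8) * of_real (sqrt (of_int c)))"
    unfolding gauss1_mult[OF c a hc] gauss1_half[OF c h] ..
  finally show ?thesis by (simp add: power_mult_distrib ec_power mult_ac)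
qed

text \<open>For even \<open>c\<close> the rank is even, so the \<open>n\<close>-th power of a symbol
  with coprime arguments is 1. The twists by the Chinese remainder cofactors thereby disappear, and
  only the odd factor contributes a root of unity.\<close>

lemma gsum_formula:
  assumes c: "c > 0" and G: "even_form n G" and a: "coprime a c" and d: "coprime (det G) c"
  shows "gsum G a c = of_int (kronecker (det G) c) * of_int (kronecker a c) ^ n *
    ec (of_nat n * (1 - of_int (odd_part c)) / 8) * of_real (sqrt (of_int c)) ^ n"
proof (cases "odd c")
  case True
  then show ?thesis using gsum_odd[OF c True G a d] by (simp add: odd_part_odd)
next
  case False
  define k where "k = multiplicity 2 c"
  obtain r where r: "c = 2 ^ k * r" "odd r"
    unfolding k_def by (rule multiplicity_decompose'[of c 2]) (use c in auto)
  have r0: "r > 0" using c unfolding r(1) by (simp add: zero_less_mult_iff)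
  have odds: "odd (det G)" "odd a" using False a d coprime_common_divisor[of _ c 2] by auto
  have cop: "coprime a r" "coprime (det G) r" "coprime (2 ^ k) r" "coprime (a * 2 ^ k) r"
    using a d r by auto
  have "odd (a * r)" using odds r by simp
  obtain m where m: "n = 2 * m" using gsum_two(1)[OF G odds] by blast
  have even_pow: "(of_int (kronecker b j) :: complex) ^ n = 1" if "j > 0" "coprime b j" for b j
  proof -
    have "(of_int (kronecker b j) :: complex) ^ 2 = of_int (kronecker b j * kronecker b j)"
      by (simp add: power2_eq_square)
    then show ?thesis using kronecker_square[OF that] by (simp add: m power_mult)
  qed
  have "gsum G a c = gsum G (a * r) (2 ^ k) * gsum G (a * 2 ^ k) r"
    unfolding r(1) by (rule gsum_crt[OF G _ r0 cop(3)]) simp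
  also have "\<dots> = (of_int (kronecker (det G) (2 ^ k)) * of_real (sqrt (2 ^ k)) ^ n) *
      (of_int (kronecker (det G) r) * ec (of_nat n * (1 - of_int r) / 8) * of_real (sqrt (of_int r)) ^ n)"
    unfolding gsum_two_power[OF G odds(1) \<open>odd (a * r)\<close>] gsum_odd[OF r0 r(2) G cop(4) cop(2)]
      even_pow[OF r0 cop(4)] by simp
  also have "\<dots> = of_int (kronecker (det G) c) * of_int (kronecker a c) ^ n *
    ec (of_nat n * (1 - of_int r) / 8) * of_real (sqrt (of_int c)) ^ n"
    unfolding even_pow[OF c a]
    using r0 by (simp add: r(1) kronecker_mult_right real_sqrt_mult power_mult_distrib mult_ac)
  finally show ?thesis unfolding r(1) odd_part_two_power[OF r(2)] .
qed

section \<open>The level, completing the square and the representation number\<close>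

lemma inv_mat_props:
  fixes G :: "int mat"
  assumes G: "G \<in> carrier_mat n n" and d: "det G \<noteq> 0"
  shows "inv_mat G \<in> carrier_mat n n" "map_mat real_of_int G * inv_mat G = 1\<^sub>m n"
    "inv_mat G * map_mat real_of_int G = 1\<^sub>m n"
proof -
  let ?R = "map_mat real_of_int G"
  have R: "?R \<in> carrier_mat n n" using G by simp
  have "det ?R = of_int (det G)" by (rule of_int_hom.hom_det)
  then have "?R \<in> Units (ring_mat TYPE(real) n ())"
    using d by (intro det_non_zero_imp_unit[OF R]) simp
  then have "mat_inverse ?R \<noteq> None" using mat_inverse(1)[OF R, of "()"] by blast
  then obtain B where B: "mat_inverse ?R = Some B" by blast
  then have "inv_mat G = B" by (simp add: inv_mat_def)
  then show "inv_mat G \<in> carrier_mat n n" "?R * inv_mat G = 1\<^sub>m n" "inv_mat G * ?R = 1\<^sub>m n"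
    using mat_inverse(2)[OF R B] by auto
qed

lemma det_smult_inv_mat:
  fixes G :: "int mat"
  assumes G: "G \<in> carrier_mat n n" and d: "det G \<noteq> 0"
  shows "of_int (det G) \<cdot>\<^sub>m inv_mat G = map_mat real_of_int (adj_mat G)"
proof -
  let ?R = "map_mat real_of_int G" and ?A = "map_mat real_of_int (adj_mat G)"
  note inv = inv_mat_props[OF assms]
  have A: "?A \<in> carrier_mat n n" using adj_mat(1)[OF G] by simp
  have R: "?R \<in> carrier_mat n n" using G by simp
  have "?A * ?R = map_mat real_of_int (adj_mat G * G)"
    by (rule of_int_hom.mat_hom_mult[symmetric, OF adj_mat(1)[OF G] G])
  also have "\<dots> = of_int (det G) \<cdot>\<^sub>m 1\<^sub>m n"
    unfolding adj_mat(3)[OF G] by (intro eq_matI) auto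
  finally have AR: "?A * ?R = of_int (det G) \<cdot>\<^sub>m 1\<^sub>m n" .
  have "?A = ?A * (?R * inv_mat G)" using inv A by simp
  also have "\<dots> = (?A * ?R) * inv_mat G" using A R inv by (intro assoc_mult_mat[symmetric]) auto
  also have "\<dots> = of_int (det G) \<cdot>\<^sub>m inv_mat G"
    unfolding AR using inv(1) by (simp add: mult_smult_assoc_mat[of _ n n _ n])
  finally show ?thesis by simp
qed

text \<open>Twice \<bar>\<open>det G\<close>\<bar> is admissible, since the adjugate is integral and
  doubling makes the diagonal even; so the \<open>LEAST\<close> defining the level is
  attained.\<close>

lemma level_props:
  fixes G :: "int mat"
  assumes G: "G \<in> carrier_mat n n" and d: "det G \<noteq> 0"
  shows "level G > 0" "even_integral (of_nat (level G) \<cdot>\<^sub>m inv_mat G)"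
proof -
  let ?P = "\<lambda>N::nat. 0 < N \<and> even_integral (of_nat N \<cdot>\<^sub>m inv_mat G)"
  define N where "N = nat (2 * \<bar>det G\<bar>)"
  note inv = inv_mat_props[OF assms]
  have entry: "real N * inv_mat G $$ (i, j) = 2 * of_int (sgn (det G) * adj_mat G $$ (i, j))"
    if "i < n" "j < n" for i j
  proof -
    have "of_int (det G) * inv_mat G $$ (i, j) = (of_int (det G) \<cdot>\<^sub>m inv_mat G) $$ (i, j)"
      using that inv(1) by simp
    also have "\<dots> = of_int (adj_mat G $$ (i, j))"
      unfolding det_smult_inv_mat[OF assms] using that adj_mat(1)[OF G] by simp
    finally have 1: "of_int (det G) * inv_mat G $$ (i, j) = real_of_int (adj_mat G $$ (i, j))" .
    have "real N = 2 * of_int (sgn (det G)) * of_int (det G)"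
      by (simp add: N_def sgn_if)
    then show ?thesis by (simp add: 1 mult.assoc)
  qed
  have "?P N"
    unfolding even_integral_def using d inv(1)
    by (auto simp: entry N_def[symmetric] simp del: of_int_mult) (auto simp: N_def)
  then have "?P (level G)" unfolding level_def by (rule LeastI)
  then show "level G > 0" "even_integral (of_nat (level G) \<cdot>\<^sub>m inv_mat G)" by auto
qed

text \<open>\<open>M\<close> is \<open>N G^{-1}\<close> as an integer matrix, and itself an even
  form. With it the square can be completed, half included, by congruences between integers.\<close>

lemma level_adjoint:
  fixes G :: "int mat"
  assumes G: "symm n G" and d: "det G \<noteq> 0"
  obtains M where "even_form n M" "G * M = int (level G) \<cdot>\<^sub>m 1\<^sub>m n"
    "\<And>i j. i < n \<Longrightarrow> j < n \<Longrightarrow> real_of_int (M $$ (i, j)) = real (level G) * inv_mat G $$ (i, j)"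
proof -
  have Gc: "G \<in> carrier_mat n n" using G by (rule symm_carrier)
  note inv = inv_mat_props[OF Gc d] and lev = level_props[OF Gc d]
  define N where "N = level G"
  \<comment> \<open>The entries are integers already; the floor only changes their type.\<close>
  define M where "M = mat n n (\<lambda>(i, j). \<lfloor>real N * inv_mat G $$ (i, j)\<rfloor>)"
  have Mc: "M \<in> carrier_mat n n" by (simp add: M_def)
  have entry: "real_of_int (M $$ (i, j)) = real N * inv_mat G $$ (i, j)" if "i < n" "j < n" for i j
  proof -
    have "real N * inv_mat G $$ (i, j) \<in> \<int>"
      using lev(2) that inv(1) unfolding even_integral_def N_def by auto
    then show ?thesis using that by (simp add: M_def of_int_floor)
  qed
  have "map_mat real_of_int M = of_nat N \<cdot>\<^sub>m inv_mat G"
    using inv(1) Mc by (intro eq_matI) (auto simp: entry)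
  then have "map_mat real_of_int (G * M) = map_mat real_of_int G * (of_nat N \<cdot>\<^sub>m inv_mat G)"
    using of_int_hom.mat_hom_mult[OF Gc Mc, where 'a = real] by simp
  also have "\<dots> = of_nat N \<cdot>\<^sub>m 1\<^sub>m n"
    using inv Gc by (simp add: mult_smult_distrib[of _ n n _ n])
  also have "\<dots> = map_mat real_of_int (int N \<cdot>\<^sub>m 1\<^sub>m n)"
    by (intro eq_matI) auto
  finally have GM: "G * M = int N \<cdot>\<^sub>m 1\<^sub>m n"
    by (rule of_int_hom.mat_hom_inj)
  have "transpose_mat M * G = transpose_mat (G * M)"
    using G Gc Mc transpose_mult[OF Gc Mc] by (simp add: symm_def)
  also have "\<dots> = int N \<cdot>\<^sub>m 1\<^sub>m n" unfolding GM by (intro eq_matI) auto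
  finally have MG: "transpose_mat M * G = int N \<cdot>\<^sub>m 1\<^sub>m n" .
  \<comment> \<open>Associating the product of the transpose of \<open>M\<close>, \<open>G\<close>
    and \<open>M\<close> in two ways shows that \<open>M\<close> is symmetric.\<close>
  have "int N \<cdot>\<^sub>m transpose_mat M = transpose_mat M * (G * M)"
    unfolding GM using Mc by (simp add: mult_smult_distrib[of _ n n _ n])
  also have "\<dots> = (transpose_mat M * G) * M"
    using Mc Gc by (intro assoc_mult_mat[symmetric]) auto
  also have "\<dots> = int N \<cdot>\<^sub>m M"
    unfolding MG using Mc by (simp add: mult_smult_assoc_mat[of _ n n _ n])
  finally have NM: "int N \<cdot>\<^sub>m transpose_mat M = int N \<cdot>\<^sub>m M" .
  have N0: "N > 0" using lev(1) by (simp add: N_def)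
  have "transpose_mat M = M"
  proof (rule eq_matI)
    fix i j assume "i < dim_row M" "j < dim_col M"
    then have "int N * transpose_mat M $$ (i, j) = int N * M $$ (i, j)"
      using arg_cong[OF NM, of "\<lambda>A. A $$ (i, j)"] Mc by auto
    then show "transpose_mat M $$ (i, j) = M $$ (i, j)" using N0 by simp
  qed (use Mc in auto)
  moreover have "even (M $$ (i, i))" if i: "i < n" for i
  proof -
    obtain k :: int where "real N * inv_mat G $$ (i, i) = 2 * of_int k"
      using lev(2) i inv(1) unfolding even_integral_def N_def by auto
    then have "real_of_int (M $$ (i, i)) = of_int (2 * k)" using entry[OF i i] by simp
    then have "M $$ (i, i) = 2 * k" by linarith
    then show ?thesis by simp
  qed
  ultimately have "even_form n M" using Mc by (simp add: even_form_def symm_def)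
  then show thesis using that GM entry unfolding N_def by blast
qed

text \<open>Translate \<open>x\<close> by \<open>- a k M v\<close>, which \<open>G\<close> maps to \<open>(1 - c c') v \<equiv> v (mod c)\<close>.\<close>

lemma complete_square:
  fixes G M :: "int mat"
  assumes G: "even_form n G" and M: "even_form n M" and GM: "G * M = N \<cdot>\<^sub>m 1\<^sub>m n"
    and v: "v \<in> carrier_vec n" and c: "c > 0" and k: "c * c' - 1 = a * N * k"
  shows "(\<Sum>x\<in>box n c. ec (of_int (a * (hq G x + v \<bullet> x)) / of_int c)) =
    gsum G a c * ec (of_int (a * a * k * hq M v) / of_int c)"
proof -
  define s where "s = - (a * k)"
  define u where "u = s \<cdot>\<^sub>v (M *\<^sub>v v)"
  have Gc: "G \<in> carrier_mat n n" and Mc: "M \<in> carrier_mat n n"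
    using G M even_form_carrier by auto
  have Mv: "M *\<^sub>v v \<in> carrier_vec n" using Mc v by simp
  have u: "u \<in> carrier_vec n" using Mv by (simp add: u_def)
  have "G *\<^sub>v u = s \<cdot>\<^sub>v (G *\<^sub>v (M *\<^sub>v v))"
    unfolding u_def by (rule mult_mat_smult_vec[OF Gc Mv])
  also have "G *\<^sub>v (M *\<^sub>v v) = N \<cdot>\<^sub>v v"
  proof -
    have "G *\<^sub>v (M *\<^sub>v v) = (N \<cdot>\<^sub>m 1\<^sub>m n) *\<^sub>v v"
      using Gc Mc v GM by (simp add: assoc_mult_mat_vec[symmetric, of _ n n _ n])
    also have "\<dots> = N \<cdot>\<^sub>v v" using v by (auto intro!: eq_vecI)
    finally show ?thesis .
  qed
  also have "s \<cdot>\<^sub>v (N \<cdot>\<^sub>v v) = (s * N) \<cdot>\<^sub>v v"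
    by (rule smult_smult_assoc)
  also have "s * N = 1 - c * c'" using k by (simp add: s_def algebra_simps)
  finally have Gu: "G *\<^sub>v u = (1 - c * c') \<cdot>\<^sub>v v" .
  have "2 * hq G u = u \<bullet> (G *\<^sub>v u)"
    using qf_eq_hq[OF G u] by (simp add: qf_def)
  also have "\<dots> = (1 - c * c') * s * (v \<bullet> (M *\<^sub>v v))"
    unfolding Gu using u v Mv comm_scalar_prod[OF Mv v]
    by (simp add: u_def scalar_prod_smult_distrib[of _ n] smult_scalar_prod_distrib[of _ n])
  also have "v \<bullet> (M *\<^sub>v v) = 2 * hq M v"
    using qf_eq_hq[OF M v] by (simp add: qf_def)
  finally have hu: "hq G u = (1 - c * c') * s * hq M v" by simp
  let ?f = "\<lambda>x. ec (of_int (a * hq G x) / of_int c)"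
  let ?ph = "ec (of_int (a * a * k * hq M v) / of_int c)"
  have "?f (x + u) * ?ph = ec (of_int (a * (hq G x + v \<bullet> x)) / of_int c)" if x: "x \<in> box n c" for x
  proof -
    have xc: "x \<in> carrier_vec n" using x by (rule box_carrier)
    have "u \<bullet> (G *\<^sub>v x) = x \<bullet> (G *\<^sub>v u)"
      by (rule symm_scalar_prod_commute[OF even_form_symm[OF G] u xc])
    also have "\<dots> = (1 - c * c') * (v \<bullet> x)"
      unfolding Gu using xc v comm_scalar_prod[OF v xc] by (simp add: scalar_prod_smult_distrib[of _ n])
    finally have shift: "hq G (x + u) = hq G x + (1 - c * c') * (v \<bullet> x) + (1 - c * c') * s * hq M v"
      unfolding hq_add[OF G xc u] hu by simp
    \<comment> \<open>Modulo \<open>c\<close> the factor \<open>1 - c * c'\<close> is 1, so the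
      shift leaves the constant \<open>- a * a * k * hq M v\<close>, which the second summand
      cancels.\<close>
    have "a * hq G (x + u) + a * a * k * hq M v =
        a * (hq G x + v \<bullet> x) + c * (a * (c' * a * k * hq M v - c' * (v \<bullet> x)))"
      unfolding shift by (simp add: s_def algebra_simps)
    then have "[a * hq G (x + u) + a * a * k * hq M v = a * (hq G x + v \<bullet> x)] (mod c)"
      by (simp add: cong_def)
    then have "ec (of_int (a * hq G (x + u) + a * a * k * hq M v) / of_int c) =
        ec (of_int (a * (hq G x + v \<bullet> x)) / of_int c)"
      by (rule ec_quot_cong)
    then show ?thesis by (simp add: ec_add[symmetric] add_divide_distrib)
  qed
  then have "(\<Sum>x\<in>box n c. ec (of_int (a * (hq G x + v \<bullet> x)) / of_int c)) =
      (\<Sum>x\<in>box n c. ?f (x + u)) * ?ph"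
    unfolding sum_distrib_right by (intro sum.cong refl) simp
  also have "(\<Sum>x\<in>box n c. ?f (x + u)) = gsum G a c"
    unfolding sum_box_shift[OF c periodic_gsum[OF G] u] by (simp add: gsum_def even_form_dim[OF G])
  finally show ?thesis .
qed

section \<open>The representation number as a sum over additive characters\<close>

lemma hq_affine_vcong:
  assumes G: "even_form n G" and v: "v \<in> carrier_vec n"
    and x: "x \<in> carrier_vec n" and y: "y \<in> carrier_vec n" and xy: "vcong n c x y"
  shows "[hq G x + v \<bullet> x = hq G y + v \<bullet> y] (mod c)"
proof (rule cong_add[OF hq_vcong[OF G x y xy]])
  show "[v \<bullet> x = v \<bullet> y] (mod c)"
    using x y xy unfolding scalar_prod_def by (auto simp: vcong_def intro!: cong_sum cong_mult)
qed

text \<open>Each class meets the box exactly once, and solving the congruence is invariant within a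
  class.\<close>

lemma rep_count_eq_card:
  assumes G: "even_form n G" and v: "v \<in> carrier_vec n" and c: "c > 0"
  shows "rep_count G v m c = card {x \<in> box n c. [hq G x + v \<bullet> x = m] (mod c)}"
proof -
  let ?P = "\<lambda>x. [hq G x + v \<bullet> x = m] (mod c)"
  let ?A = "{x \<in> carrier_vec n. ?P x}" and ?B = "{x \<in> box n c. ?P x}"
  let ?cl = "\<lambda>x. vec_cong n c `` {x}"
  have rel: "(x, y) \<in> vec_cong n c \<longleftrightarrow> x \<in> carrier_vec n \<and> y \<in> carrier_vec n \<and> vcong n c x y" for x y
    by (simp add: vec_cong_def vcong_def)
  have cl_eq: "?cl x = ?cl y \<longleftrightarrow> vcong n c x y" if "x \<in> carrier_vec n" "y \<in> carrier_vec n" for x y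
    using eq_equiv_class_iff[OF equiv_vec_cong that] that rel by blast
  have "?A // vec_cong n c = ?cl ` ?A" by (auto simp: quotient_def)
  also have "\<dots> = ?cl ` ?B"
  proof (intro equalityI subsetI)
    fix X assume "X \<in> ?cl ` ?A"
    then obtain x where x: "x \<in> carrier_vec n" "?P x" "X = ?cl x" by blast
    have b: "vmod c x \<in> box n c" by (rule vmod_in_box[OF c x(1)])
    have "?P (vmod c x)"
      using hq_affine_vcong[OF G v box_carrier[OF b] x(1) vcong_vmod[OF x(1)]] x(2) cong_trans by blast
    moreover have "X = ?cl (vmod c x)"
      using cl_eq[OF x(1) box_carrier[OF b]] vcong_sym[OF vcong_vmod[OF x(1)]] x(3) by simp
    ultimately show "X \<in> ?cl ` ?B" using b by blast
  qed (auto dest: box_carrier)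
  finally have eq: "?A // vec_cong n c = ?cl ` ?B" .
  have "inj_on ?cl ?B"
  proof (rule inj_onI)
    fix x y assume xy: "x \<in> ?B" "y \<in> ?B" "?cl x = ?cl y"
    then have "vcong n c x y" using cl_eq[of x y] box_carrier by blast
    then show "x = y" using xy vcong_box_eq by blast
  qed
  then show ?thesis
    unfolding rep_count_def even_form_dim[OF G] hq_def[symmetric] qf_def[symmetric]
    by (simp add: eq card_image)
qed

lemma rep_count_fourier:
  assumes G: "even_form n G" and v: "v \<in> carrier_vec n" and c: "c > 0"
  shows "of_int c * of_nat (rep_count G v m c) =
    (\<Sum>a\<in>{0..<c}. ec (- of_int (a * m) / of_int c) *
       (\<Sum>x\<in>box n c. ec (of_int (a * (hq G x + v \<bullet> x)) / of_int c)))"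
proof -
  have "(\<Sum>a\<in>{0..<c}. ec (- of_int (a * m) / of_int c) *
      (\<Sum>x\<in>box n c. ec (of_int (a * (hq G x + v \<bullet> x)) / of_int c))) =
    (\<Sum>x\<in>box n c. \<Sum>a\<in>{0..<c}. ec (of_int (a * (hq G x + v \<bullet> x - m)) / of_int c))"
  proof -
    have "ec (- of_int (a * m) / of_int c) * ec (of_int (a * X) / of_int c) =
        ec (of_int (a * (X - m)) / of_int c)" for a X
      unfolding ec_add[symmetric]
      by (rule arg_cong[of _ _ ec]) (simp add: right_diff_distrib diff_divide_distrib)
    then show ?thesis
      unfolding sum_distrib_left by (subst sum.swap) (simp only:)
  qed
  also have "\<dots> = (\<Sum>x\<in>box n c. if [hq G x + v \<bullet> x = m] (mod c) then of_int c else 0)"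
    unfolding sum_ec_residues[OF c] cong_iff_dvd_diff ..
  also have "\<dots> = of_int c * of_nat (rep_count G v m c)"
    unfolding rep_count_eq_card[OF assms]
    by (simp add: sum.inter_filter[symmetric])
  finally show ?thesis by simp
qed

lemma powr_half_nat: "x > 0 \<Longrightarrow> x powr (real n / 2) = sqrt x ^ n"
  by (simp add: powr_half_sqrt[symmetric] powr_realpow[symmetric] powr_powr)

lemma hq_level_inverse:
  fixes G M :: "int mat"
  assumes G: "symm n G" and d: "det G \<noteq> 0" and v: "v \<in> carrier_vec n" and M: "even_form n M"
    and entry: "\<And>i j. i < n \<Longrightarrow> j < n \<Longrightarrow>
      real_of_int (M $$ (i, j)) = real (level G) * inv_mat G $$ (i, j)"
  shows "real (level G) * (map_vec real_of_int v \<bullet> (inv_mat G *\<^sub>v map_vec real_of_int v)) = 2 * of_int (hq M v)"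
proof -
  have Gi: "inv_mat G \<in> carrier_mat n n"
    using inv_mat_props(1)[OF symm_carrier[OF G] d] .
  have Mc: "M \<in> carrier_mat n n" using M by (rule even_form_carrier)
  have "2 * hq M v = v \<bullet> (M *\<^sub>v v)" using qf_eq_hq[OF M v] by (simp add: qf_def)
  then have "2 * real_of_int (hq M v) = real_of_int (v \<bullet> (M *\<^sub>v v))" by linarith
  also have "\<dots> = (\<Sum>i<n. \<Sum>j<n. real_of_int (v $ i) * (real_of_int (M $$ (i, j)) * real_of_int (v $ j)))"
    using Mc v by (simp add: scalar_prod_def sum_distrib_left lessThan_atLeast0)
  also have "\<dots> = (\<Sum>i<n. \<Sum>j<n. real_of_int (v $ i) * (real (level G) * inv_mat G $$ (i, j) * real_of_int (v $ j)))"
    by (intro sum.cong refl) (simp add: entry)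
  also have "\<dots> = real (level G) * (map_vec real_of_int v \<bullet> (inv_mat G *\<^sub>v map_vec real_of_int v))"
    using Gi v by (simp add: scalar_prod_def sum_distrib_left lessThan_atLeast0 mult_ac)
  finally show ?thesis by simp
qed

text \<open>The summand depends on \<open>x\<close> only modulo the reduced denominator
  \<open>c1\<close>, so the large box contributes \<open>g^n\<close> copies. The right-hand side
  then separates what does not depend on \<open>a\<close>: the symbol at \<open>c1\<close> is the
  product of the signs at \<open>c\<close> and \<open>g\<close>, and
  \<open>g^n c1^(n/2) = c^(n/2) g^(n/2)\<close>.\<close>

lemma affine_gauss_sum:
  fixes G :: "int mat" and a c c' :: int
  assumes G: "even_form n G" and d0: "det G \<noteq> 0" and v: "v \<in> carrier_vec n" and c: "c > 0"
    and cop: "coprime (det G) c" and g: "g = gcd a c" and a1: "a1 = a div g" and c1: "c1 = c div g"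
    and c': "[c1 * c' = 1] (mod (a1 * int (level G)))"
    and w: "w = map_vec real_of_int v \<bullet> (inv_mat G *\<^sub>v map_vec real_of_int v)"
  shows "(\<Sum>x\<in>box n c. ec (of_int (a * (hq G x + v \<bullet> x)) / of_int c)) =
    of_real (of_int c powr (real n / 2)) * of_int (kronecker (det G) c) *
    (ec (of_nat n * (1 - of_int (odd_part c1)) / 8) * of_real (of_int g powr (real n / 2)) *
     of_int (kronecker a1 c1) ^ n * of_int (kronecker (det G) g) *
     ec (of_int a / of_int c * ((of_int (c1 * c') - 1) / 2 * w)))"
proof -
  have Gs: "symm n G" using G by (rule even_form_symm)
  have g0: "g > 0" using c by (simp add: g)
  have ag: "a = g * a1" and cg: "c = c1 * g" by (simp_all add: g a1 c1)
  have c10: "c1 > 0" using c g0 unfolding cg by (simp add: zero_less_mult_iff)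
  have cop1: "coprime a1 c1"
    using div_gcd_coprime[of a c] c by (simp add: a1 c1 g)
  have copd: "coprime (det G) c1" "coprime (det G) g" using cop unfolding cg by simp_all
  define N where "N = int (level G)"
  have N0: "N > 0" using level_props(1)[OF symm_carrier[OF Gs] d0] by (simp add: N_def)
  \<comment> \<open>For \<open>a = 0\<close> the modulus is 0 while \<open>c1 = 1\<close>, so the
    hypothesis says \<open>c' = 1\<close> and any \<open>k\<close> will do.\<close>
  obtain k where k: "c1 * c' - 1 = a1 * N * k"
    using c' unfolding N_def cong_iff_dvd_diff by blast
  obtain M where M: "even_form n M" "G * M = int (level G) \<cdot>\<^sub>m 1\<^sub>m n"
    "\<And>i j. i < n \<Longrightarrow> j < n \<Longrightarrow> real_of_int (M $$ (i, j)) = real (level G) * inv_mat G $$ (i, j)"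
    by (rule level_adjoint[OF Gs d0]) (rule that)
  have Nw: "of_int N * w = 2 * of_int (hq M v)"
    using hq_level_inverse[OF Gs d0 v M(1,3)] by (simp add: w N_def)
  let ?F = "\<lambda>x. ec (of_int (a1 * (hq G x + v \<bullet> x)) / of_int c1)"
  have per: "periodic n c1 ?F"
    unfolding periodic_def
    by (intro ballI impI ec_quot_cong cong_mult cong_refl hq_affine_vcong[OF G v])
  have "(\<Sum>x\<in>box n c. ec (of_int (a * (hq G x + v \<bullet> x)) / of_int c)) = (\<Sum>x\<in>box n (c1 * g). ?F x)"
    unfolding cg[symmetric]
  proof (intro sum.cong refl arg_cong[of _ _ ec])
    fix x
    show "of_int (a * (hq G x + v \<bullet> x)) / of_int c = (of_int (a1 * (hq G x + v \<bullet> x)) / of_int c1 :: real)"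
      using g0 c10 by (simp add: ag cg field_simps)
  qed
  also have "\<dots> = of_int g ^ n * (\<Sum>x\<in>box n c1. ?F x)"
    by (rule sum_box_periodic[OF c10 g0 per])
  also have "(\<Sum>x\<in>box n c1. ?F x) = gsum G a1 c1 * ec (of_int (a1 * a1 * k * hq M v) / of_int c1)"
    by (rule complete_square[OF G M(1) M(2)[folded N_def] v c10 k])
  also have "of_int (a1 * a1 * k * hq M v) / of_int c1 =
      of_int a / of_int c * ((of_int (c1 * c') - 1) / 2 * w)"
  proof -
    \<comment> \<open>\<open>N * w = 2 * hq M v\<close> absorbs both the denominator of the inverse
      matrix and the half.\<close>
    have "real_of_int (c1 * c') - 1 = of_int a1 * of_int N * of_int k"
      using arg_cong[OF k, of real_of_int] by simp
    then have "(of_int (c1 * c') - 1) / 2 * w = of_int a1 * of_int k * (of_int N * w) / 2" by simp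
    also have "\<dots> = of_int (a1 * k * hq M v)" unfolding Nw by simp
    finally have "(of_int (c1 * c') - 1) / 2 * w = of_int (a1 * k * hq M v)" .
    then show ?thesis using g0 c10 by (simp only:) (simp add: ag cg field_simps)
  qed
  also have "gsum G a1 c1 = of_int (kronecker (det G) c1) * of_int (kronecker a1 c1) ^ n *
      ec (of_nat n * (1 - of_int (odd_part c1)) / 8) * of_real (sqrt (of_int c1)) ^ n"
    by (rule gsum_formula[OF c10 G cop1 copd(1)])
  also have "kronecker (det G) c1 = kronecker (det G) c * kronecker (det G) g"
    using kronecker_square[OF g0 copd(2)]
    by (simp add: cg kronecker_mult_right[OF c10 g0] mult.assoc)
  finally have main: "(\<Sum>x\<in>box n c. ec (of_int (a * (hq G x + v \<bullet> x)) / of_int c)) =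
      of_int g ^ n * (of_int (kronecker (det G) c * kronecker (det G) g) * of_int (kronecker a1 c1) ^ n *
      ec (of_nat n * (1 - of_int (odd_part c1)) / 8) * of_real (sqrt (of_int c1)) ^ n *
      ec (of_int a / of_int c * ((of_int (c1 * c') - 1) / 2 * w)))" .
  have "of_int g ^ n * sqrt (of_int c1) ^ n = of_int c powr (real n / 2) * of_int g powr (real n / 2)"
  proof -
    have "of_int g ^ n = sqrt (of_int g) ^ n * sqrt (of_int g) ^ n"
      using g0 by (simp add: power_mult_distrib[symmetric])
    then show ?thesis
      using c g0 by (simp add: powr_half_nat) (simp add: cg real_sqrt_mult power_mult_distrib)
  qed
  then have pow: "(of_int g :: complex) ^ n * of_real (sqrt (of_int c1)) ^ n =
      of_real (of_int c powr (real n / 2)) * of_real (of_int g powr (real n / 2))"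
    by (metis of_real_mult of_real_power of_real_of_int_eq)
  have rearrange: "x * (d * dg * ka * ee * s * ph) = x * s * (d * dg * ka * ee * ph)"
    for x d dg ka ee s ph :: complex
    by (simp only: mult_ac)
  show ?thesis
    unfolding main of_int_mult[of "kronecker (det G) c"] rearrange pow by (simp only: mult_ac)
qed

theorem theorem8p1:
  fixes G :: "int mat" and v :: "int vec" and n :: nat and m c :: int
    and c' :: "int \<Rightarrow> int"
  assumes "n \<ge> 1"
    and "G \<in> carrier_mat n n" and "transpose_mat G = G"
    and "even_integral (map_mat real_of_int G)" and "det G \<noteq> 0"
    and "v \<in> carrier_vec n"
    and "c > 0" and "gcd (det G) c = 1"
    and "\<forall>a\<in>{0..<c}. [c div gcd a c * c' a = 1] (mod (a div gcd a c * int (level G)))"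
  shows "(of_nat (rep_count G v m c) :: complex) =
    of_real (real_of_int c powr (real n / 2 - 1)) * of_int (kronecker (det G) c) *
    (\<Sum>a\<in>{0..<c}.
       let g = gcd a c; a1 = a div g; c1 = c div g;
           w = map_vec real_of_int v
       in e (of_nat n * (1 - of_int (odd_part c1)) / 8) *
          of_real (real_of_int g powr (real n / 2)) *
          of_int (kronecker a1 c1) ^ n *
          of_int (kronecker (det G) g) *
          e (of_int a / of_int c *
             ((of_int (c1 * c' a) - 1) / 2 * of_real (w \<bullet> (inv_mat G *\<^sub>v w)) - of_int m)))"
proof -
  have "even (G $$ (i, i))" if i: "i < n" for i
  proof -
    obtain k :: int where "real_of_int (G $$ (i, i)) = 2 * of_int k"
      using assms(2,4) i unfolding even_integral_def by auto
    then have "G $$ (i, i) = 2 * k" by linarith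
    then show ?thesis by simp
  qed
  then have G: "even_form n G" using assms(2,3) by (simp add: even_form_def symm_def)
  have cop: "coprime (det G) c" using assms(8) by (simp add: coprime_iff_gcd_eq_1)
  note c = assms(7)
  define W where "W = map_vec real_of_int v \<bullet> (inv_mat G *\<^sub>v map_vec real_of_int v)"
  define B where "B a = ec (of_nat n * (1 - of_int (odd_part (c div gcd a c))) / 8) *
      of_real (of_int (gcd a c) powr (real n / 2)) *
      of_int (kronecker (a div gcd a c) (c div gcd a c)) ^ n * of_int (kronecker (det G) (gcd a c))" for a
  define P where "P a = of_int a / of_int c * ((of_int (c div gcd a c * c' a) - 1) / 2 * W)" for a
  \<comment> \<open>The factor independent of \<open>a\<close>; dividing it by \<open>c\<close> at
    the end produces the exponent \<open>n/2 - 1\<close>.\<close>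
  define K where "K = of_real (of_int c powr (real n / 2)) * (of_int (kronecker (det G) c) :: complex)"
  have phase: "e (of_int a / of_int c * ((of_int (c div gcd a c * c' a) - 1) / 2 * of_real W - of_int m)) =
      ec (- of_int (a * m) / of_int c) * ec (P a)" for a
  proof -
    have "(of_int a / of_int c * ((of_int (c div gcd a c * c' a) - 1) / 2 * of_real W - of_int m) :: complex) =
        of_real (- of_int (a * m) / of_int c + P a)"
      by (simp add: P_def right_diff_distrib)
    then show ?thesis by (simp only: e_of_real ec_add)
  qed
  have unit: "e (of_nat n * (1 - of_int b) / 8) = ec (of_nat n * (1 - of_int b) / 8)" for b
    using e_of_real[of "of_nat n * (1 - of_int b) / 8"] by simp
  have "of_int c * (of_nat (rep_count G v m c) :: complex) =
      (\<Sum>a\<in>{0..<c}. ec (- of_int (a * m) / of_int c) * (K * (B a * ec (P a))))"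
    unfolding rep_count_fourier[OF G assms(6) c]
  proof (intro sum.cong refl arg_cong2[of _ _ _ _ "(*)"])
    fix a assume "a \<in> {0..<c}"
    then have "[c div gcd a c * c' a = 1] (mod (a div gcd a c * int (level G)))"
      using assms(9) by blast
    then show "(\<Sum>x\<in>box n c. ec (of_int (a * (hq G x + v \<bullet> x)) / of_int c)) = K * (B a * ec (P a))"
      unfolding K_def B_def P_def
      by (rule affine_gauss_sum[OF G assms(5,6) c cop refl refl refl _ W_def])
  qed
  also have "\<dots> = K * (\<Sum>a\<in>{0..<c}. B a * (ec (- of_int (a * m) / of_int c) * ec (P a)))"
    unfolding sum_distrib_left by (intro sum.cong refl) (simp only: mult_ac)
  finally have "(of_nat (rep_count G v m c) :: complex) =
      K / of_int c * (\<Sum>a\<in>{0..<c}. B a * (ec (- of_int (a * m) / of_int c) * ec (P a)))"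
    using c by (simp add: field_simps)
  also have "K / of_int c = of_real (of_int c powr (real n / 2 - 1)) * of_int (kronecker (det G) c)"
    using c by (simp add: K_def powr_diff)
  finally show ?thesis
    by (simp only: Let_def unit W_def[symmetric] phase B_def)
qed

end
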